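(* Let $G$ be a locally trivial bundle of compact Lie groups with essentially abelian fibers. Then for each base point $x_0$ there exist strongly invertible homotopy representations of $G$ with the property that the isotropy representations at $x_0$ (i.e. representations of the isotropy group $G_{x_0}$) which they induce in cohomology are faithful.
   Context: Groupoids $G=(G_1\rightrightarrows G_0)$ are locally compact topological groupoids, with source $s$, target $t$, units $1_x$; the product $gh$ is defined when $sg=th$. A locally trivial bundle of compact Lie groups is a groupoid $G$ over a locally compact Hausdorff base $G_0$ with $s=t$ such that each point of $G_0$ has an open neighborhood $U$ for which $G|_U\simeq K\times U$ as bundles of topological groups over $U$, for some compact Lie group $K$. The isotropy group $G_x$ is the fiber over $x$. A group is essentially abelian if its identity component is abelian. Vector bundles are real or complex, of finite rank. Graded vector bundles $E^\bullet=\bigoplus_n E^{(n)}$ are $\mathbb{Z}$-graded of finite rank (so $E^{(n)}=0$ for $|n|\gg0$); $\operatorname{Hom}^{(n)}(E^\bullet,F^\bullet)$ is the bundle of degree $n$ linear maps between fibers, and $\operatorname{End}^{(n)}(E^\bullet)=\operatorname{Hom}^{(n)}(E^\bullet,E^\bullet)$. For $k\ge 2$, $G_k$ is the space of composable $k$-tuples $(g_1,\dots,g_k)$, $sg_j=tg_{j+1}$; $t_k,s_k:G_k\to G_0$ are $(g_1,\dots,g_k)\mapsto tg_1$ and $\mapsto sg_k$ (with $t_1=t$, $s_1=s$, and $s_0=t_0=\mathrm{id}_{G_0}$). A homotopy representation of $G$ consists of a graded vector bundle $E^\bullet$ over $G_0$ and continuous sections $R_k\in\Gamma(G_k;\operatorname{Hom}^{(1-k)}(s_k^*E^\bullet,t_k^*E^\bullet))$,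 $k\ge0$, such that for every $k\ge0$ $$\sum_{j=1}^{k-1}(-1)^jR_{k-1}(g_1,\dots,g_jg_{j+1},\dots,g_k)=\sum_{j=0}^k(-1)^jR_j(g_1,\dots,g_j)\circ R_{k-j}(g_{j+1},\dots,g_k),$$ and which is moreover unital up to homotopy: there exists a continuous section $\Upsilon\in\Gamma(G_0;\operatorname{End}^{(-1)}(E^\bullet))$ with $R_1(1_x)-\mathrm{id}_{E^\bullet_x}=\partial_x\circ\Upsilon(x)+\Upsilon(x)\circ\partial_x$ for all $x\in G_0$, where $\partial=R_0$ ($\Upsilon$ is not part of the data). Then $\partial\circ\partial=0$, and the maps $R_1(g)$ induce linear maps $H^i(E^\bullet_{sg},\partial_{sg})\to H^i(E^\bullet_{tg},\partial_{tg})$ which respect composition and units; in particular each isotropy group $G_x$ is represented on the cohomology $\bigoplus_i H^i(E^\bullet_x,\partial_x)$; this is the isotropy representation at $x$ induced in cohomology. A homotopy representation is strongly invertible if $R_1:s^*E^\bullet\to t^*E^\bullet$ is an isomorphism of vector bundles over $G_1$. *)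

theory Defs
  imports "HOL-Analysis.Analysis" "HOL-Library.Function_Algebras" "HOL-Algebra.Group"
begin

section \<open>Topological groupoids\<close>

record ('g, 'b) groupoid =
  arrows :: "'g topology"
  objects :: "'b topology"
  src :: "'g \<Rightarrow> 'b"
  tgt :: "'g \<Rightarrow> 'b"
  unit :: "'b \<Rightarrow> 'g"
  ginv :: "'g \<Rightarrow> 'g"
  gmult :: "'g \<Rightarrow> 'g \<Rightarrow> 'g"

locale topological_groupoid =
  fixes G :: "('g, 'b) groupoid"
  assumes src_cont: "continuous_map (arrows G) (objects G) (src G)"
    and tgt_cont: "continuous_map (arrows G) (objects G) (tgt G)"
    and unit_cont: "continuous_map (objects G) (arrows G) (unit G)"
    and ginv_cont: "continuous_map (arrows G) (arrows G) (ginv G)"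
    and gmult_cont: "continuous_map
          (subtopology (prod_topology (arrows G) (arrows G)) {(g, h). src G g = tgt G h})
          (arrows G) (\<lambda>(g, h). gmult G g h)"
    and src_unit: "x \<in> topspace (objects G) \<Longrightarrow> src G (unit G x) = x"
    and tgt_unit: "x \<in> topspace (objects G) \<Longrightarrow> tgt G (unit G x) = x"
    and src_ginv: "g \<in> topspace (arrows G) \<Longrightarrow> src G (ginv G g) = tgt G g"
    and tgt_ginv: "g \<in> topspace (arrows G) \<Longrightarrow> tgt G (ginv G g) = src G g"
    and src_gmult: "\<lbrakk>g \<in> topspace (arrows G); h \<in> topspace (arrows G); src G g = tgt G h\<rbrakk>
          \<Longrightarrow> src G (gmult G g h) = src G h"
    and tgt_gmult: "\<lbrakk>g \<in> topspace (arrows G); h \<in> topspace (arrows G); src G g = tgt G h\<rbrakk>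
          \<Longrightarrow> tgt G (gmult G g h) = tgt G g"
    and gmult_assoc: "\<lbrakk>f \<in> topspace (arrows G); g \<in> topspace (arrows G); h \<in> topspace (arrows G);
            src G f = tgt G g; src G g = tgt G h\<rbrakk>
          \<Longrightarrow> gmult G (gmult G f g) h = gmult G f (gmult G g h)"
    and unit_left: "g \<in> topspace (arrows G) \<Longrightarrow> gmult G (unit G (tgt G g)) g = g"
    and unit_right: "g \<in> topspace (arrows G) \<Longrightarrow> gmult G g (unit G (src G g)) = g"
    and ginv_left: "g \<in> topspace (arrows G) \<Longrightarrow> gmult G (ginv G g) g = unit G (src G g)"
    and ginv_right: "g \<in> topspace (arrows G) \<Longrightarrow> gmult G g (ginv G g) = unit G (tgt G g)"

locale locally_compact_groupoid = topological_groupoid +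
  assumes arrows_locally_compact: "locally_compact_space (arrows G)"
    and objects_locally_compact: "locally_compact_space (objects G)"

definition isotropy_group :: "('g, 'b) groupoid \<Rightarrow> 'b \<Rightarrow> 'g monoid" where
  "isotropy_group G x =
     \<lparr>carrier = {g \<in> topspace (arrows G). src G g = x \<and> tgt G g = x},
      monoid.mult = gmult G, one = unit G x\<rparr>"

definition isotropy_topology :: "('g, 'b) groupoid \<Rightarrow> 'b \<Rightarrow> 'g topology" where
  "isotropy_topology G x = subtopology (arrows G) (carrier (isotropy_group G x))"


section \<open>Compact Lie groups\<close>

text \<open>\<open>Ck_on k n S f\<close>: the function \<open>f\<close> is of class \<open>C\<^sup>k\<close> on the open subset \<open>S\<close> of
  the \<open>n\<close>-dimensional Euclidean space (all iterated partial derivatives up to order \<open>k\<close>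
  exist and are continuous).\<close>

primrec Ck_on :: "nat \<Rightarrow> nat \<Rightarrow> (nat \<Rightarrow> real) set \<Rightarrow> ((nat \<Rightarrow> real) \<Rightarrow> real) \<Rightarrow> bool" where
  "Ck_on 0 n S f \<longleftrightarrow> continuous_map (subtopology (Euclidean_space n) S) euclideanreal f"
| "Ck_on (Suc k) n S f \<longleftrightarrow>
     continuous_map (subtopology (Euclidean_space n) S) euclideanreal f \<and>
     (\<exists>D. \<forall>i<n. (\<forall>x\<in>S. ((\<lambda>t. f (x(i := t))) has_real_derivative D i x) (at (x i))) \<and>
                Ck_on k n S (D i))"

definition smooth_on ::
    "nat \<Rightarrow> nat \<Rightarrow> (nat \<Rightarrow> real) set \<Rightarrow> ((nat \<Rightarrow> real) \<Rightarrow> nat \<Rightarrow> real) \<Rightarrow> bool" where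
  "smooth_on n m S f \<longleftrightarrow> (\<forall>j<m. \<forall>k. Ck_on k n S (\<lambda>x. f x j))"

type_synonym 'a chart = "'a set \<times> ('a \<Rightarrow> nat \<Rightarrow> real)"

definition smooth_atlas :: "'a topology \<Rightarrow> nat \<Rightarrow> 'a chart set \<Rightarrow> bool" where
  "smooth_atlas X n A \<longleftrightarrow>
     \<Union> (fst ` A) = topspace X \<and>
     (\<forall>(U, \<phi>)\<in>A. openin X U \<and> openin (Euclidean_space n) (\<phi> ` U) \<and>
        homeomorphic_map (subtopology X U) (subtopology (Euclidean_space n) (\<phi> ` U)) \<phi>) \<and>
     (\<forall>(U, \<phi>)\<in>A. \<forall>(V, \<psi>)\<in>A. smooth_on n n (\<phi> ` (U \<inter> V)) (\<psi> \<circ> inv_into U \<phi>))"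

definition smooth_map ::
    "'a topology \<Rightarrow> nat \<Rightarrow> 'a chart set \<Rightarrow> 'c topology \<Rightarrow> nat \<Rightarrow> 'c chart set \<Rightarrow> ('a \<Rightarrow> 'c) \<Rightarrow> bool"
  where
  "smooth_map X n A Y m B f \<longleftrightarrow>
     continuous_map X Y f \<and>
     (\<forall>(U, \<phi>)\<in>A. \<forall>(V, \<psi>)\<in>B.
        smooth_on n m (\<phi> ` {x \<in> U. f x \<in> V}) (\<psi> \<circ> f \<circ> inv_into U \<phi>))"

definition product_atlas :: "nat \<Rightarrow> 'a chart set \<Rightarrow> 'c chart set \<Rightarrow> ('a \<times> 'c) chart set" where
  "product_atlas n A B =
     {(U \<times> V, \<lambda>(a, c) i. if i < n then \<phi> a i else \<psi> c (i - n)) | U \<phi> V \<psi>.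
        (U, \<phi>) \<in> A \<and> (V, \<psi>) \<in> B}"

text \<open>Second countability is not required separately: it is automatic for compact manifolds.\<close>

definition compact_lie_group :: "'a monoid \<Rightarrow> 'a topology \<Rightarrow> bool" where
  "compact_lie_group K T \<longleftrightarrow>
     group K \<and> topspace T = carrier K \<and> compact_space T \<and> Hausdorff_space T \<and>
     (\<exists>n A. smooth_atlas T n A \<and>
        smooth_map (prod_topology T T) (n + n) (product_atlas n A A) T n A
          (\<lambda>(a, b). a \<otimes>\<^bsub>K\<^esub> b) \<and>
        smooth_map T n A T n A (\<lambda>a. inv\<^bsub>K\<^esub> a))"

definition essentially_abelian :: "'a monoid \<Rightarrow> 'a topology \<Rightarrow> bool" where
  "essentially_abelian K T \<longleftrightarrow>
     (\<forall>a\<in>connected_component_of_set T \<one>\<^bsub>K\<^esub>. \<forall>b\<in>connected_component_of_set T \<one>\<^bsub>K\<^esub>.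
        a \<otimes>\<^bsub>K\<^esub> b = b \<otimes>\<^bsub>K\<^esub> a)"

text \<open>The model group \<open>K\<close> is sought on the type of arrows. This loses no generality: a model
  group over a nonempty \<open>U\<close> is isomorphic to an isotropy group, and its structure can be
  transported there.\<close>

definition compact_lie_group_bundle :: "('g, 'b) groupoid \<Rightarrow> bool" where
  "compact_lie_group_bundle G \<longleftrightarrow>
     locally_compact_groupoid G \<and> Hausdorff_space (objects G) \<and>
     (\<forall>g\<in>topspace (arrows G). src G g = tgt G g) \<and>
     (\<forall>x\<in>topspace (objects G). \<exists>U K T \<Phi>.
        openin (objects G) U \<and> x \<in> U \<and> compact_lie_group (K :: 'g monoid) T \<and>
        homeomorphic_map (subtopology (arrows G) {g. src G g \<in> U})
          (prod_topology T (subtopology (objects G) U)) \<Phi> \<and>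
        (\<forall>g\<in>topspace (arrows G). src G g \<in> U \<longrightarrow> snd (\<Phi> g) = src G g) \<and>
        (\<forall>y\<in>U. (\<lambda>g. fst (\<Phi> g)) \<in> iso (isotropy_group G y) K))"


section \<open>Vector bundles\<close>

text \<open>Scalars are an arbitrary \<open>real_normed_field\<close>; the instances of interest are \<open>real\<close> and
  \<open>complex\<close>. Fibers are finite-dimensional linear subspaces of the space of scalar sequences.
  Only the linear structure of that ambient space is used; the topology of the total space
  is part of the data, so that every vector bundle of finite rank is isomorphic to one of
  this form.\<close>

type_synonym 'k vect = "nat \<Rightarrow> 'k"

definition vscale :: "'k \<Rightarrow> 'k vect \<Rightarrow> ('k::real_normed_field) vect" where
  "vscale c v = (\<lambda>i. c * v i)"

definition linear_subspace :: "('k::real_normed_field) vect set \<Rightarrow> bool" where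
  "linear_subspace V \<longleftrightarrow>
     0 \<in> V \<and> (\<forall>v\<in>V. \<forall>w\<in>V. v + w \<in> V) \<and> (\<forall>c. \<forall>v\<in>V. vscale c v \<in> V)"

definition linear_from_to ::
    "'k vect set \<Rightarrow> 'k vect set \<Rightarrow> ('k vect \<Rightarrow> ('k::real_normed_field) vect) \<Rightarrow> bool" where
  "linear_from_to V W f \<longleftrightarrow>
     f ` V \<subseteq> W \<and> (\<forall>v\<in>V. \<forall>w\<in>V. f (v + w) = f v + f w) \<and>
     (\<forall>c. \<forall>v\<in>V. f (vscale c v) = vscale c (f v))"

definition coord_space :: "nat \<Rightarrow> ('k::real_normed_field) vect set" where
  "coord_space r = {v. \<forall>i\<ge>r. v i = 0}"

definition basis_vect :: "nat \<Rightarrow> ('k::real_normed_field) vect" where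
  "basis_vect i = (\<lambda>l. if l = i then 1 else 0)"

record ('b, 'k) vbundle =
  fib :: "'b \<Rightarrow> (nat \<Rightarrow> 'k) set"
  total :: "('b \<times> (nat \<Rightarrow> 'k)) topology"

definition local_trivialization ::
    "'b topology \<Rightarrow> ('b, 'k::real_normed_field) vbundle \<Rightarrow> 'b set \<Rightarrow> nat \<Rightarrow>
     ('b \<Rightarrow> 'k vect \<Rightarrow> 'k vect) \<Rightarrow> bool" where
  "local_trivialization X E U r \<phi> \<longleftrightarrow>
     openin X U \<and>
     (\<forall>x\<in>U. linear_from_to (fib E x) (coord_space r) (\<phi> x)) \<and>
     homeomorphic_map (subtopology (total E) (U \<times> UNIV))
       (prod_topology (subtopology X U) (top_of_set (coord_space r))) (\<lambda>(x, v). (x, \<phi> x v))"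

definition vector_bundle :: "'b topology \<Rightarrow> ('b, 'k::real_normed_field) vbundle \<Rightarrow> bool" where
  "vector_bundle X E \<longleftrightarrow>
     (\<forall>x\<in>topspace X. linear_subspace (fib E x)) \<and>
     topspace (total E) = Sigma (topspace X) (fib E) \<and>
     continuous_map (total E) X fst \<and>
     (\<forall>x\<in>topspace X. \<exists>U r \<phi>. x \<in> U \<and> local_trivialization X E U r \<phi>)"

text \<open>\<open>hom_section X Z a b E F f\<close>: given continuous maps \<open>a, b\<close> from \<open>Z\<close> to \<open>X\<close>, \<open>f\<close> is a
  continuous section over \<open>Z\<close> of \<open>Hom(a\<^sup>*E, b\<^sup>*F)\<close>. That bundle is topologized by the local
  trivializations which those of \<open>E\<close> and \<open>F\<close> induce, so continuity of \<open>f\<close> means continuity of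
  its matrix entries with respect to all local trivializations.\<close>

definition hom_section ::
    "'b topology \<Rightarrow> 'z topology \<Rightarrow> ('z \<Rightarrow> 'b) \<Rightarrow> ('z \<Rightarrow> 'b) \<Rightarrow> ('b, 'k) vbundle \<Rightarrow>
     ('b, 'k) vbundle \<Rightarrow> ('z \<Rightarrow> 'k vect \<Rightarrow> ('k::real_normed_field) vect) \<Rightarrow> bool" where
  "hom_section X Z a b E F f \<longleftrightarrow>
     (\<forall>z\<in>topspace Z. linear_from_to (fib E (a z)) (fib F (b z)) (f z)) \<and>
     (\<forall>U r \<phi> V s \<psi>. local_trivialization X E U r \<phi> \<longrightarrow> local_trivialization X F V s \<psi> \<longrightarrow>
        (\<forall>i<r. \<forall>j<s. continuous_map (subtopology Z {z. a z \<in> U \<and> b z \<in> V}) euclidean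
           (\<lambda>z. \<psi> (b z) (f z (inv_into (fib E (a z)) (\<phi> (a z)) (basis_vect i))) j)))"

type_synonym ('b, 'k) graded_bundle = "int \<Rightarrow> ('b, 'k) vbundle"

definition graded_vector_bundle ::
    "'b topology \<Rightarrow> ('b, 'k::real_normed_field) graded_bundle \<Rightarrow> bool" where
  "graded_vector_bundle X E \<longleftrightarrow>
     (\<forall>n. vector_bundle X (E n)) \<and>
     (\<exists>N. \<forall>n. \<bar>n\<bar> > N \<longrightarrow> (\<forall>x\<in>topspace X. fib (E n) x = {0}))"


section \<open>The nerve\<close>

text \<open>A point of \<open>G\<^sub>k\<close> is encoded as \<open>(x, g)\<close> with \<open>g\<close> an extensional function on \<open>{1..k}\<close> and
  \<open>x = s\<^sub>k (g 1, \<dots>, g k)\<close>. For \<open>k \<ge> 1\<close> the component \<open>x\<close> is redundant; for \<open>k = 0\<close> it is the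
  only information. Hence the same encoding also covers the space \<open>G\<^sub>0\<close> of objects.\<close>

type_synonym ('g, 'b) nerve_point = "'b \<times> (nat \<Rightarrow> 'g)"

definition nerve :: "('g, 'b) groupoid \<Rightarrow> nat \<Rightarrow> ('g, 'b) nerve_point topology" where
  "nerve G k =
     subtopology (prod_topology (objects G) (product_topology (\<lambda>_. arrows G) {1..k}))
       {(x, g). (\<forall>j\<in>{1..<k}. src G (g j) = tgt G (g (j + 1))) \<and> (k \<ge> 1 \<longrightarrow> src G (g k) = x)}"

definition nsrc :: "('g, 'b) nerve_point \<Rightarrow> 'b" where
  "nsrc p = fst p"

definition ntgt :: "('g, 'b) groupoid \<Rightarrow> nat \<Rightarrow> ('g, 'b) nerve_point \<Rightarrow> 'b" where
  "ntgt G k p = (if k = 0 then fst p else tgt G (snd p 1))"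

text \<open>\<open>(g\<^sub>j\<^sub>+\<^sub>1, \<dots>, g\<^sub>k)\<close>\<close>

definition back_face :: "nat \<Rightarrow> nat \<Rightarrow> ('g, 'b) nerve_point \<Rightarrow> ('g, 'b) nerve_point" where
  "back_face k j p = (fst p, \<lambda>i\<in>{1..k - j}. snd p (j + i))"

text \<open>\<open>(g\<^sub>1, \<dots>, g\<^sub>j)\<close>; its source is the target of \<open>(g\<^sub>j\<^sub>+\<^sub>1, \<dots>, g\<^sub>k)\<close>.\<close>

definition front_face ::
    "('g, 'b) groupoid \<Rightarrow> nat \<Rightarrow> nat \<Rightarrow> ('g, 'b) nerve_point \<Rightarrow> ('g, 'b) nerve_point" where
  "front_face G k j p = (ntgt G (k - j) (back_face k j p), restrict (snd p) {1..j})"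

text \<open>\<open>(g\<^sub>1, \<dots>, g\<^sub>j g\<^sub>j\<^sub>+\<^sub>1, \<dots>, g\<^sub>k)\<close> for \<open>1 \<le> j < k\<close>\<close>

definition contract ::
    "('g, 'b) groupoid \<Rightarrow> nat \<Rightarrow> nat \<Rightarrow> ('g, 'b) nerve_point \<Rightarrow> ('g, 'b) nerve_point" where
  "contract G k j p =
     (fst p, \<lambda>i\<in>{1..k - 1}. if i < j then snd p i
                             else if i = j then gmult G (snd p j) (snd p (j + 1))
                             else snd p (i + 1))"

definition object_point :: "'b \<Rightarrow> ('g, 'b) nerve_point" where
  "object_point x = (x, \<lambda>i\<in>{1..0}. undefined)"

definition arrow_point :: "('g, 'b) groupoid \<Rightarrow> 'g \<Rightarrow> ('g, 'b) nerve_point" where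
  "arrow_point G g = (src G g, \<lambda>i\<in>{1..1}. g)"


section \<open>Homotopy representations\<close>

text \<open>\<open>R k p n\<close> is the component of \<open>R\<^sub>k(p)\<close> defined on the degree \<open>n\<close> part of the fiber; it
  takes values in degree \<open>n + 1 - k\<close>.\<close>

type_synonym ('g, 'b, 'k) rep_data =
  "nat \<Rightarrow> ('g, 'b) nerve_point \<Rightarrow> int \<Rightarrow> (nat \<Rightarrow> 'k) \<Rightarrow> (nat \<Rightarrow> 'k)"

abbreviation (input) differential ::
    "('g, 'b, 'k) rep_data \<Rightarrow> 'b \<Rightarrow> int \<Rightarrow> 'k vect \<Rightarrow> 'k vect" where
  "differential R x \<equiv> R 0 (object_point x)"

definition unital_up_to_homotopy ::
    "('g, 'b) groupoid \<Rightarrow> ('b, 'k::real_normed_field) graded_bundle \<Rightarrow> ('g, 'b, 'k) rep_data \<Rightarrow> bool"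
  where
  "unital_up_to_homotopy G E R \<longleftrightarrow>
     (\<exists>\<Upsilon>. (\<forall>n. hom_section (objects G) (objects G) id id (E n) (E (n - 1)) (\<lambda>x. \<Upsilon> x n)) \<and>
        (\<forall>x\<in>topspace (objects G). \<forall>n. \<forall>v\<in>fib (E n) x.
           R 1 (arrow_point G (unit G x)) n v - v =
             differential R x (n - 1) (\<Upsilon> x n v) + \<Upsilon> x (n + 1) (differential R x n v)))"

definition homotopy_representation ::
    "('g, 'b) groupoid \<Rightarrow> ('b, 'k::real_normed_field) graded_bundle \<Rightarrow> ('g, 'b, 'k) rep_data \<Rightarrow> bool"
  where
  "homotopy_representation G E R \<longleftrightarrow>
     graded_vector_bundle (objects G) E \<and>
     (\<forall>k n. hom_section (objects G) (nerve G k) nsrc (ntgt G k) (E n) (E (n + 1 - int k))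
              (\<lambda>p. R k p n)) \<and>
     (\<forall>k. \<forall>p\<in>topspace (nerve G k). \<forall>n. \<forall>v\<in>fib (E n) (nsrc p).
        (\<Sum>j\<in>{1..<k}. vscale ((-1) ^ j) (R (k - 1) (contract G k j p) n v)) =
        (\<Sum>j\<le>k. vscale ((-1) ^ j)
           (R j (front_face G k j p) (n + 1 - int (k - j)) (R (k - j) (back_face k j p) n v)))) \<and>
     unital_up_to_homotopy G E R"

text \<open>\<open>R\<^sub>1\<close> is an isomorphism from \<open>s\<^sup>*E\<close> to \<open>t\<^sup>*E\<close>: it has a continuous fiberwise linear
  inverse \<open>Q\<close>.\<close>

definition strongly_invertible ::
    "('g, 'b) groupoid \<Rightarrow> ('b, 'k::real_normed_field) graded_bundle \<Rightarrow> ('g, 'b, 'k) rep_data \<Rightarrow> bool"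
  where
  "strongly_invertible G E R \<longleftrightarrow>
     (\<forall>n. \<exists>Q. hom_section (objects G) (arrows G) (tgt G) (src G) (E n) (E n) Q \<and>
        (\<forall>g\<in>topspace (arrows G).
           (\<forall>v\<in>fib (E n) (src G g). Q g (R 1 (arrow_point G g) n v) = v) \<and>
           (\<forall>w\<in>fib (E n) (tgt G g). R 1 (arrow_point G g) n (Q g w) = w)))"


section \<open>The isotropy representations in cohomology\<close>

definition cocycles ::
    "('b, 'k::real_normed_field) graded_bundle \<Rightarrow> ('g, 'b, 'k) rep_data \<Rightarrow> 'b \<Rightarrow> int \<Rightarrow> 'k vect set"
  where
  "cocycles E R x i = {v \<in> fib (E i) x. differential R x i v = 0}"

definition coboundaries ::
    "('b, 'k::real_normed_field) graded_bundle \<Rightarrow> ('g, 'b, 'k) rep_data \<Rightarrow> 'b \<Rightarrow> int \<Rightarrow> 'k vect set"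
  where
  "coboundaries E R x i = differential R x (i - 1) ` fib (E (i - 1)) x"

definition cohomology_class ::
    "('b, 'k::real_normed_field) graded_bundle \<Rightarrow> ('g, 'b, 'k) rep_data \<Rightarrow> 'b \<Rightarrow> int \<Rightarrow>
     'k vect \<Rightarrow> 'k vect set" where
  "cohomology_class E R x i v = (\<lambda>b. v + b) ` coboundaries E R x i"

definition cohomology ::
    "('b, 'k::real_normed_field) graded_bundle \<Rightarrow> ('g, 'b, 'k) rep_data \<Rightarrow> 'b \<Rightarrow> int \<Rightarrow>
     'k vect set set" where
  "cohomology E R x i = cohomology_class E R x i ` cocycles E R x i"

text \<open>The union below is the class of \<open>R\<^sub>1(g) v\<close> for any representative \<open>v\<close> of \<open>c\<close>.\<close>

definition cohomology_map ::
    "('g, 'b) groupoid \<Rightarrow> ('b, 'k::real_normed_field) graded_bundle \<Rightarrow> ('g, 'b, 'k) rep_data \<Rightarrow>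
     'g \<Rightarrow> int \<Rightarrow> 'k vect set \<Rightarrow> 'k vect set" where
  "cohomology_map G E R g i c =
     (\<Union>v\<in>c. cohomology_class E R (tgt G g) i (R 1 (arrow_point G g) i v))"

text \<open>The direct sum of the cohomology groups is the full product, since the grading is bounded.\<close>

definition total_cohomology ::
    "('b, 'k::real_normed_field) graded_bundle \<Rightarrow> ('g, 'b, 'k) rep_data \<Rightarrow> 'b \<Rightarrow>
     (int \<Rightarrow> 'k vect set) set" where
  "total_cohomology E R x = {c. \<forall>i. c i \<in> cohomology E R x i}"

definition isotropy_representation ::
    "('g, 'b) groupoid \<Rightarrow> ('b, 'k::real_normed_field) graded_bundle \<Rightarrow> ('g, 'b, 'k) rep_data \<Rightarrow>
     'b \<Rightarrow> 'g \<Rightarrow> (int \<Rightarrow> 'k vect set) \<Rightarrow> (int \<Rightarrow> 'k vect set)" where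
  "isotropy_representation G E R x g =
     (\<lambda>c\<in>total_cohomology E R x. \<lambda>i. cohomology_map G E R g i (c i))"

definition faithful_isotropy_representation ::
    "('g, 'b) groupoid \<Rightarrow> ('b, 'k::real_normed_field) graded_bundle \<Rightarrow> ('g, 'b, 'k) rep_data \<Rightarrow>
     'b \<Rightarrow> bool" where
  "faithful_isotropy_representation G E R x \<longleftrightarrow>
     inj_on (isotropy_representation G E R x) (carrier (isotropy_group G x))"

end

(*
The homotopy representations have the form of a two-term complex c : k^N -> k^N of trivial bundles,
with c a function that vanishes at x0 and equals 1 off a small neighbourhood. Let R_1(g) act by
A(g) in both degrees. Where c = 1 the complex is acyclic, so A need not be multiplicative: the
operator R_2(g, h) = A(g)A(h) - A(gh) from degree 1 to degree 0 absorbs the defect, and no higher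
terms are needed. So A may be a faithful representation of the fibre near x0 and the identity far
away, provided that the compact Lie group K has a faithful representation that is null-homotopic as
a map into GL(N, R).

Since K is essentially abelian, an open subgroup H of finite index is a quotient of R^n by a
discrete cocompact subgroup via the exponential map Exp v = lim e(v / 2^k)^(2^k), where e is an
inverse chart. The coordinates with respect to a Z-basis of that lattice give characters that
separate the points of H. Inducing them to K yields monomial matrices; their entries are taken as unit
complex numbers z acting on the quaternions. The path t z + (1 - t) j deforms all entries to j,
and what remains is a constant monomial matrix on each coset, which lies in the identity component:
a matrix J with J^2 = -1 is joined to 1 by cos + sin J, and permutation matrices with quaternionic
entries are products of such J.
*)

theory Submission
  imports Defs "HOL-Homology.Invariance_of_Domain" "HOL-Combinatorics.Permutations"
begin

section \<open>The \<open>l\<^sup>1\<close> norm on Euclidean space\<close>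

text \<open>Representations of a compact group are rigid: a faithful one cannot be deformed to a
  trivial one through representations. So multiplicativity has to yield along the cut-off, while
  strong invertibility keeps every matrix invertible; what is needed is a path of invertible
  matrices, continuous in the group element. This meets a genuine obstruction, since a nontrivial
  character of the circle has nonzero winding number in the invertible complex matrices. Among
  quaternions the obstruction disappears: \<open>j\<close> is orthogonal to the complex plane, so
  the segment from a unit complex number \<open>z\<close> to \<open>j\<close> misses 0. Blocks of
  size four also remove the sign of a coset permutation, because a transposition of such blocks has
  determinant 1. An abelian identity component is what makes one-dimensional characters sufficient.

  The exponential map rests on one second-order estimate for the group law \<open>m\<close> in a
  chart: \<open>m x y - m x' y\<close> differs from \<open>x - x'\<close> by at most
  \<open>C\<close> times the norms of \<open>x - x'\<close> and \<open>y\<close>. Over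
  \<open>2^k\<close> factors of size \<open>2^-k\<close> the errors add up to order
  \<open>2^-k\<close> only.\<close>

abbreviation Euclidean_vectors :: "nat \<Rightarrow> (nat \<Rightarrow> real) set" ("\<V>") where
  "\<V> n \<equiv> topspace (Euclidean_space n)"

text \<open>The sum norm fits arguments that change one coordinate at a time: bounds on the single
  partial derivatives add up to it without a dimensional factor.\<close>

definition l1 :: "nat \<Rightarrow> (nat \<Rightarrow> real) \<Rightarrow> real" where
  "l1 n x = (\<Sum>i<n. \<bar>x i\<bar>)"

definition l1ball :: "nat \<Rightarrow> real \<Rightarrow> (nat \<Rightarrow> real) set" where
  "l1ball n r = {x \<in> \<V> n. l1 n x < r}"

lemma l1_nonneg [simp]: "0 \<le> l1 n x"
  by (simp add: l1_def sum_nonneg)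

lemma l1_zero [simp]: "l1 n 0 = 0"
  by (simp add: l1_def)

lemma l1_triangle: "l1 n (x + y) \<le> l1 n x + l1 n y"
  unfolding l1_def sum.distrib[symmetric] by (intro sum_mono) simp

lemma l1_diff_triangle: "l1 n (x - y) \<le> l1 n x + l1 n y"
  unfolding l1_def sum.distrib[symmetric] by (intro sum_mono) simp

lemma l1_minus_commute: "l1 n (x - y) = l1 n (y - x)"
  by (simp add: l1_def abs_minus_commute)

lemma l1_vscale: "l1 n (vscale c x) = \<bar>c\<bar> * l1 n x"
  by (simp add: l1_def vscale_def abs_mult sum_distrib_left)

lemma abs_le_l1: "i < n \<Longrightarrow> \<bar>x i\<bar> \<le> l1 n x"
  unfolding l1_def by (rule member_le_sum) auto

lemma l1_eq_0D: "x \<in> \<V> n \<Longrightarrow> l1 n x \<le> 0 \<Longrightarrow> x = 0"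
proof
  fix i assume "x \<in> \<V> n" "l1 n x \<le> 0"
  then show "x i = 0 i"
    using abs_le_l1[of i n x] by (cases "i < n") (auto simp: topspace_Euclidean_space)
qed

lemma topspace_Euclidean_space_closed:
  assumes "x \<in> \<V> n" "y \<in> \<V> n"
  shows "x + y \<in> \<V> n" "x - y \<in> \<V> n"
    "vscale c x \<in> \<V> n" "0 \<in> \<V> n"
  using assms by (auto simp: topspace_Euclidean_space vscale_def)

lemma zero_in_Euclidean_space [simp]: "0 \<in> \<V> n"
  by (auto simp: topspace_Euclidean_space)

lemma zero_in_l1ball [simp]: "0 \<in> l1ball n r \<longleftrightarrow> 0 < r"
  by (auto simp: l1ball_def)

lemma continuous_map_Euclidean_proj: "continuous_map (Euclidean_space n) euclideanreal (\<lambda>y. y i)"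
  unfolding Euclidean_space_def
  by (intro continuous_map_from_subtopology continuous_map_product_projection) simp

lemma openin_l1ball_around:
  "openin (Euclidean_space n) {y \<in> \<V> n. l1 n (y - x) < d}"
proof -
  have "continuous_map (Euclidean_space n) euclideanreal (\<lambda>y. l1 n (y - x))"
    unfolding l1_def minus_apply
    by (intro continuous_map_sum continuous_map_real_abs continuous_map_diff
        continuous_map_Euclidean_proj) auto
  from openin_continuous_map_preimage[OF this, of "{..<d}"] show ?thesis
    by simp
qed

lemma openin_l1ball: "openin (Euclidean_space n) (l1ball n r)"
  using openin_l1ball_around[of n 0 r] by (simp add: l1ball_def)

lemma openin_Euclidean_l1D:
  assumes S: "openin (Euclidean_space n) S" and x: "x \<in> S"
  obtains d where "d > 0" "\<And>y. y \<in> \<V> n \<Longrightarrow> l1 n (y - x) < d \<Longrightarrow> y \<in> S"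
proof -
  obtain W where W: "openin (powertop_real UNIV) W" "S = W \<inter> {x. \<forall>i\<ge>n. x i = 0}"
    using S by (auto simp: Euclidean_space_def openin_subtopology)
  obtain X where X: "x \<in> (\<Pi>\<^sub>E i\<in>UNIV. X i)" "\<And>i. openin euclideanreal (X i)" "(\<Pi>\<^sub>E i\<in>UNIV. X i) \<subseteq> W"
    using product_topology_open_contains_basis[OF W(1), of x] x W(2) by blast
  have "\<exists>d>0. ball (x i) d \<subseteq> X i" for i
    using X(1,2) by (metis PiE_UNIV_domain Pi_iff UNIV_I open_contains_ball open_openin)
  then obtain d where d: "\<And>i. d i > 0" "\<And>i. ball (x i) (d i) \<subseteq> X i"
    by metis
  \<comment> \<open>The coordinates from \<open>n\<close> on vanish, so only finitely many of the
    radii matter. The inserted 1 covers \<open>n = 0\<close>.\<close>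
  define D where "D = Min (insert 1 (d ` {..<n}))"
  have D: "D > 0" "\<And>i. i < n \<Longrightarrow> D \<le> d i"
    using d(1) by (auto simp: D_def)
  show thesis
  proof (rule that[OF D(1)])
    fix y assume y: "y \<in> \<V> n" "l1 n (y - x) < D"
    have "y i \<in> X i" for i
    proof (cases "i < n")
      case True
      then have "dist (x i) (y i) < d i"
        using abs_le_l1[OF True, of "y - x"] y(2) D(2)[OF True] by (simp add: dist_real_def)
      then show ?thesis using d(2)[of i] by (meson mem_ball subsetD)
    next
      case False
      then have "y i = x i" using y x W(2) by (auto simp: topspace_Euclidean_space)
      then show ?thesis using d by (metis centre_in_ball subsetD)
    qed
    then show "y \<in> S" using X(3) W(2) y(1) by (auto simp: topspace_Euclidean_space)
  qed
qed

text \<open>The path from \<open>x\<close> to \<open>x'\<close> replaces one coordinate at a time.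
  Its points can have larger norm than both ends, but never more than
  \<open>l1 n x + l1 n x'\<close>, whence the assumption on the sum.\<close>

lemma l1_mean_value:
  fixes h :: "(nat \<Rightarrow> real) \<Rightarrow> real"
  assumes der: "\<And>x i. x \<in> l1ball n \<rho> \<Longrightarrow> i < n \<Longrightarrow>
      ((\<lambda>t. h (x(i := t))) has_real_derivative D i x) (at (x i))"
    and bd: "\<And>x i. x \<in> l1ball n \<rho> \<Longrightarrow> i < n \<Longrightarrow> \<bar>D i x\<bar> \<le> M"
    and x: "x \<in> \<V> n" "x' \<in> \<V> n"
    and less: "l1 n x + l1 n x' < \<rho>"
  shows "\<bar>h x - h x'\<bar> \<le> M * l1 n (x - x')"
proof -
  define y where "y k = (\<lambda>i. if i < k then x' i else x i)" for k :: nat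
  have step: "\<bar>h (y k) - h (y (Suc k))\<bar> \<le> M * \<bar>(x - x') k\<bar>" if k: "k < n" for k
  proof -
    \<comment> \<open>A symmetric interval contains both values whatever their order, and its points
      are bounded by \<open>\<bar>x k\<bar> + \<bar>x' k\<bar>\<close>.\<close>
    define c where "c = max \<bar>x k\<bar> \<bar>x' k\<bar>"
    have ball: "(y k)(k := t) \<in> l1ball n \<rho>" if "t \<in> {-c..c}" for t
    proof -
      have "l1 n ((y k)(k := t)) \<le> l1 n x + l1 n x'"
        unfolding l1_def sum.distrib[symmetric]
        by (intro sum_mono) (use that in \<open>auto simp: y_def c_def\<close>)
      then show ?thesis
        using less x k by (auto simp: l1ball_def y_def topspace_Euclidean_space)
    qed
    have "norm (h ((y k)(k := x k)) - h ((y k)(k := x' k))) \<le> M * norm (x k - x' k)"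
    proof (rule field_differentiable_bound[where S = "{-c..c}" and f = "\<lambda>t. h ((y k)(k := t))" and f' = "\<lambda>t. D k ((y k)(k := t))"])
      fix t assume t: "t \<in> {-c..c}"
      show "((\<lambda>t. h ((y k)(k := t))) has_real_derivative D k ((y k)(k := t))) (at t within {-c..c})"
        using der[OF ball[OF t] k] by (simp add: has_field_derivative_at_within)
      show "norm (D k ((y k)(k := t))) \<le> M"
        using bd[OF ball[OF t] k] by simp
    qed (auto simp: c_def)
    moreover have "(y k)(k := x k) = y k" "(y k)(k := x' k) = y (Suc k)"
      by (auto simp: y_def)
    ultimately show ?thesis by simp
  qed
  have "\<bar>h (y 0) - h (y k)\<bar> \<le> M * (\<Sum>i<k. \<bar>(x - x') i\<bar>)" if "k \<le> n" for k
    using that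
  proof (induction k)
    case (Suc k)
    then show ?case using step[of k] by (simp add: distrib_left)
  qed simp
  moreover have "y 0 = x" "y n = x'"
    using x by (auto simp: y_def topspace_Euclidean_space)
  ultimately show ?thesis
    by (metis l1_def order_refl)
qed

text \<open>The same gluing as in \<open>product_atlas\<close>, so that the product chart at a pair
  of points is \<open>pair_coords\<close> of their coordinates.\<close>

definition pair_coords :: "nat \<Rightarrow> (nat \<Rightarrow> real) \<Rightarrow> (nat \<Rightarrow> real) \<Rightarrow> nat \<Rightarrow> real" where
  "pair_coords n a b i = (if i < n then a i else b (i - n))"

lemma pair_coords_mem:
  "a \<in> \<V> n \<Longrightarrow> b \<in> \<V> n \<Longrightarrow>
    pair_coords n a b \<in> topspace (Euclidean_space (n + n))"
  by (auto simp: pair_coords_def topspace_Euclidean_space)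

lemma l1_pair_coords:
  "l1 (n + n) (pair_coords n a b - pair_coords n a' b') = l1 n (a - a') + l1 n (b - b')"
proof -
  let ?w = "pair_coords n a b - pair_coords n a' b'"
  have "x \<in> {..<n} \<union> (+) n ` {..<n}" if "x < n + n" for x
    using that image_eqI[of x "(+) n" "x - n" "{..<n}"] by (cases "x < n") auto
  then have "{..<n + n} = {..<n} \<union> (+) n ` {..<n}"
    by auto
  then have "l1 (n + n) ?w = (\<Sum>i<n. \<bar>?w i\<bar>) + (\<Sum>i\<in>(+) n ` {..<n}. \<bar>?w i\<bar>)"
    unfolding l1_def by (simp only: ) (rule sum.union_disjoint, auto)
  also have "(\<Sum>i\<in>(+) n ` {..<n}. \<bar>?w i\<bar>) = l1 n (b - b')"
    by (subst sum.reindex) (auto simp: pair_coords_def l1_def)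
  also have "(\<Sum>i<n. \<bar>?w i\<bar>) = l1 n (a - a')"
    by (auto simp: pair_coords_def l1_def)
  finally show ?thesis .
qed

lemma continuous_near_l1:
  fixes f :: "(nat \<Rightarrow> real) \<Rightarrow> real"
  assumes "continuous_map (subtopology (Euclidean_space N) S) euclideanreal f"
    and "z \<in> S" "z \<in> topspace (Euclidean_space N)"
  obtains d where "d > 0"
    "\<And>y. y \<in> S \<Longrightarrow> y \<in> topspace (Euclidean_space N) \<Longrightarrow> l1 N (y - z) < d \<Longrightarrow> \<bar>f y\<bar> < \<bar>f z\<bar> + 1"
proof -
  have "openin (subtopology (Euclidean_space N) S)
     {y \<in> topspace (subtopology (Euclidean_space N) S). f y \<in> {f z - 1<..<f z + 1}}"
    by (rule openin_continuous_map_preimage[OF assms(1)]) auto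
  then obtain W where W: "openin (Euclidean_space N) W"
     "{y \<in> topspace (subtopology (Euclidean_space N) S). f y \<in> {f z - 1<..<f z + 1}} = W \<inter> S"
    unfolding openin_subtopology by blast
  have "z \<in> W"
  proof -
    have "z \<in> W \<inter> S" unfolding W(2)[symmetric] using assms(2,3) by simp
    then show ?thesis by blast
  qed
  from openin_Euclidean_l1D[OF W(1) this] obtain d where
    d: "d > 0" "\<And>y. y \<in> topspace (Euclidean_space N) \<Longrightarrow> l1 N (y - z) < d \<Longrightarrow> y \<in> W" by metis
  show thesis
  proof (rule that[OF d(1)])
    fix y assume "y \<in> S" "y \<in> topspace (Euclidean_space N)" "l1 N (y - z) < d"
    then have "f y \<in> {f z - 1<..<f z + 1}" using d W(2) by blast
    then show "\<bar>f y\<bar> < \<bar>f z\<bar> + 1" by auto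
  qed
qed

text \<open>The double difference vanishes for \<open>x = x'\<close> and for \<open>y = 0\<close>,
  so it is governed by the mixed second partials: the mean value estimate in \<open>y\<close> bounds
  the change of each first partial in an \<open>x\<close>-direction, and the estimate in
  \<open>x\<close> then integrates these bounds.\<close>

lemma C2_mixed_difference:
  fixes f :: "(nat \<Rightarrow> real) \<Rightarrow> real"
  assumes C2: "Ck_on 2 (n + n) S f" and p: "p \<in> \<V> n"
    and r: "r > 0"
    and S: "\<And>x y. x \<in> l1ball n r \<Longrightarrow> y \<in> l1ball n r \<Longrightarrow> pair_coords n (x + p) (y + p) \<in> S"
  obtains M r' where "M \<ge> 0" "r' > 0" "r' \<le> r"
    "\<And>x x' y. x \<in> l1ball n r' \<Longrightarrow> x' \<in> l1ball n r' \<Longrightarrow> y \<in> l1ball n r' \<Longrightarrow>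
      \<bar>f (pair_coords n (x + p) (y + p)) - f (pair_coords n (x' + p) (y + p))
        - (f (pair_coords n (x + p) p) - f (pair_coords n (x' + p) p))\<bar> \<le> M * l1 n (x - x') * l1 n y"
proof -
  obtain D where D: "\<And>i z. i < n + n \<Longrightarrow> z \<in> S \<Longrightarrow> ((\<lambda>t. f (z(i := t))) has_real_derivative D i z) (at (z i))"
     "\<And>i. i < n + n \<Longrightarrow> Ck_on 1 (n + n) S (D i)"
    using C2[unfolded numeral_2_eq_2 Ck_on.simps(2)[of "Suc 0"], folded One_nat_def] by blast
  have "\<exists>E. \<forall>l<n + n. (\<forall>z\<in>S. ((\<lambda>t. D i (z(l := t))) has_real_derivative E l z) (at (z l))) \<and>
         continuous_map (subtopology (Euclidean_space (n + n)) S) euclideanreal (E l)" if "i < n + n" for i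
    using D(2)[OF that] by auto
  then obtain E where E: "\<And>i l z. i < n + n \<Longrightarrow> l < n + n \<Longrightarrow> z \<in> S \<Longrightarrow> ((\<lambda>t. D i (z(l := t))) has_real_derivative E i l z) (at (z l))"
     "\<And>i l. i < n + n \<Longrightarrow> l < n + n \<Longrightarrow> continuous_map (subtopology (Euclidean_space (n + n)) S) euclideanreal (E i l)"
    by metis
  define z0 where "z0 = pair_coords n p p"
  have z0: "z0 \<in> S" "z0 \<in> topspace (Euclidean_space (n + n))"
    using S[of 0 0] r p by (auto simp: z0_def pair_coords_mem)
  have "\<exists>d>0. \<forall>y. y \<in> S \<longrightarrow> y \<in> topspace (Euclidean_space (n + n)) \<longrightarrow> l1 (n + n) (y - z0) < d
          \<longrightarrow> \<bar>E i l y\<bar> < \<bar>E i l z0\<bar> + 1" if "i < n + n" "l < n + n" for i l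
    using continuous_near_l1[OF E(2)[OF that] z0] by metis
  then obtain d where d: "\<And>i l. i < n + n \<Longrightarrow> l < n + n \<Longrightarrow> d i l > 0"
    "\<And>i l y. i < n + n \<Longrightarrow> l < n + n \<Longrightarrow> y \<in> S \<Longrightarrow> y \<in> topspace (Euclidean_space (n + n)) \<Longrightarrow>
       l1 (n + n) (y - z0) < d i l \<Longrightarrow> \<bar>E i l y\<bar> < \<bar>E i l z0\<bar> + 1"
    by metis
  let ?P = "{..<n + n} \<times> {..<n + n}"
  \<comment> \<open>One radius on which all second partials are bounded by \<open>M\<close>: near
    \<open>z0\<close> their absolute values exceed those at \<open>z0\<close> by less than
    1.\<close>
  define d0 where "d0 = Min (insert r ((\<lambda>(i, l). d i l) ` ?P))"
  define M where "M = Max (insert 0 ((\<lambda>(i, l). \<bar>E i l z0\<bar> + 1) ` ?P))"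
  have d0: "d0 > 0" "d0 \<le> r"
    using d(1) r by (auto simp: d0_def)
  have d0le: "d0 \<le> d i l" if "i < n + n" "l < n + n" for i l
    unfolding d0_def by (rule Min_le) (use that in \<open>auto simp: image_iff\<close>)
  have M: "\<bar>E i l z0\<bar> + 1 \<le> M" if "i < n + n" "l < n + n" for i l
    unfolding M_def by (rule Max_ge) (use that in \<open>auto simp: image_iff\<close>)
  have M0: "M \<ge> 0" by (simp add: M_def)
  \<comment> \<open>Half of \<open>d0\<close>, because the norm of a pair is the sum of the norms of
    its components.\<close>
  define \<rho> where "\<rho> = d0 / 2"
  have \<rho>: "\<rho> > 0" "\<rho> \<le> r" "\<rho> + \<rho> = d0" using d0 by (auto simp: \<rho>_def)
  let ?c = "\<lambda>x y. pair_coords n (x + p) (y + p)"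
  have cS: "?c x y \<in> S" if "x \<in> l1ball n \<rho>" "y \<in> l1ball n \<rho>" for x y
    using S that \<rho>(2) by (auto simp: l1ball_def)
  have Ebd: "\<bar>E i l (?c x y)\<bar> \<le> M" if "x \<in> l1ball n \<rho>" "y \<in> l1ball n \<rho>" "i < n + n" "l < n + n" for x y i l
  proof -
    have "l1 (n + n) (?c x y - z0) = l1 n x + l1 n y"
      unfolding z0_def l1_pair_coords by simp
    also have "\<dots> < d i l" using d0le[OF that(3,4)] that(1,2) \<rho>(3) by (auto simp: l1ball_def)
    finally have "l1 (n + n) (?c x y - z0) < d i l" .
    moreover have "?c x y \<in> topspace (Euclidean_space (n + n))"
      using that p by (auto simp: l1ball_def intro!: pair_coords_mem topspace_Euclidean_space_closed(1))
    ultimately have "\<bar>E i l (?c x y)\<bar> < \<bar>E i l z0\<bar> + 1"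
      using d(2)[OF that(3,4) cS[OF that(1,2)]] by blast
    with M[OF that(3,4)] show ?thesis by linarith
  qed
  have upd1: "(?c x y)(i := s) = ?c (x(i := s - p i)) y" if "i < n" for x y i s
    using that by (auto simp: pair_coords_def fun_eq_iff)
  have upd2: "(?c x y)(n + i := s) = ?c x (y(i := s - p i))" for x y i s
    by (auto simp: pair_coords_def fun_eq_iff)
  have der1: "((\<lambda>t. f (?c (x(i := t)) y)) has_real_derivative D i (?c x y)) (at (x i))"
    if "x \<in> l1ball n \<rho>" "y \<in> l1ball n \<rho>" "i < n" for x y i
  proof -
    have "((\<lambda>s. f (?c (x(i := s - p i)) y)) has_real_derivative D i (?c x y)) (at (x i + p i))"
      using D(1)[of i "?c x y"] cS[OF that(1,2)] that(3) by (simp only: upd1) (simp add: pair_coords_def)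
    then show ?thesis
      by (subst (asm) DERIV_shift) simp
  qed
  have der2: "((\<lambda>t. D i (?c x (y(l := t)))) has_real_derivative E i (n + l) (?c x y)) (at (y l))"
    if "x \<in> l1ball n \<rho>" "y \<in> l1ball n \<rho>" "i < n" "l < n" for x y i l
  proof -
    have "((\<lambda>s. D i (?c x (y(l := s - p l)))) has_real_derivative E i (n + l) (?c x y)) (at (y l + p l))"
      using E(1)[of i "n + l" "?c x y"] cS[OF that(1,2)] that(3,4) by (simp only: upd2) (simp add: pair_coords_def)
    then show ?thesis
      by (subst (asm) DERIV_shift) simp
  qed
  have Ddiff: "\<bar>D i (?c x y) - D i (?c x 0)\<bar> \<le> M * l1 n y"
    if "x \<in> l1ball n \<rho>" "y \<in> l1ball n \<rho>" "i < n" for x y i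
    using l1_mean_value[of n \<rho> "\<lambda>y. D i (?c x y)" "\<lambda>l y. E i (n + l) (?c x y)" M y 0]
      der2 Ebd that by (auto simp: l1ball_def)
  \<comment> \<open>A second halving provides \<open>l1 n x + l1 n x' < \<rho>\<close> for
    \<open>l1_mean_value\<close>.\<close>
  have fin: "\<bar>f (?c x y) - f (?c x 0) - (f (?c x' y) - f (?c x' 0))\<bar> \<le> (M * l1 n y) * l1 n (x - x')"
    if "x \<in> l1ball n (\<rho> / 2)" "x' \<in> l1ball n (\<rho> / 2)" "y \<in> l1ball n (\<rho> / 2)" for x x' y
  proof (rule l1_mean_value[where h = "\<lambda>x. f (?c x y) - f (?c x 0)" and D = "\<lambda>i x. D i (?c x y) - D i (?c x 0)" and \<rho> = \<rho>])
    have y: "y \<in> l1ball n \<rho>" using that \<rho>(1) by (auto simp: l1ball_def)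
    show "((\<lambda>t. f (?c (x(i := t)) y) - f (?c (x(i := t)) 0)) has_real_derivative
           D i (?c x y) - D i (?c x 0)) (at (x i))" if "x \<in> l1ball n \<rho>" "i < n" for x i
      by (intro DERIV_diff der1) (use that y \<rho>(1) in auto)
    show "\<bar>D i (?c x y) - D i (?c x 0)\<bar> \<le> M * l1 n y" if "x \<in> l1ball n \<rho>" "i < n" for x i
      using Ddiff that y by blast
  qed (use that in \<open>auto simp: l1ball_def\<close>)
  show thesis
  proof (rule that[of M "\<rho> / 2"])
    fix x x' y assume *: "x \<in> l1ball n (\<rho> / 2)" "x' \<in> l1ball n (\<rho> / 2)" "y \<in> l1ball n (\<rho> / 2)"
    show "\<bar>f (?c x y) - f (?c x' y) - (f (pair_coords n (x + p) p) - f (pair_coords n (x' + p) p))\<bar>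
            \<le> M * l1 n (x - x') * l1 n y"
      using fin[OF *] by (simp add: algebra_simps)
  qed (use M0 \<rho> in auto)
qed

section \<open>Charts of a Lie group at the identity\<close>

locale compact_top_group = group K for K :: "'a monoid" (structure) +
  fixes T :: "'a topology"
  assumes topspace_eq: "topspace T = carrier K"
    and mult_cont: "continuous_map (prod_topology T T) T (\<lambda>(a, b). a \<otimes> b)"
    and inv_cont: "continuous_map T T (\<lambda>a. inv a)"
    and compact: "compact_space T"
    and Hausdorff: "Hausdorff_space T"
begin

lemma continuous_map_mult:
  "continuous_map X T f \<Longrightarrow> continuous_map X T g \<Longrightarrow> continuous_map X T (\<lambda>x. f x \<otimes> g x)"
  using continuous_map_compose[OF _ mult_cont, of X "\<lambda>x. (f x, g x)"]
  by (simp add: continuous_map_paired o_def)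

lemma continuous_map_inv:
  "continuous_map X T f \<Longrightarrow> continuous_map X T (\<lambda>x. inv (f x))"
  using continuous_map_compose[OF _ inv_cont, of X f] by (simp add: o_def)

end

lemma compact_lie_group_imp_compact_top_group:
  "compact_lie_group K T \<Longrightarrow> compact_top_group K T"
  by (auto simp: compact_lie_group_def compact_top_group_def compact_top_group_axioms_def smooth_map_def)

lemma l1ball_pair_nhd:
  assumes F: "continuous_map (prod_topology (subtopology (Euclidean_space n) (l1ball n d))
      (subtopology (Euclidean_space n) (l1ball n d))) T (\<lambda>(x, y). F x y)"
    and W: "openin T W" "F 0 0 \<in> W" and d: "d > 0"
  obtains r where "r > 0" "r \<le> d" "\<And>x y. x \<in> l1ball n r \<Longrightarrow> y \<in> l1ball n r \<Longrightarrow> F x y \<in> W"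
proof -
  let ?E = "subtopology (Euclidean_space n) (l1ball n d)"
  have top: "topspace ?E = l1ball n d" by (auto simp: l1ball_def)
  have "openin (prod_topology ?E ?E) {z \<in> topspace (prod_topology ?E ?E). (\<lambda>(x, y). F x y) z \<in> W}"
    by (rule openin_continuous_map_preimage[OF F W(1)])
  moreover have "(0, 0) \<in> {z \<in> topspace (prod_topology ?E ?E). (\<lambda>(x, y). F x y) z \<in> W}"
    using W(2) d by (simp only: topspace_prod_topology top) auto
  ultimately obtain P Q where PQ: "openin ?E P" "openin ?E Q" "0 \<in> P" "0 \<in> Q"
      "P \<times> Q \<subseteq> {z \<in> topspace (prod_topology ?E ?E). (\<lambda>(x, y). F x y) z \<in> W}"
    unfolding openin_prod_topology_alt by meson
  have "openin (Euclidean_space n) P" "openin (Euclidean_space n) Q"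
    using PQ(1,2) openin_l1ball openin_trans_full by blast+
  from openin_Euclidean_l1D[OF this(1) PQ(3)] openin_Euclidean_l1D[OF this(2) PQ(4)]
  obtain a b where a: "a > 0" "\<And>y. y \<in> \<V> n \<Longrightarrow> l1 n (y - 0) < a \<Longrightarrow> y \<in> P"
    and b: "b > 0" "\<And>y. y \<in> \<V> n \<Longrightarrow> l1 n (y - 0) < b \<Longrightarrow> y \<in> Q"
    by metis
  show thesis
  proof (rule that[of "min d (min a b)"])
    fix x y assume "x \<in> l1ball n (min d (min a b))" "y \<in> l1ball n (min d (min a b))"
    then have "x \<in> P" "y \<in> Q" using a(2)[of x] b(2)[of y] by (auto simp: l1ball_def)
    then show "F x y \<in> W" using subsetD[OF PQ(5), of "(x, y)"] by simp
  qed (use a b d in auto)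
qed

text \<open>\<open>e\<close> is an inverse chart centred at the identity, and \<open>m\<close> is the group law in this chart.\<close>

locale local_chart_group = compact_top_group +
  fixes n :: nat and e :: "(nat \<Rightarrow> real) \<Rightarrow> 'a" and m :: "(nat \<Rightarrow> real) \<Rightarrow> (nat \<Rightarrow> real) \<Rightarrow> nat \<Rightarrow> real"
    and \<delta> r C :: real
  assumes r_pos: "0 < r" and r_le: "r \<le> \<delta>" and C_nonneg: "0 \<le> C"
    and e_inj: "inj_on e (l1ball n \<delta>)"
    and e_cont: "continuous_map (subtopology (Euclidean_space n) (l1ball n \<delta>)) T e"
    and e_open: "openin (Euclidean_space n) S \<Longrightarrow> S \<subseteq> l1ball n \<delta> \<Longrightarrow> openin T (e ` S)"
    and e_zero: "e 0 = \<one>"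
    and m_ball: "x \<in> l1ball n r \<Longrightarrow> y \<in> l1ball n r \<Longrightarrow> m x y \<in> l1ball n \<delta>"
    and e_mult: "x \<in> l1ball n r \<Longrightarrow> y \<in> l1ball n r \<Longrightarrow> e x \<otimes> e y = e (m x y)"
    and m_bilinear: "x \<in> l1ball n r \<Longrightarrow> x' \<in> l1ball n r \<Longrightarrow> y \<in> l1ball n r \<Longrightarrow>
        l1 n (m x y - m x' y - (x - x')) \<le> C * l1 n (x - x') * l1 n y"

text \<open>In a chart centred at the identity the group law satisfies \<open>m x 0 = x\<close>, so
  the terms of \<open>C2_mixed_difference\<close> without \<open>y\<close> contribute
  \<open>x - x'\<close>. The estimate that remains is \<open>m_bilinear\<close>, with
  \<open>C\<close> the sum of the bounds for the single coordinates.\<close>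

lemma compact_lie_group_chart:
  assumes K: "compact_lie_group K T"
  obtains n e m \<delta> r C where "local_chart_group K T n e m \<delta> r C"
proof -
  interpret compact_top_group K T
    by (rule compact_lie_group_imp_compact_top_group[OF K])
  obtain n A where A: "smooth_atlas T n A"
    and sm: "smooth_map (prod_topology T T) (n + n) (product_atlas n A A) T n A (\<lambda>(a, b). a \<otimes>\<^bsub>K\<^esub> b)"
    using K by (auto simp: compact_lie_group_def)
  have "\<one>\<^bsub>K\<^esub> \<in> \<Union> (fst ` A)" using A topspace_eq by (auto simp: smooth_atlas_def)
  then obtain U \<phi> where U: "(U, \<phi>) \<in> A" "\<one>\<^bsub>K\<^esub> \<in> U" by auto
  have Uo: "openin T U" and \<phi>U: "openin (Euclidean_space n) (\<phi> ` U)"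
    and hom: "homeomorphic_map (subtopology T U) (subtopology (Euclidean_space n) (\<phi> ` U)) \<phi>"
    using A U(1) by (auto simp: smooth_atlas_def)
  have UK: "U \<subseteq> carrier K" using Uo openin_subset topspace_eq by blast
  have topU: "topspace (subtopology T U) = U" using UK topspace_eq by auto
  have inj: "inj_on \<phi> U" using homeomorphic_imp_injective_map[OF hom] topU by simp
  have top\<phi>: "topspace (subtopology (Euclidean_space n) (\<phi> ` U)) = \<phi> ` U"
    using openin_subset[OF \<phi>U] by auto
  \<comment> \<open>The atlas conditions speak of \<open>inv_into\<close>, so the inverse chart is
    taken in this form and inherits continuity from the abstract inverse \<open>g\<close>.\<close>
  define \<psi> where "\<psi> = inv_into U \<phi>"
  obtain g where g: "homeomorphic_maps (subtopology T U) (subtopology (Euclidean_space n) (\<phi> ` U)) \<phi> g"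
    using hom homeomorphic_map_maps by blast
  have \<psi>_cont: "continuous_map (subtopology (Euclidean_space n) (\<phi> ` U)) (subtopology T U) \<psi>"
  proof (rule continuous_map_eq)
    show "continuous_map (subtopology (Euclidean_space n) (\<phi> ` U)) (subtopology T U) g"
      using g by (simp add: homeomorphic_maps_def)
    fix x assume "x \<in> topspace (subtopology (Euclidean_space n) (\<phi> ` U))"
    then have "x \<in> \<phi> ` U" by (simp add: top\<phi>)
    then obtain u where "u \<in> U" "x = \<phi> u" by auto
    then show "g x = \<psi> x" using g inj UK topspace_eq by (auto simp: homeomorphic_maps_def \<psi>_def)
  qed
  have \<phi>_cont: "continuous_map (subtopology T U) (Euclidean_space n) \<phi>"
    using hom continuous_map_in_subtopology homeomorphic_imp_continuous_map by blast
  define p where "p = \<phi> \<one>\<^bsub>K\<^esub>"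
  have p: "p \<in> \<V> n" "p \<in> \<phi> ` U"
    using U(2) openin_subset[OF \<phi>U] by (auto simp: p_def)
  obtain \<delta> where \<delta>: "\<delta> > 0" "\<And>y. y \<in> \<V> n \<Longrightarrow> l1 n (y - p) < \<delta> \<Longrightarrow> y \<in> \<phi> ` U"
    using openin_Euclidean_l1D[OF \<phi>U p(2)] by metis
  define e where "e x = \<psi> (x + p)" for x
  have xp: "x + p \<in> \<phi> ` U" if "x \<in> l1ball n \<delta>" for x
    using that p(1) by (intro \<delta>(2)) (auto simp: l1ball_def intro: topspace_Euclidean_space_closed(1))
  have \<phi>e: "\<phi> (e x) = x + p" if "x \<in> l1ball n \<delta>" for x
    using xp[OF that] by (simp add: e_def \<psi>_def f_inv_into_f)
  have eU: "e x \<in> U" if "x \<in> l1ball n \<delta>" for x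
    using xp[OF that] by (simp add: e_def \<psi>_def inv_into_into)
  have e_inj: "inj_on e (l1ball n \<delta>)"
    by (rule inj_onI) (metis \<phi>e add_right_cancel)
  have e0: "e 0 = \<one>\<^bsub>K\<^esub>" using inj U(2) by (simp add: e_def \<psi>_def p_def)
  have shift: "continuous_map (Euclidean_space n) (Euclidean_space n) (\<lambda>x. x + q)"
    if "q \<in> \<V> n" for q
    unfolding plus_fun_def using that
    by (intro continuous_map_Euclidean_space_add continuous_map_id[unfolded id_def]) auto
  have e_cont: "continuous_map (subtopology (Euclidean_space n) (l1ball n \<delta>)) T e"
  proof -
    have "continuous_map (subtopology (Euclidean_space n) (l1ball n \<delta>)) (subtopology (Euclidean_space n) (\<phi> ` U)) (\<lambda>x. x + p)"
      by (rule continuous_map_into_subtopology) (use xp shift[OF p(1)] in \<open>auto intro: continuous_map_from_subtopology\<close>)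
    from continuous_map_compose[OF this \<psi>_cont] have "continuous_map (subtopology (Euclidean_space n) (l1ball n \<delta>)) (subtopology T U) e"
      by (simp add: o_def e_def[abs_def])
    then show ?thesis using continuous_map_in_subtopology by blast
  qed
  have e_open: "openin T (e ` S)" if S: "openin (Euclidean_space n) S" "S \<subseteq> l1ball n \<delta>" for S
  proof -
    have "openin (Euclidean_space n) {x \<in> \<V> n. x + - p \<in> S}"
      by (rule openin_continuous_map_preimage[OF shift S(1)]) (use p in \<open>auto simp: topspace_Euclidean_space\<close>)
    then have "openin (subtopology T U) {u \<in> topspace (subtopology T U). \<phi> u \<in> {x \<in> \<V> n. x + - p \<in> S}}"
      by (rule openin_continuous_map_preimage[OF \<phi>_cont])
    moreover have "{u \<in> topspace (subtopology T U). \<phi> u \<in> {x \<in> \<V> n. x + - p \<in> S}} = e ` S"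
    proof (intro equalityI subsetI)
      fix u assume "u \<in> {u \<in> topspace (subtopology T U). \<phi> u \<in> {x \<in> \<V> n. x + - p \<in> S}}"
      then have u: "u \<in> U" "\<phi> u - p \<in> S" by auto
      then have "u = e (\<phi> u - p)" using inj by (simp add: e_def \<psi>_def)
      with u show "u \<in> e ` S" by blast
    next
      fix u assume "u \<in> e ` S"
      then obtain x where x: "x \<in> S" "u = e x" by auto
      with S(2) have "u \<in> U" "\<phi> u = x + p" using eU \<phi>e by auto
      moreover from this have "x + p \<in> \<V> n" using openin_subset[OF \<phi>U] by force
      ultimately show "u \<in> {u \<in> topspace (subtopology T U). \<phi> u \<in> {x \<in> \<V> n. x + - p \<in> S}}"
        using x topU by auto
    qed
    ultimately show ?thesis using Uo openin_trans_full by fastforce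
  qed
  define m where "m x y = \<phi> (e x \<otimes>\<^bsub>K\<^esub> e y) - p" for x y
  let ?E = "subtopology (Euclidean_space n) (l1ball n \<delta>)"
  have "continuous_map (prod_topology ?E ?E) T (\<lambda>z. e (fst z) \<otimes>\<^bsub>K\<^esub> e (snd z))"
    by (intro continuous_map_mult continuous_map_compose[OF _ e_cont, unfolded o_def]
         continuous_map_fst continuous_map_snd)
  then have mc: "continuous_map (prod_topology ?E ?E) T (\<lambda>(x, y). e x \<otimes>\<^bsub>K\<^esub> e y)"
    by (simp add: case_prod_unfold)
  have "openin T (e ` l1ball n \<delta>)" by (rule e_open) (auto simp: openin_l1ball)
  moreover have "e 0 \<otimes>\<^bsub>K\<^esub> e 0 \<in> e ` l1ball n \<delta>" using imageI[of 0 "l1ball n \<delta>" e] \<delta>(1) by (simp add: e0)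
  ultimately obtain r0 where r0: "r0 > 0" "r0 \<le> \<delta>"
     "\<And>x y. x \<in> l1ball n r0 \<Longrightarrow> y \<in> l1ball n r0 \<Longrightarrow> e x \<otimes>\<^bsub>K\<^esub> e y \<in> e ` l1ball n \<delta>"
    using l1ball_pair_nhd[OF mc _ _ \<delta>(1)] by metis
  have sub: "x \<in> l1ball n \<delta>" if "x \<in> l1ball n s" "s \<le> r0" for x s
    using that r0(2) by (auto simp: l1ball_def)
  have m1: "m x y \<in> l1ball n \<delta>" "e x \<otimes>\<^bsub>K\<^esub> e y = e (m x y)"
    if xy: "x \<in> l1ball n r0" "y \<in> l1ball n r0" for x y
  proof -
    obtain z where z: "z \<in> l1ball n \<delta>" "e x \<otimes>\<^bsub>K\<^esub> e y = e z" using r0(3)[OF xy] by auto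
    then have "m x y = z" using \<phi>e by (simp add: m_def)
    with z show "m x y \<in> l1ball n \<delta>" "e x \<otimes>\<^bsub>K\<^esub> e y = e (m x y)" by auto
  qed
  \<comment> \<open>The chart of the product atlas, the multiplication in coordinates and its
    domain, each in the form in which \<open>smooth_map\<close> produces it.\<close>
  define \<Phi> where "\<Phi> = (\<lambda>(a, c) i. if i < n then \<phi> a i else \<phi> c (i - n))"
  define F where "F = \<phi> \<circ> (\<lambda>(a, b). a \<otimes>\<^bsub>K\<^esub> b) \<circ> inv_into (U \<times> U) \<Phi>"
  define S where "S = \<Phi> ` {q \<in> U \<times> U. (\<lambda>(a, b). a \<otimes>\<^bsub>K\<^esub> b) q \<in> U}"
  have "(U \<times> U, \<Phi>) \<in> product_atlas n A A"
    unfolding product_atlas_def \<Phi>_def using U(1) by blast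
  then have sm': "smooth_on (n + n) n S F"
    using sm U(1) unfolding smooth_map_def S_def F_def by blast
  have \<Phi>_eq: "\<Phi> (a, c) = pair_coords n (\<phi> a) (\<phi> c)" for a c
    by (auto simp: \<Phi>_def pair_coords_def fun_eq_iff)
  have \<Phi>_inj: "inj_on \<Phi> (U \<times> U)"
  proof (rule inj_onI, clarify)
    fix a b c d assume *: "a \<in> U" "b \<in> U" "c \<in> U" "d \<in> U" "\<Phi> (a, b) = \<Phi> (c, d)"
    have "\<phi> a i = \<phi> c i" for i
    proof (cases "i < n")
      case True
      then show ?thesis using fun_cong[OF *(5), of i] by (simp add: \<Phi>_def)
    next
      case False
      have "\<phi> a \<in> \<V> n" "\<phi> c \<in> \<V> n"
        using * openin_subset[OF \<phi>U] by auto
      with False show ?thesis by (simp add: topspace_Euclidean_space)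
    qed
    moreover have "\<phi> b i = \<phi> d i" for i
      using fun_cong[OF *(5), of "n + i"] by (simp add: \<Phi>_def)
    ultimately show "a = c \<and> b = d" using * inj by (metis ext inj_onD)
  qed
  have F_eq: "F (pair_coords n (x + p) (y + p)) = \<phi> (e x \<otimes>\<^bsub>K\<^esub> e y)"
    "pair_coords n (x + p) (y + p) \<in> S"
    if xy: "x \<in> l1ball n r0" "y \<in> l1ball n r0" for x y
  proof -
    have eq: "pair_coords n (x + p) (y + p) = \<Phi> (e x, e y)"
      using xy sub \<phi>e by (simp add: \<Phi>_eq)
    have "(e x, e y) \<in> U \<times> U" using xy sub eU by auto
    then have "inv_into (U \<times> U) \<Phi> (\<Phi> (e x, e y)) = (e x, e y)"
      by (rule inv_into_f_f[OF \<Phi>_inj])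
    then show "F (pair_coords n (x + p) (y + p)) = \<phi> (e x \<otimes>\<^bsub>K\<^esub> e y)"
      by (simp add: F_def eq)
    have "e x \<otimes>\<^bsub>K\<^esub> e y \<in> U" using m1[OF xy] eU by simp
    with xy sub eU show "pair_coords n (x + p) (y + p) \<in> S"
      unfolding S_def eq by auto
  qed
  have "\<exists>M r'. M \<ge> 0 \<and> r' > 0 \<and> r' \<le> r0 \<and> (\<forall>x x' y. x \<in> l1ball n r' \<longrightarrow> x' \<in> l1ball n r' \<longrightarrow> y \<in> l1ball n r' \<longrightarrow>
      \<bar>F (pair_coords n (x + p) (y + p)) j - F (pair_coords n (x' + p) (y + p)) j
        - (F (pair_coords n (x + p) p) j - F (pair_coords n (x' + p) p) j)\<bar> \<le> M * l1 n (x - x') * l1 n y)"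
    if j: "j < n" for j
  proof -
    have "Ck_on 2 (n + n) S (\<lambda>z. F z j)" using sm' j by (simp add: smooth_on_def)
    from C2_mixed_difference[OF this p(1) r0(1) F_eq(2)] show ?thesis by metis
  qed
  then obtain M r' where M: "\<And>j. j < n \<Longrightarrow> M j \<ge> 0" "\<And>j. j < n \<Longrightarrow> r' j > 0" "\<And>j. j < n \<Longrightarrow> r' j \<le> r0"
     "\<And>j x x' y. j < n \<Longrightarrow> x \<in> l1ball n (r' j) \<Longrightarrow> x' \<in> l1ball n (r' j) \<Longrightarrow> y \<in> l1ball n (r' j) \<Longrightarrow>
      \<bar>F (pair_coords n (x + p) (y + p)) j - F (pair_coords n (x' + p) (y + p)) j
        - (F (pair_coords n (x + p) p) j - F (pair_coords n (x' + p) p) j)\<bar> \<le> M j * l1 n (x - x') * l1 n y"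
    by metis
  define r where "r = Min (insert r0 (r' ` {..<n}))"
  have r: "r > 0" "r \<le> r0" "\<And>j. j < n \<Longrightarrow> r \<le> r' j"
    using M(2) r0(1) by (auto simp: r_def)
  have rsub: "x \<in> l1ball n (r' j)" if "x \<in> l1ball n r" "j < n" for x j
    using that r(3)[of j] by (auto simp: l1ball_def)
  have rsub0: "x \<in> l1ball n r0" if "x \<in> l1ball n r" for x
    using that r(2) by (auto simp: l1ball_def)
  have "local_chart_group K T n e m \<delta> r (\<Sum>j<n. M j)"
  proof (unfold_locales)
    fix x x' y assume *: "x \<in> l1ball n r" "x' \<in> l1ball n r" "y \<in> l1ball n r"
    \<comment> \<open>\<open>e 0\<close> is the identity, so at \<open>y = 0\<close> the group law
      returns its left argument; this identifies two of the four terms of the double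
      difference.\<close>
    have F0: "F (pair_coords n (z + p) p) = z + p" if "z \<in> l1ball n r" for z
    proof -
      have "e z \<in> carrier K" using that rsub0 sub eU UK by blast
      then show ?thesis
        using F_eq(1)[of z 0] rsub0[OF that] r0(1) \<phi>e sub e0 by simp
    qed
    have "\<bar>(m x y - m x' y - (x - x')) j\<bar> \<le> M j * (l1 n (x - x') * l1 n y)" if j: "j < n" for j
      using M(4)[OF j rsub[OF *(1) j] rsub[OF *(2) j] rsub[OF *(3) j],
          unfolded F0[OF *(1)] F0[OF *(2)] F_eq(1)[OF rsub0[OF *(1)] rsub0[OF *(3)]]
            F_eq(1)[OF rsub0[OF *(2)] rsub0[OF *(3)]]]
      by (simp add: m_def algebra_simps)
    then have "l1 n (m x y - m x' y - (x - x')) \<le> (\<Sum>j<n. M j * (l1 n (x - x') * l1 n y))"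
      unfolding l1_def[of n "m x y - m x' y - (x - x')"] by (intro sum_mono) auto
    then show "l1 n (m x y - m x' y - (x - x')) \<le> (\<Sum>j<n. M j) * l1 n (x - x') * l1 n y"
      by (simp add: sum_distrib_right mult.assoc)
  next
    show "0 \<le> (\<Sum>j<n. M j)" using M(1) by (intro sum_nonneg) auto
  qed (use r r0 e_inj e_cont e_open e0 m1 rsub0 in \<open>auto intro: order_trans\<close>)
  then show thesis by (rule that)
qed

section \<open>The exponential map\<close>

text \<open>The segment from 0 to \<open>x\<close> is mapped to a connected set through the
  identity. Commutativity of the identity component thereby reaches every element in the range of
  the chart.\<close>

lemma (in local_chart_group) e_connected_component:
  assumes x: "x \<in> l1ball n \<delta>"
  shows "e x \<in> connected_component_of_set T \<one>"
proof -
  have sc: "vscale t x \<in> l1ball n \<delta>" if "t \<in> {0..1}" for t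
  proof -
    have "\<bar>t\<bar> * l1 n x \<le> 1 * l1 n x" using that by (intro mult_right_mono) auto
    then show ?thesis
      using x by (auto simp: l1ball_def l1_vscale topspace_Euclidean_space_closed(3))
  qed
  have "continuous_map (top_of_set {0..1}) (Euclidean_space n) (\<lambda>t. vscale t x)"
    unfolding Euclidean_space_def continuous_map_in_subtopology
    using x by (auto simp: vscale_def continuous_map_componentwise_UNIV l1ball_def topspace_Euclidean_space
        intro!: continuous_intros)
  then have "continuous_map (top_of_set {0..1}) (subtopology (Euclidean_space n) (l1ball n \<delta>)) (\<lambda>t. vscale t x)"
    using sc by (auto simp: continuous_map_in_subtopology)
  from continuous_map_compose[OF this e_cont]
  have c: "continuous_map (top_of_set {0..1}) T (\<lambda>t. e (vscale t x))"
    by (simp add: o_def)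
  have "connectedin T ((\<lambda>t. e (vscale t x)) ` {0..1})"
    by (rule connectedin_continuous_map_image[OF c]) (simp add: connectedin_subtopology)
  moreover have "vscale 0 x = 0" "vscale 1 x = x" by (auto simp: vscale_def)
  then have "\<one> \<in> (\<lambda>t. e (vscale t x)) ` {0..1}" "e x \<in> (\<lambda>t. e (vscale t x)) ` {0..1}"
    using e_zero by (auto intro: image_eqI[of _ _ 0] image_eqI[of _ _ 1])
  ultimately show ?thesis unfolding connected_component_of_def by auto
qed

locale abelian_chart_group = local_chart_group +
  assumes e_commute: "x \<in> l1ball n r \<Longrightarrow> y \<in> l1ball n r \<Longrightarrow> e x \<otimes> e y = e y \<otimes> e x"

lemma (in local_chart_group) essentially_abelian_imp_abelian_chart_group:
  assumes "essentially_abelian K T"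
  shows "abelian_chart_group K T n e m \<delta> r C"
proof
  fix x y assume "x \<in> l1ball n r" "y \<in> l1ball n r"
  then have "x \<in> l1ball n \<delta>" "y \<in> l1ball n \<delta>" using r_le by (auto simp: l1ball_def)
  then show "e x \<otimes> e y = e y \<otimes> e x"
    using assms e_connected_component unfolding essentially_abelian_def by blast
qed

context compact_top_group begin

lemma limitin_mult:
  "limitin T f a F \<Longrightarrow> limitin T g b F \<Longrightarrow> limitin T (\<lambda>x. f x \<otimes> g x) (a \<otimes> b) F"
  using continuous_map_limit[OF mult_cont, of "\<lambda>x. (f x, g x)" "(a, b)" F]
  by (simp add: limitin_pairwise o_def)

lemma limitin_pow:
  "limitin T f a F \<Longrightarrow> limitin T (\<lambda>x. f x [^] (k::nat)) (a [^] k) F"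
  by (induction k) (auto intro!: limitin_mult limitin_const_iff[THEN iffD2] simp: topspace_eq)

end

context local_chart_group begin

lemma e_closed: "x \<in> l1ball n \<delta> \<Longrightarrow> e x \<in> carrier K"
  using continuous_map_image_subset_topspace[OF e_cont] topspace_eq by (auto simp: l1ball_def)

lemma limitin_e:
  assumes u: "\<And>k. u k \<in> l1ball n \<delta>" and U: "U \<in> l1ball n \<delta>"
    and lim: "(\<lambda>k. l1 n (u k - U)) \<longlonglongrightarrow> 0"
  shows "limitin T (\<lambda>k. e (u k)) (e U) sequentially"
proof -
  have "limitin (Euclidean_space n) u U sequentially"
    unfolding limitin_def
  proof safe
    show "U \<in> \<V> n" using U by (simp add: l1ball_def)
    fix W assume W: "openin (Euclidean_space n) W" "U \<in> W"
    obtain d where d: "d > 0" "\<And>y. y \<in> \<V> n \<Longrightarrow> l1 n (y - U) < d \<Longrightarrow> y \<in> W"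
      using openin_Euclidean_l1D[OF W] by metis
    have "\<forall>\<^sub>F k in sequentially. l1 n (u k - U) < d"
      using lim d(1) by (rule order_tendstoD)
    then show "\<forall>\<^sub>F k in sequentially. u k \<in> W"
      by eventually_elim (use d(2) u in \<open>auto simp: l1ball_def\<close>)
  qed
  then have "limitin (subtopology (Euclidean_space n) (l1ball n \<delta>)) u U sequentially"
    using u U by (simp add: limitin_subtopology)
  from continuous_map_limit[OF e_cont this] show ?thesis by (simp add: o_def)
qed

end

section \<open>Second-order estimates for products and powers in the chart\<close>

context abelian_chart_group begin

lemma in_l1ball_r: "x \<in> l1ball n r \<Longrightarrow> x \<in> l1ball n \<delta>"
  using r_le by (auto simp: l1ball_def)

lemma e_eqD: "x \<in> l1ball n \<delta> \<Longrightarrow> y \<in> l1ball n \<delta> \<Longrightarrow> e x = e y \<Longrightarrow> x = y"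
  using e_inj by (auto dest: inj_onD)

lemma m_zero: "x \<in> l1ball n r \<Longrightarrow> m 0 x = x"
  using e_eqD[OF m_ball in_l1ball_r, of 0 x x] e_mult[of 0 x] r_pos e_zero e_closed[of x] in_l1ball_r[of x]
  by simp

lemma m_near: "x \<in> l1ball n r \<Longrightarrow> y \<in> l1ball n r \<Longrightarrow> l1 n (m x y - x - y) \<le> C * l1 n x * l1 n y"
  using m_bilinear[of x 0 y] m_zero r_pos by (simp add: algebra_simps)

text \<open>At this scale coordinate differences control group quotients up to a factor 2, and a
  quadratic error with one factor below \<open>s\<close> is at most half of the other
  factor.\<close>

definition good_radius :: "real \<Rightarrow> bool" where
  "good_radius s \<longleftrightarrow> 0 < s \<and> s \<le> r \<and> C * s \<le> 1 / 2 \<and>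
     (\<forall>y\<in>l1ball n s. \<forall>z\<in>l1ball n s. \<exists>w\<in>l1ball n r. inv (e y) \<otimes> e z = e w \<and> l1 n w \<le> 2 * l1 n (z - y))"

text \<open>If \<open>e z = e y \<otimes> e w\<close>, then \<open>z = m y w\<close>, and
  \<open>m_near\<close> bounds \<open>z - y - w\<close> by \<open>C * l1 n y * l1 n w\<close>. This
  is at most half of \<open>l1 n w\<close> and is absorbed there.\<close>

lemma ex_good_radius: "\<exists>s. good_radius s"
proof -
  have d: "\<delta> > 0" using r_pos r_le by simp
  let ?E = "subtopology (Euclidean_space n) (l1ball n \<delta>)"
  have "continuous_map (prod_topology ?E ?E) T (\<lambda>z. inv (e (fst z)) \<otimes> e (snd z))"
    by (intro continuous_map_mult continuous_map_inv continuous_map_compose[OF _ e_cont, unfolded o_def]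
         continuous_map_fst continuous_map_snd)
  then have c: "continuous_map (prod_topology ?E ?E) T (\<lambda>(y, z). inv (e y) \<otimes> e z)"
    by (simp add: case_prod_unfold)
  have "openin T (e ` l1ball n r)"
    by (rule e_open) (use in_l1ball_r in \<open>auto simp: openin_l1ball\<close>)
  moreover have "inv (e 0) \<otimes> e 0 \<in> e ` l1ball n r"
    using imageI[of 0 "l1ball n r" e] r_pos by (simp add: e_zero)
  ultimately obtain s where s: "s > 0" "s \<le> \<delta>"
     "\<And>y z. y \<in> l1ball n s \<Longrightarrow> z \<in> l1ball n s \<Longrightarrow> inv (e y) \<otimes> e z \<in> e ` l1ball n r"
    using l1ball_pair_nhd[OF c _ _ d] by metis
  \<comment> \<open>\<open>C + 1\<close> in place of \<open>C\<close>, since \<open>C\<close> may be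
    0.\<close>
  define s' where "s' = min s (min r (1 / (2 * (C + 1))))"
  have s': "0 < s'" "s' \<le> r" "s' \<le> s"
    using s(1) r_pos C_nonneg by (auto simp: s'_def)
  have "s' * (C + 1) \<le> 1 / (2 * (C + 1)) * (C + 1)"
    using C_nonneg by (intro mult_right_mono) (auto simp: s'_def)
  also have "\<dots> = 1 / 2" using C_nonneg by simp
  finally have Cs: "C * s' \<le> 1 / 2" using s'(1) by (simp add: algebra_simps)
  have "\<exists>w\<in>l1ball n r. inv (e y) \<otimes> e z = e w \<and> l1 n w \<le> 2 * l1 n (z - y)"
    if yz: "y \<in> l1ball n s'" "z \<in> l1ball n s'" for y z
  proof -
    have yz': "y \<in> l1ball n s" "z \<in> l1ball n s" "y \<in> l1ball n r" "z \<in> l1ball n r"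
      using yz s' by (auto simp: l1ball_def)
    then obtain w where w: "w \<in> l1ball n r" "inv (e y) \<otimes> e z = e w"
      using s(3) by blast
    have cl: "e y \<in> carrier K" "e z \<in> carrier K" "e w \<in> carrier K"
      using yz' w e_closed in_l1ball_r by auto
    have "e z = e (m y w)"
      using w(2) cl e_mult[OF yz'(3) w(1)] by (metis inv_solve_left')
    then have "z = m y w"
      using e_eqD m_ball[OF yz'(3) w(1)] in_l1ball_r yz' by blast
    then have "l1 n (z - y - w) \<le> C * l1 n y * l1 n w"
      using m_near[OF yz'(3) w(1)] by simp
    also have "\<dots> \<le> 1 / 2 * l1 n w"
    proof (rule mult_right_mono)
      have "C * l1 n y \<le> C * s'" using yz C_nonneg by (intro mult_left_mono) (auto simp: l1ball_def)
      then show "C * l1 n y \<le> 1 / 2" using Cs by linarith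
    qed simp
    finally have "l1 n (z - y - w) \<le> 1 / 2 * l1 n w" .
    moreover have "l1 n w \<le> l1 n (z - y) + l1 n (z - y - w)"
      using l1_diff_triangle[of n "z - y" "z - y - w"] by simp
    ultimately show ?thesis using w by auto
  qed
  then have "good_radius s'" using s' Cs by (simp add: good_radius_def)
  then show ?thesis ..
qed

definition \<rho> where "\<rho> = (SOME s. good_radius s)"
text \<open>\<open>D >= 2 * C\<close> is what the doubling step of \<open>e_pow\<close> demands; the
  added 1 makes \<open>D\<close> positive.\<close>

definition D where "D = 2 * C + 1"
text \<open>For a vector of norm \<open>s\<close> at most \<open>\<eta>\<close>, the quadratic error
  \<open>D * s^2\<close> is at most half of \<open>s\<close>, and \<open>2 * s\<close> stays below
  \<open>\<rho> / 4\<close>.\<close>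

definition \<eta> where "\<eta> = min (\<rho> / 16) (1 / (2 * D))"

lemma good_radius_\<rho>: "good_radius \<rho>"
  unfolding \<rho>_def using ex_good_radius by (rule someI_ex)

lemma \<rho>: "0 < \<rho>" "\<rho> \<le> r" "C * \<rho> \<le> 1 / 2"
  using good_radius_\<rho> by (auto simp: good_radius_def)

lemma e_quotient:
  assumes "y \<in> l1ball n \<rho>" "z \<in> l1ball n \<rho>"
  obtains w where "w \<in> l1ball n r" "inv (e y) \<otimes> e z = e w" "l1 n w \<le> 2 * l1 n (z - y)"
  using good_radius_\<rho> assms unfolding good_radius_def by meson

lemma D_pos: "D \<ge> 1" "D > 0" using C_nonneg by (auto simp: D_def)

lemma \<eta>: "0 < \<eta>" "\<eta> \<le> \<rho> / 16" "D * \<eta> \<le> 1 / 2"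
proof -
  show "0 < \<eta>" "\<eta> \<le> \<rho> / 16" using \<rho> D_pos by (auto simp: \<eta>_def)
  have "D * \<eta> \<le> D * (1 / (2 * D))" using D_pos by (intro mult_left_mono) (auto simp: \<eta>_def)
  then show "D * \<eta> \<le> 1 / 2" using D_pos by simp
qed

lemma in_ball_mono: "x \<in> l1ball n s \<Longrightarrow> s \<le> s' \<Longrightarrow> x \<in> l1ball n s'"
  by (auto simp: l1ball_def)

text \<open>\<open>m_near\<close> bounds the difference of \<open>m x y\<close> and
  \<open>x + y\<close> by a quadratic term, and \<open>e_quotient\<close> turns this difference of
  coordinates into a group factor of the same order.\<close>

lemma e_add:
  assumes x: "x \<in> l1ball n (\<rho> / 4)" and y: "y \<in> l1ball n (\<rho> / 4)"
  obtains d where "d \<in> l1ball n r" "e x \<otimes> e y = e (x + y) \<otimes> e d" "l1 n d \<le> 2 * C * l1 n x * l1 n y"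
proof -
  have xr: "x \<in> l1ball n r" "y \<in> l1ball n r" using x y \<rho> in_ball_mono by (auto simp: l1ball_def)
  have s: "x + y \<in> l1ball n \<rho>"
    using x y l1_triangle[of n x y] \<rho>(1) by (auto simp: l1ball_def topspace_Euclidean_space_closed)
  have near: "l1 n (m x y - (x + y)) \<le> C * l1 n x * l1 n y"
    using m_near[OF xr] by (simp add: algebra_simps)
  have "C * l1 n x * l1 n y \<le> C * \<rho> * l1 n y"
    using x C_nonneg \<rho>(1) by (intro mult_right_mono mult_left_mono) (auto simp: l1ball_def)
  also have "\<dots> \<le> 1 / 2 * l1 n y" using \<rho>(3) by (intro mult_right_mono) auto
  finally have "l1 n (m x y) \<le> l1 n (x + y) + 1 / 2 * l1 n y"
    using near l1_triangle[of n "m x y - (x + y)" "x + y"] by simp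
  then have mm: "m x y \<in> l1ball n \<rho>"
    using x y l1_triangle[of n x y] \<rho>(1) m_ball[OF xr] by (auto simp: l1ball_def)
  obtain d where d: "d \<in> l1ball n r" "inv (e (x + y)) \<otimes> e (m x y) = e d"
      "l1 n d \<le> 2 * l1 n (m x y - (x + y))"
    using e_quotient[OF s mm] by blast
  have "e (x + y) \<in> carrier K" "e (m x y) \<in> carrier K" "e d \<in> carrier K"
    using e_closed in_l1ball_r d(1) m_ball[OF xr] in_ball_mono[OF s \<rho>(2)] by auto
  then have "e (m x y) = e (x + y) \<otimes> e d"
    using d(2) by (metis inv_solve_left')
  then show thesis using that[OF d(1)] e_mult[OF xr] d(3) near by auto
qed

text \<open>Put \<open>s = 2^k * l1 n x\<close>. Squaring doubles the old error and adds at most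
  \<open>C * (2 * s)^2\<close>, while the permitted error grows from \<open>D * s^2\<close> to four
  times as much; \<open>D >= 2 * C\<close> closes the induction.\<close>

lemma e_pow:
  assumes x: "x \<in> \<V> n"
  shows "2 ^ k * l1 n x \<le> \<eta> \<Longrightarrow> \<exists>u\<in>\<V> n.
     e x [^] (2 ^ k :: nat) = e u \<and> l1 n (u - vscale (2 ^ k) x) \<le> D * (2 ^ k * l1 n x)\<^sup>2"
proof (induction k)
  case 0
  have "x \<in> l1ball n \<delta>"
    using 0 x \<eta> \<rho> r_le by (auto simp: l1ball_def)
  then show ?case using x e_closed by (intro bexI[of _ x]) (auto simp: vscale_def l1_def D_def C_nonneg)
next
  case (Suc k)
  let ?s = "2 ^ k * l1 n x"
  have s0: "0 \<le> ?s" by simp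
  have s: "?s \<le> \<eta> / 2" using Suc.prems by simp
  then have "?s \<le> \<eta>" using \<eta>(1) by linarith
  from Suc.IH[OF this] obtain u where u: "u \<in> \<V> n" "e x [^] (2 ^ k :: nat) = e u"
      "l1 n (u - vscale (2 ^ k) x) \<le> D * ?s\<^sup>2"
    by blast
  have "D * ?s\<^sup>2 \<le> ?s"
  proof -
    have "D * ?s \<le> D * \<eta>" using s \<eta>(1) D_pos by (intro mult_left_mono) auto
    then have "D * ?s \<le> 1" using \<eta>(3) by linarith
    then have "D * ?s * ?s \<le> 1 * ?s" by (rule mult_right_mono[OF _ s0])
    then show ?thesis by (simp add: power2_eq_square algebra_simps)
  qed
  then have lu: "l1 n u \<le> 2 * ?s"
    using u(3) l1_triangle[of n "u - vscale (2 ^ k) x" "vscale (2 ^ k) x"] by (simp add: l1_vscale)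
  have ur: "u \<in> l1ball n r" "x \<in> l1ball n r"
  proof -
    have "l1 n u < r" using lu s \<eta> \<rho> by linarith
    then show "u \<in> l1ball n r" using u by (simp add: l1ball_def)
    have "1 * l1 n x \<le> 2 ^ k * l1 n x" by (intro mult_right_mono) auto
    then have "l1 n x < r" using s \<eta> \<rho> by linarith
    then show "x \<in> l1ball n r" using x by (simp add: l1ball_def)
  qed
  have ex: "e x \<in> carrier K" using e_closed in_l1ball_r ur by blast
  have "e x [^] (2 ^ Suc k :: nat) = e x [^] (2 ^ k :: nat) \<otimes> e x [^] (2 ^ k :: nat)"
    using ex by (simp add: nat_pow_mult mult_2)
  also have "\<dots> = e (m u u)" using u(2) e_mult ur by simp
  finally have 1: "e x [^] (2 ^ Suc k :: nat) = e (m u u)" .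
  have "m u u - vscale (2 ^ Suc k) x = (m u u - u - u) + vscale 2 (u - vscale (2 ^ k) x)"
    by (auto simp: vscale_def fun_eq_iff algebra_simps)
  then have "l1 n (m u u - vscale (2 ^ Suc k) x) \<le> l1 n (m u u - u - u) + l1 n (vscale 2 (u - vscale (2 ^ k) x))"
    by (metis l1_triangle)
  moreover have "l1 n (vscale 2 (u - vscale (2 ^ k) x)) \<le> 2 * (D * ?s\<^sup>2)"
    using u(3) by (simp add: l1_vscale)
  moreover have "l1 n (m u u - u - u) \<le> C * (2 * ?s) * (2 * ?s)"
  proof (rule order_trans[OF m_near[OF ur(1) ur(1)]])
    show "C * l1 n u * l1 n u \<le> C * (2 * ?s) * (2 * ?s)"
      using lu C_nonneg s0 by (intro mult_mono) auto
  qed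
  moreover have "C * (2 * ?s) * (2 * ?s) + 2 * (D * ?s\<^sup>2) \<le> D * (2 * ?s)\<^sup>2"
    by (simp add: D_def power2_eq_square algebra_simps)
  ultimately have "l1 n (m u u - vscale (2 ^ Suc k) x) \<le> D * (2 * ?s)\<^sup>2"
    by argo
  moreover have "2 * ?s = 2 ^ Suc k * l1 n x" by simp
  ultimately have "l1 n (m u u - vscale (2 ^ Suc k) x) \<le> D * (2 ^ Suc k * l1 n x)\<^sup>2"
    by metis
  moreover have "m u u \<in> \<V> n" using m_ball[OF ur(1) ur(1)] by (simp add: l1ball_def)
  ultimately show ?case using 1 by blast
qed

lemma e_pow_small:
  assumes x: "x \<in> \<V> n" and k: "2 ^ k * l1 n x \<le> \<eta>"
  obtains u where "u \<in> l1ball n (\<rho> / 4)" "e x [^] (2 ^ k :: nat) = e u"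
     "l1 n (u - vscale (2 ^ k) x) \<le> D * (2 ^ k * l1 n x)\<^sup>2" "l1 n u \<le> 2 * (2 ^ k * l1 n x)"
proof -
  let ?s = "2 ^ k * l1 n x"
  obtain u where u: "u \<in> \<V> n" "e x [^] (2 ^ k :: nat) = e u"
     "l1 n (u - vscale (2 ^ k) x) \<le> D * ?s\<^sup>2"
    using e_pow[OF assms] by auto
  have "D * ?s \<le> D * \<eta>" using k D_pos by (intro mult_left_mono) auto
  then have "D * ?s \<le> 1" using \<eta>(3) by linarith
  then have "D * ?s * ?s \<le> 1 * ?s" by (rule mult_right_mono) simp
  then have "D * ?s\<^sup>2 \<le> ?s" by (simp add: power2_eq_square algebra_simps)
  then have lu: "l1 n u \<le> 2 * ?s"
    using u(3) l1_triangle[of n "u - vscale (2 ^ k) x" "vscale (2 ^ k) x"] by (simp add: l1_vscale)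
  then have "l1 n u < \<rho> / 4" using k \<eta> \<rho> by linarith
  then show thesis using that u lu by (simp add: l1ball_def)
qed

end

lemma convergent_if_geometric_steps:
  fixes u :: "nat \<Rightarrow> real"
  assumes "\<And>k. \<bar>u (Suc k) - u k\<bar> \<le> M / 2 ^ k"
  shows "convergent u"
proof -
  have "summable (\<lambda>k. M * (1 / 2) ^ k)" by (intro summable_mult summable_geometric) auto
  then have "summable (\<lambda>k. u (Suc k) - u k)"
    by (rule summable_comparison_test') (use assms in \<open>simp add: power_divide\<close>)
  then have "convergent (\<lambda>N. \<Sum>k<N. u (Suc k) - u k)"
    by (simp add: summable_iff_convergent)
  then have "convergent (\<lambda>N. u N - u 0)"
    by (simp add: sum_lessThan_telescope)
  then have "convergent (\<lambda>N. (u N - u 0) + u 0)"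
    by (intro convergent_add convergent_const)
  then show ?thesis by simp
qed

section \<open>Convergence of the dyadic powers\<close>

context abelian_chart_group begin

definition P :: "nat \<Rightarrow> (nat \<Rightarrow> real) \<Rightarrow> 'a" where
  "P k v = e (vscale (1 / 2 ^ k) v) [^] (2 ^ k :: nat)"

lemma small_scale:
  assumes "v \<in> \<V> n" "l1 n v / 2 ^ k < s"
  shows "vscale (1 / 2 ^ k) v \<in> l1ball n s"
  using assms by (simp add: l1ball_def l1_vscale topspace_Euclidean_space_closed)

lemma quarter_sub: "x \<in> l1ball n (\<rho> / 4) \<Longrightarrow> x \<in> l1ball n r" "x \<in> l1ball n (\<rho> / 4) \<Longrightarrow> x \<in> l1ball n \<delta>"
  using \<rho> r_le by (auto simp: l1ball_def)

lemma sum_quarter: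
  assumes "x \<in> l1ball n (\<rho> / 4)" "y \<in> l1ball n (\<rho> / 4)"
  shows "x + y \<in> l1ball n r"
  using assms l1_triangle[of n x y] \<rho> by (auto simp: l1ball_def topspace_Euclidean_space_closed)

text \<open>Commutativity lets the power be taken factor by factor. The defect \<open>e c\<close>
  from \<open>e_add\<close> is therefore raised to the power on its own, and its size grows at most
  by \<open>2^(k+1)\<close>.\<close>

lemma e_pow_add:
  assumes x: "x \<in> l1ball n (\<rho> / 4)" and y: "y \<in> l1ball n (\<rho> / 4)"
    and k: "2 ^ k * (2 * C * l1 n x * l1 n y) \<le> \<eta>"
  obtains d where "d \<in> l1ball n (\<rho> / 4)" "l1 n d \<le> 2 * (2 ^ k * (2 * C * l1 n x * l1 n y))"
    "e x [^] (2 ^ k :: nat) \<otimes> e y [^] (2 ^ k :: nat) = e (x + y) [^] (2 ^ k :: nat) \<otimes> e d"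
proof -
  obtain c where c: "c \<in> l1ball n r" "e x \<otimes> e y = e (x + y) \<otimes> e c" "l1 n c \<le> 2 * C * l1 n x * l1 n y"
    using e_add[OF x y] by blast
  have "2 ^ k * l1 n c \<le> 2 ^ k * (2 * C * l1 n x * l1 n y)"
    using c(3) by (intro mult_left_mono) auto
  from order_trans[OF this k] this
  have ck: "2 ^ k * l1 n c \<le> \<eta>" "2 ^ k * l1 n c \<le> 2 ^ k * (2 * C * l1 n x * l1 n y)"
    by auto
  obtain d where d: "d \<in> l1ball n (\<rho> / 4)" "e c [^] (2 ^ k :: nat) = e d" "l1 n d \<le> 2 * (2 ^ k * l1 n c)"
    using e_pow_small[OF _ ck(1)] c(1) by (auto simp: l1ball_def)
  have cl: "e x \<in> carrier K" "e y \<in> carrier K" "e (x + y) \<in> carrier K" "e c \<in> carrier K"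
    using e_closed quarter_sub x y sum_quarter c(1) in_l1ball_r by auto
  have "e x [^] (2 ^ k :: nat) \<otimes> e y [^] (2 ^ k :: nat) = (e x \<otimes> e y) [^] (2 ^ k :: nat)"
    using cl e_commute quarter_sub x y by (intro pow_mult_distrib[symmetric]) auto
  also have "\<dots> = e (x + y) [^] (2 ^ k :: nat) \<otimes> e c [^] (2 ^ k :: nat)"
    unfolding c(2) using cl e_commute[OF sum_quarter[OF x y] c(1)] by (intro pow_mult_distrib) auto
  finally show thesis using that[OF d(1)] d(2,3) ck(2) by auto
qed

text \<open>The defect for the scaled vectors carries two factors \<open>2^-k\<close>, of which the
  power \<open>2^k\<close> consumes one; it still tends to 0.\<close>

lemma P_add:
  assumes v: "v \<in> \<V> n" "l1 n v / 2 ^ k < \<rho> / 4"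
    and w: "w \<in> \<V> n" "l1 n w / 2 ^ k < \<rho> / 4"
    and k: "2 * C * l1 n v * l1 n w / 2 ^ k \<le> \<eta>"
  obtains d where "d \<in> l1ball n (\<rho> / 4)" "l1 n d \<le> 4 * C * l1 n v * l1 n w / 2 ^ k"
    "P k v \<otimes> P k w = P k (v + w) \<otimes> e d"
proof -
  let ?x = "vscale (1 / 2 ^ k) v" and ?y = "vscale (1 / 2 ^ k) w"
  have eq: "2 ^ k * (2 * C * l1 n ?x * l1 n ?y) = 2 * C * l1 n v * l1 n w / 2 ^ k"
    by (simp add: l1_vscale)
  have add: "?x + ?y = vscale (1 / 2 ^ k) (v + w)"
    by (auto simp: vscale_def fun_eq_iff add_divide_distrib)
  obtain d where "d \<in> l1ball n (\<rho> / 4)" "l1 n d \<le> 2 * (2 ^ k * (2 * C * l1 n ?x * l1 n ?y))"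
    "e ?x [^] (2 ^ k :: nat) \<otimes> e ?y [^] (2 ^ k :: nat) = e (?x + ?y) [^] (2 ^ k :: nat) \<otimes> e d"
    using e_pow_add[OF small_scale[OF v] small_scale[OF w], of k, unfolded eq, OF k] unfolding eq by blast
  then show thesis using that by (simp add: P_def eq add)
qed

text \<open>The case of two equal vectors \<open>?y = v / 2^(k+1)\<close> in
  \<open>e_pow_add\<close>: their product is raised to the power \<open>2^k\<close> on the left,
  \<open>e (?y + ?y)\<close> on the right.\<close>

lemma P_Suc:
  assumes v: "v \<in> \<V> n" "l1 n v \<le> \<eta>"
  obtains d where "d \<in> l1ball n (\<rho> / 4)" "l1 n d \<le> C * (l1 n v)\<^sup>2 / 2 ^ k" "P (Suc k) v = P k v \<otimes> e d"
proof -
  let ?y = "vscale (1 / 2 ^ Suc k) v"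
  have "l1 n v / 2 ^ Suc k \<le> l1 n v / 1"
    by (rule divide_left_mono) (use one_le_power[of "2 :: real" "Suc k"] in auto)
  then have y: "?y \<in> l1ball n (\<rho> / 4)"
    using v \<eta> \<rho> by (intro small_scale) auto
  have eq: "2 ^ k * (2 * C * l1 n ?y * l1 n ?y) = C * (l1 n v)\<^sup>2 / 2 ^ k / 2"
    by (simp add: l1_vscale power2_eq_square)
  have "C * (l1 n v)\<^sup>2 / 2 ^ k / 2 \<le> \<eta>"
  proof -
    have "C * (l1 n v)\<^sup>2 / 2 ^ k \<le> C * (l1 n v)\<^sup>2 / 1"
      using C_nonneg by (intro divide_left_mono) auto
    also have "\<dots> \<le> D * \<eta>\<^sup>2" using v C_nonneg by (auto simp: D_def intro!: mult_mono power_mono)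
    also have "\<dots> = D * \<eta> * \<eta>" by (simp add: power2_eq_square)
    also have "\<dots> \<le> 1 / 2 * \<eta>" using \<eta> by (intro mult_right_mono) auto
    finally have "C * (l1 n v)\<^sup>2 / 2 ^ k / 2 \<le> 1 / 2 * \<eta> / 2"
      by (rule divide_right_mono) simp
    then show ?thesis by (rule order_trans) (use \<eta>(1) in simp)
  qed
  from e_pow_add[OF y y, of k, unfolded eq, OF this]
  obtain d where d: "d \<in> l1ball n (\<rho> / 4)" "l1 n d \<le> 2 * (C * (l1 n v)\<^sup>2 / 2 ^ k / 2)"
    "e ?y [^] (2 ^ k :: nat) \<otimes> e ?y [^] (2 ^ k :: nat) = e (?y + ?y) [^] (2 ^ k :: nat) \<otimes> e d"
    by blast
  have double: "?y + ?y = vscale (1 / 2 ^ k) v" by (auto simp: vscale_def fun_eq_iff)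
  have square: "e ?y [^] (2 ^ k :: nat) \<otimes> e ?y [^] (2 ^ k :: nat) = P (Suc k) v"
    unfolding P_def power_Suc[of "2 :: nat"] mult_2[of "2 ^ k :: nat"]
    by (rule nat_pow_mult[OF e_closed[OF quarter_sub(2)[OF y]]])
  show thesis
    using that[OF d(1)] d(2) d(3)[unfolded square double, folded P_def] by simp
qed

text \<open>For small \<open>v\<close> no \<open>P k v\<close> leaves the chart, so the limit can be
  formed in coordinates: by \<open>P_Suc\<close> consecutive terms differ by a factor of size
  \<open>2^-k\<close>, and the coordinates move by geometrically decreasing steps.\<close>

lemma P_converges_small:
  assumes v: "v \<in> \<V> n" "l1 n v \<le> \<eta>"
  obtains U where "U \<in> l1ball n (\<rho> / 2)" "limitin T (\<lambda>k. P k v) (e U) sequentially"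
     "l1 n (U - v) \<le> D * (l1 n v)\<^sup>2"
proof -
  have "\<exists>u. u \<in> l1ball n (\<rho> / 4) \<and> P k v = e u \<and> l1 n (u - v) \<le> D * (l1 n v)\<^sup>2" for k
  proof -
    let ?x = "vscale (1 / 2 ^ k) v"
    have x: "?x \<in> \<V> n" using v by (simp add: topspace_Euclidean_space_closed)
    have eq: "2 ^ k * l1 n ?x = l1 n v" "vscale (2 ^ k) ?x = v"
      by (simp add: l1_vscale) (simp add: vscale_def)
    show ?thesis
      using e_pow_small[OF x, of k, unfolded eq, OF v(2)] unfolding P_def by blast
  qed
  then obtain u where u: "\<And>k. u k \<in> l1ball n (\<rho> / 4)" "\<And>k. P k v = e (u k)"
      "\<And>k. l1 n (u k - v) \<le> D * (l1 n v)\<^sup>2"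
    by metis
  have step: "l1 n (u (Suc k) - u k) \<le> 2 * (C * \<eta>\<^sup>2) / 2 ^ k" for k
  proof -
    obtain d where d: "d \<in> l1ball n (\<rho> / 4)" "l1 n d \<le> C * (l1 n v)\<^sup>2 / 2 ^ k" "P (Suc k) v = P k v \<otimes> e d"
      using P_Suc[OF v] by blast
    have "e (u (Suc k)) = e (m (u k) d)"
      using d(3) u(2) e_mult quarter_sub(1)[OF u(1)] quarter_sub(1)[OF d(1)] by simp
    then have eq: "u (Suc k) = m (u k) d"
      using e_eqD m_ball quarter_sub u(1) d(1) by blast
    have "l1 n (u (Suc k) - u k - d) \<le> C * l1 n (u k) * l1 n d"
      unfolding eq by (rule m_near) (use quarter_sub u(1) d(1) in auto)
    also have "\<dots> \<le> C * \<rho> * l1 n d"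
      using u(1)[of k] C_nonneg \<rho> by (intro mult_right_mono mult_left_mono) (auto simp: l1ball_def)
    also have "\<dots> \<le> 1 / 2 * l1 n d" using \<rho> by (intro mult_right_mono) auto
    finally have "l1 n (u (Suc k) - u k - d) \<le> 1 / 2 * l1 n d" .
    moreover have "l1 n (u (Suc k) - u k) \<le> l1 n (u (Suc k) - u k - d) + l1 n d"
      using l1_triangle[of n "u (Suc k) - u k - d" d] by simp
    ultimately have "l1 n (u (Suc k) - u k) \<le> 2 * l1 n d"
      using l1_nonneg[of n d] by linarith
    also have "\<dots> \<le> 2 * (C * \<eta>\<^sup>2 / 2 ^ k)"
    proof -
      have "C * (l1 n v)\<^sup>2 / 2 ^ k \<le> C * \<eta>\<^sup>2 / 2 ^ k"
        using v C_nonneg by (intro divide_right_mono mult_left_mono power_mono) auto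
      then show ?thesis using d(2) by linarith
    qed
    finally show ?thesis by simp
  qed
  have "convergent (\<lambda>k. u k i)" for i
  proof (cases "i < n")
    case True
    have "\<bar>u (Suc k) i - u k i\<bar> \<le> 2 * (C * \<eta>\<^sup>2) / 2 ^ k" for k
      using abs_le_l1[OF True, of "u (Suc k) - u k"] step[of k] by simp
    then show ?thesis by (rule convergent_if_geometric_steps)
  next
    case False
    then have "u k i = 0" for k
      using u(1)[of k] by (auto simp: l1ball_def topspace_Euclidean_space)
    then show ?thesis by (simp add: convergent_const)
  qed
  define U where "U i = lim (\<lambda>k. u k i)" for i
  have lim: "(\<lambda>k. u k i) \<longlonglongrightarrow> U i" for i
    using \<open>convergent (\<lambda>k. u k i)\<close> by (simp add: U_def convergent_LIMSEQ_iff)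
  have Utop: "U \<in> \<V> n"
  proof -
    have "U i = 0" if "i \<ge> n" for i
    proof -
      have "u k i = 0" for k
        using u(1)[of k] that by (auto simp: l1ball_def topspace_Euclidean_space)
      then show ?thesis using lim[of i] by (simp add: LIMSEQ_const_iff)
    qed
    then show ?thesis by (simp add: topspace_Euclidean_space)
  qed
  have "(\<lambda>k. l1 n (u k - U)) \<longlonglongrightarrow> (\<Sum>i<n. \<bar>U i - U i\<bar>)"
    unfolding l1_def minus_apply by (intro tendsto_intros lim)
  then have l1lim: "(\<lambda>k. l1 n (u k - U)) \<longlonglongrightarrow> 0" by simp
  have "(\<lambda>k. l1 n (u k)) \<longlonglongrightarrow> l1 n U"
    unfolding l1_def by (intro tendsto_intros lim)
  then have "l1 n U \<le> \<rho> / 4"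
    by (rule LIMSEQ_le_const2) (use u(1) in \<open>auto simp: l1ball_def less_imp_le\<close>)
  then have Ub: "U \<in> l1ball n (\<rho> / 2)" using Utop \<rho>(1) by (simp add: l1ball_def)
  have "(\<lambda>k. l1 n (u k - v)) \<longlonglongrightarrow> l1 n (U - v)"
    unfolding l1_def minus_apply by (intro tendsto_intros lim)
  then have "l1 n (U - v) \<le> D * (l1 n v)\<^sup>2"
    by (rule LIMSEQ_le_const2) (use u(3) in auto)
  moreover have "limitin T (\<lambda>k. e (u k)) (e U) sequentially"
  proof (rule limitin_e)
    show "U \<in> l1ball n \<delta>" using Ub \<rho> r_le by (auto simp: l1ball_def)
  qed (use l1lim quarter_sub u(1) in auto)
  ultimately show thesis using that[OF Ub] by (simp add: u(2))
qed

lemma ex_power_scale: "\<exists>j. l1 n v / 2 ^ j \<le> s" if "s > 0"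
proof -
  obtain j where "l1 n v / s < 2 ^ j" using real_arch_pow[of 2 "l1 n v / s"] by auto
  then have "l1 n v / 2 ^ j \<le> s" using that by (simp add: field_simps)
  then show ?thesis ..
qed

text \<open>\<open>P (k + j) v\<close> is the \<open>2^j\<close>-th power of \<open>P k\<close> at
  \<open>v / 2^j\<close>. For large \<open>j\<close> the latter vector is small, and taking powers
  preserves limits.\<close>

lemma P_converges:
  assumes v: "v \<in> \<V> n"
  shows "\<exists>l. limitin T (\<lambda>k. P k v) l sequentially"
proof -
  obtain j where j: "l1 n v / 2 ^ j \<le> \<eta>" using ex_power_scale[OF \<eta>(1)] by blast
  let ?w = "vscale (1 / 2 ^ j) v"
  have w: "?w \<in> \<V> n" "l1 n ?w \<le> \<eta>"
    using v j by (auto simp: l1_vscale topspace_Euclidean_space_closed)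
  obtain U where U: "limitin T (\<lambda>k. P k ?w) (e U) sequentially"
    using P_converges_small[OF w] by blast
  have "limitin T (\<lambda>k. P k ?w [^] (2 ^ j :: nat)) (e U [^] (2 ^ j :: nat)) sequentially"
    by (rule limitin_pow[OF U])
  moreover have "P k ?w [^] (2 ^ j :: nat) = P (k + j) v" for k
  proof -
    have "vscale (1 / 2 ^ k) ?w = vscale (1 / 2 ^ (k + j)) v"
      by (auto simp: vscale_def power_add)
    moreover have "l1 n ?w / 2 ^ k < r"
    proof -
      have "l1 n ?w / 2 ^ k \<le> l1 n ?w / 1" by (rule divide_left_mono) auto
      then show ?thesis using w(2) \<eta> \<rho> by linarith
    qed
    then have "e (vscale (1 / 2 ^ k) ?w) \<in> carrier K"
      using small_scale[OF w(1)] in_l1ball_r e_closed by blast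
    ultimately show ?thesis by (simp add: P_def nat_pow_pow power_add)
  qed
  ultimately have "limitin T (\<lambda>k. P (k + j) v) (e U [^] (2 ^ j :: nat)) sequentially" by simp
  then show ?thesis using limitin_sequentially_offset_rev[of T "\<lambda>k. P k v" j] by blast
qed

definition Exp :: "(nat \<Rightarrow> real) \<Rightarrow> 'a" where
  "Exp v = (THE l. limitin T (\<lambda>k. P k v) l sequentially)"

lemma P_unique: "limitin T f l sequentially \<Longrightarrow> limitin T f l' sequentially \<Longrightarrow> l = l'"
  using Hausdorff limitin_Hausdorff_unique trivial_limit_sequentially by metis

lemma Exp_eq: "limitin T (\<lambda>k. P k v) l sequentially \<Longrightarrow> Exp v = l"
  unfolding Exp_def using P_unique by blast

lemma Exp_limit: "v \<in> \<V> n \<Longrightarrow> limitin T (\<lambda>k. P k v) (Exp v) sequentially"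
  using P_converges Exp_eq by metis

lemma Exp_closed: "v \<in> \<V> n \<Longrightarrow> Exp v \<in> carrier K"
  using Exp_limit limitin_topspace topspace_eq by metis

lemma Exp_small:
  assumes "v \<in> \<V> n" "l1 n v \<le> \<eta>"
  obtains u where "u \<in> l1ball n \<delta>" "Exp v = e u" "l1 n (u - v) \<le> D * (l1 n v)\<^sup>2" "l1 n u \<le> 2 * l1 n v"
proof -
  obtain u where u: "u \<in> l1ball n (\<rho> / 2)" "limitin T (\<lambda>k. P k v) (e u) sequentially"
     "l1 n (u - v) \<le> D * (l1 n v)\<^sup>2"
    using P_converges_small[OF assms] by blast
  have "D * l1 n v \<le> D * \<eta>" using assms(2) D_pos by (intro mult_left_mono) auto
  then have "D * l1 n v \<le> 1" using \<eta>(3) by linarith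
  then have "D * l1 n v * l1 n v \<le> 1 * l1 n v" by (rule mult_right_mono) simp
  then have "D * (l1 n v)\<^sup>2 \<le> l1 n v" by (simp add: power2_eq_square algebra_simps)
  then have "l1 n u \<le> 2 * l1 n v" using u(3) l1_triangle[of n "u - v" v] by simp
  moreover have "u \<in> l1ball n \<delta>" using u(1) \<rho> r_le by (auto simp: l1ball_def)
  ultimately show thesis using that u(3) Exp_eq[OF u(2)] by blast
qed

lemma Exp_add:
  assumes v: "v \<in> \<V> n" and w: "w \<in> \<V> n"
  shows "Exp (v + w) = Exp v \<otimes> Exp w"
proof -
  have lim0: "(\<lambda>k. c / 2 ^ k) \<longlonglongrightarrow> 0" for c :: real
    using tendsto_mult[OF tendsto_const[of c] LIMSEQ_realpow_zero[of "1 / 2"]] by (simp add: power_divide)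
  have "\<forall>\<^sub>F k in sequentially. l1 n v / 2 ^ k < \<rho> / 4"
    "\<forall>\<^sub>F k in sequentially. l1 n w / 2 ^ k < \<rho> / 4"
    "\<forall>\<^sub>F k in sequentially. 2 * C * l1 n v * l1 n w / 2 ^ k < \<eta>"
    by (intro order_tendstoD(2)[OF lim0]; use \<rho> \<eta> in simp)+
  then have ev: "\<forall>\<^sub>F k in sequentially. \<exists>d. d \<in> l1ball n (\<rho> / 4) \<and> l1 n d \<le> 4 * C * l1 n v * l1 n w / 2 ^ k \<and>
      P k v \<otimes> P k w = P k (v + w) \<otimes> e d"
    by eventually_elim (meson P_add v w less_imp_le)
  define Q where "Q k d \<longleftrightarrow> d \<in> l1ball n (\<rho> / 4) \<and> l1 n d \<le> 4 * C * l1 n v * l1 n w / 2 ^ k \<and>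
      P k v \<otimes> P k w = P k (v + w) \<otimes> e d" for k d
  \<comment> \<open>\<open>P_add\<close> supplies the defect only for large \<open>k\<close>; the
    default 0 keeps every \<open>d k\<close> in the ball, as \<open>limitin_e\<close>
    requires.\<close>
  define d where "d k = (if \<exists>d. Q k d then SOME d. Q k d else 0)" for k
  have Qd: "\<forall>\<^sub>F k in sequentially. Q k (d k)"
    using ev unfolding Q_def[symmetric] by eventually_elim (metis d_def someI_ex)
  have db: "d k \<in> l1ball n (\<rho> / 4)" for k
  proof (cases "\<exists>d. Q k d")
    case True
    then have "Q k (d k)" using someI_ex[OF True] by (simp add: d_def)
    then show ?thesis by (simp add: Q_def)
  next
    case False
    then have "d k = 0" by (simp add: d_def)
    then show ?thesis using \<rho>(1) by simp
  qed
  have "(\<lambda>k. l1 n (d k - 0)) \<longlonglongrightarrow> 0"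
  proof (rule tendsto_sandwich[of "\<lambda>_. 0" _ _ "\<lambda>k. 4 * C * l1 n v * l1 n w / 2 ^ k"])
    show "\<forall>\<^sub>F k in sequentially. l1 n (d k - 0) \<le> 4 * C * l1 n v * l1 n w / 2 ^ k"
      using Qd by eventually_elim (simp add: Q_def)
  qed (use lim0 in auto)
  then have "limitin T (\<lambda>k. e (d k)) (e 0) sequentially"
    by (rule limitin_e[rotated 2]) (use db quarter_sub r_pos r_le in auto)
  then have "limitin T (\<lambda>k. P k (v + w) \<otimes> e (d k)) (Exp (v + w) \<otimes> \<one>) sequentially"
    using Exp_limit[OF topspace_Euclidean_space_closed(1)[OF v w]] by (intro limitin_mult) (auto simp: e_zero)
  moreover have "limitin T (\<lambda>k. P k v \<otimes> P k w) (Exp v \<otimes> Exp w) sequentially"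
    using Exp_limit v w by (intro limitin_mult)
  then have "limitin T (\<lambda>k. P k (v + w) \<otimes> e (d k)) (Exp v \<otimes> Exp w) sequentially"
    by (rule limitin_transform_eventually[rotated]) (use Qd in eventually_elim, simp add: Q_def)
  ultimately have "Exp (v + w) \<otimes> \<one> = Exp v \<otimes> Exp w" by (rule P_unique)
  then show ?thesis using Exp_closed[OF topspace_Euclidean_space_closed(1)[OF v w]] by simp
qed

lemma Exp_zero: "Exp 0 = \<one>"
proof -
  have "Exp 0 \<otimes> Exp 0 = Exp 0" using Exp_add[of 0 0] by simp
  then show ?thesis using Exp_closed[of 0] by simp
qed

end

text \<open>What the sequel retains of the Lie structure: an open continuous homomorphism from
  Euclidean space that is injective near 0.\<close>

locale group_exponential = compact_top_group +
  fixes n :: nat and Ex :: "(nat \<Rightarrow> real) \<Rightarrow> 'a" and \<eta> :: real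
  assumes Ex_cont: "continuous_map (Euclidean_space n) T Ex"
    and Ex_open: "openin (Euclidean_space n) S \<Longrightarrow> openin T (Ex ` S)"
    and Ex_add: "v \<in> \<V> n \<Longrightarrow> w \<in> \<V> n \<Longrightarrow>
        Ex (v + w) = Ex v \<otimes> Ex w"
    and \<eta>_pos: "\<eta> > 0"
    and Ex_inj: "inj_on Ex (l1ball n \<eta>)"

lemma (in compact_top_group) openin_translate:
  assumes a: "a \<in> carrier K" and W: "openin T W"
  shows "openin T ((\<lambda>x. a \<otimes> x) ` W)"
proof -
  have "continuous_map T T (\<lambda>x. inv a \<otimes> x)"
    using a by (intro continuous_map_mult continuous_map_id[unfolded id_def]) (auto simp: topspace_eq)
  then have "openin T {x \<in> topspace T. inv a \<otimes> x \<in> W}"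
    by (rule openin_continuous_map_preimage[OF _ W])
  moreover have "{x \<in> topspace T. inv a \<otimes> x \<in> W} = (\<lambda>x. a \<otimes> x) ` W"
  proof (intro equalityI subsetI)
    fix x assume "x \<in> {x \<in> topspace T. inv a \<otimes> x \<in> W}"
    then have "x \<in> carrier K" "inv a \<otimes> x \<in> W" by (auto simp: topspace_eq)
    then show "x \<in> (\<lambda>x. a \<otimes> x) ` W"
      using a by (intro image_eqI[of _ _ "inv a \<otimes> x"]) (auto simp: m_assoc[symmetric])
  next
    fix x assume "x \<in> (\<lambda>x. a \<otimes> x) ` W"
    then obtain w where w: "w \<in> W" "x = a \<otimes> w" by auto
    then have "w \<in> carrier K" using openin_subset[OF W] by (auto simp: topspace_eq)
    then show "x \<in> {x \<in> topspace T. inv a \<otimes> x \<in> W}"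
      using w a by (auto simp: m_assoc[symmetric] topspace_eq)
  qed
  ultimately show ?thesis by simp
qed

section \<open>Continuity, local injectivity and openness of the exponential map\<close>

context abelian_chart_group begin

text \<open>Additivity reduces the matter to vectors near 0: \<open>Exp w\<close> is
  \<open>Exp v \<otimes> e u\<close> with \<open>u\<close> at most twice as large as
  \<open>w - v\<close>, and \<open>e\<close> is continuous at 0.\<close>

lemma Exp_continuous: "continuous_map (Euclidean_space n) T Exp"
proof -
  have "openin (Euclidean_space n) {v \<in> \<V> n. Exp v \<in> W}"
    if W: "openin T W" for W
  proof (subst openin_subopen, safe)
    fix v assume v: "v \<in> \<V> n" "Exp v \<in> W"
    have cv: "Exp v \<in> carrier K" using v Exp_closed by simp
    have "continuous_map (subtopology (Euclidean_space n) (l1ball n \<delta>)) T (\<lambda>u. Exp v \<otimes> e u)"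
      using cv by (intro continuous_map_mult e_cont) (auto simp: topspace_eq)
    then have o: "openin (subtopology (Euclidean_space n) (l1ball n \<delta>))
        {u \<in> topspace (subtopology (Euclidean_space n) (l1ball n \<delta>)). Exp v \<otimes> e u \<in> W}"
      by (rule openin_continuous_map_preimage[OF _ W])
    define N where "N = {u \<in> topspace (subtopology (Euclidean_space n) (l1ball n \<delta>)). Exp v \<otimes> e u \<in> W}"
    have N: "openin (Euclidean_space n) N"
      using o openin_l1ball openin_trans_full unfolding N_def by blast
    have "0 \<in> N"
      using v cv r_pos r_le by (simp add: e_zero N_def)
    then obtain \<epsilon> where \<epsilon>: "\<epsilon> > 0" "\<And>u. u \<in> \<V> n \<Longrightarrow> l1 n (u - 0) < \<epsilon> \<Longrightarrow> u \<in> N"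
      using openin_Euclidean_l1D[OF N] by metis
    let ?B = "{w \<in> \<V> n. l1 n (w - v) < min \<eta> (\<epsilon> / 2)}"
    have "Exp w \<in> W" if w: "w \<in> ?B" for w
    proof -
      have wv: "w - v \<in> \<V> n" "l1 n (w - v) \<le> \<eta>"
        using w v topspace_Euclidean_space_closed by auto
      obtain u where u: "u \<in> l1ball n \<delta>" "Exp (w - v) = e u" "l1 n u \<le> 2 * l1 n (w - v)"
        using Exp_small[OF wv] by blast
      have "l1 n u < \<epsilon>" using u(3) w by auto
      then have "Exp v \<otimes> e u \<in> W" using \<epsilon>(2)[of u] u(1) by (auto simp: l1ball_def N_def)
      then show "Exp w \<in> W" using Exp_add[OF v(1) wv(1)] u(2) by simp
    qed
    moreover have "v \<in> ?B" using v \<eta>(1) \<epsilon>(1) by simp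
    ultimately show "\<exists>B. openin (Euclidean_space n) B \<and> v \<in> B \<and> B \<subseteq> {v \<in> \<V> n. Exp v \<in> W}"
      using openin_l1ball_around[of n v "min \<eta> (\<epsilon> / 2)"] by (intro exI[of _ ?B]) auto
  qed
  then show ?thesis
    unfolding continuous_map using Exp_closed by (auto simp: topspace_eq)
qed

text \<open>If two values agree, \<open>Exp (v - w)\<close> is the identity and has coordinates 0.
  Since its coordinates differ from \<open>v - w\<close> by a quadratic term, \<open>v - w\<close>
  is at most half as large as itself.\<close>

lemma Exp_inj: "inj_on Exp (l1ball n (\<eta> / 2))"
proof (rule inj_onI)
  fix v w assume vw: "v \<in> l1ball n (\<eta> / 2)" "w \<in> l1ball n (\<eta> / 2)" "Exp v = Exp w"
  have t: "v \<in> \<V> n" "w \<in> \<V> n"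
      "v - w \<in> \<V> n"
    using vw by (auto simp: l1ball_def topspace_Euclidean_space_closed)
  have l: "l1 n (v - w) < \<eta>"
    using vw l1_diff_triangle[of n v w] by (auto simp: l1ball_def)
  obtain u where u: "u \<in> l1ball n \<delta>" "Exp (v - w) = e u" "l1 n (u - (v - w)) \<le> D * (l1 n (v - w))\<^sup>2"
    using Exp_small[OF t(3)] l by auto
  have "Exp w \<otimes> Exp (v - w) = Exp w"
    using Exp_add[OF t(2,3)] vw(3) by simp
  then have "Exp (v - w) = \<one>"
    using Exp_closed t by simp
  then have "e u = e 0" using u(2) e_zero by simp
  then have "u = 0" using u(1) r_pos r_le by (intro e_eqD) auto
  then have "l1 n (v - w) \<le> D * l1 n (v - w) * l1 n (v - w)"
    using u(3) l1_minus_commute[of n 0 "v - w"] by (simp add: power2_eq_square mult.assoc)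
  also have "\<dots> \<le> 1 / 2 * l1 n (v - w)"
  proof (rule mult_right_mono)
    have "D * l1 n (v - w) \<le> D * \<eta>" using l D_pos by (intro mult_left_mono) auto
    then show "D * l1 n (v - w) \<le> 1 / 2" using \<eta>(3) by linarith
  qed simp
  finally have "l1 n (v - w) \<le> 1 / 2 * l1 n (v - w)" .
  then have "l1 n (v - w) \<le> 0" by linarith
  then have "v - w = 0" by (rule l1_eq_0D[OF t(3)])
  then show "v = w" by simp
qed

text \<open>Read in the chart, \<open>Exp\<close> is a continuous injection of an open set into a
  space of the same dimension, so invariance of domain applies; no derivative of \<open>Exp\<close>
  is formed.\<close>

lemma Exp_open_small:
  assumes S: "openin (Euclidean_space n) S" "S \<subseteq> l1ball n (\<eta> / 2)"
  shows "openin T (Exp ` S)"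
proof -
  define f where "f v = inv_into (l1ball n \<delta>) e (Exp v)" for v
  have small: "Exp v \<in> e ` l1ball n \<delta>" if "v \<in> S" for v
  proof -
    have "v \<in> \<V> n" "l1 n v \<le> \<eta>"
      using that S(2) \<eta>(1) by (auto simp: l1ball_def)
    then show ?thesis using Exp_small by blast
  qed
  have f: "f v \<in> l1ball n \<delta>" "e (f v) = Exp v" if "v \<in> S" for v
    using small[OF that] by (auto simp: f_def inv_into_into f_inv_into_f)
  have "continuous_map (subtopology (Euclidean_space n) S) (Euclidean_space n) f"
    unfolding continuous_map
  proof (intro conjI allI impI)
    show "f ` topspace (subtopology (Euclidean_space n) S) \<subseteq> \<V> n"
      using f(1) by (auto simp: l1ball_def)
    fix W assume W: "openin (Euclidean_space n) W"
    have o: "openin T (e ` (W \<inter> l1ball n \<delta>))"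
      using W openin_l1ball by (intro e_open openin_Int) auto
    have "continuous_map (subtopology (Euclidean_space n) S) T Exp"
      by (rule continuous_map_from_subtopology[OF Exp_continuous])
    from openin_continuous_map_preimage[OF this o]
    have "openin (subtopology (Euclidean_space n) S) {v \<in> topspace (subtopology (Euclidean_space n) S). Exp v \<in> e ` (W \<inter> l1ball n \<delta>)}" .
    moreover have "Exp v \<in> e ` (W \<inter> l1ball n \<delta>) \<longleftrightarrow> f v \<in> W" if "v \<in> S" for v
    proof
      assume "Exp v \<in> e ` (W \<inter> l1ball n \<delta>)"
      then obtain u where "u \<in> W" "u \<in> l1ball n \<delta>" "Exp v = e u" by auto
      then show "f v \<in> W" using f[OF that] e_eqD[of "f v" u] by simp
    next
      assume "f v \<in> W"
      then show "Exp v \<in> e ` (W \<inter> l1ball n \<delta>)"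
        using f[OF that] by (metis IntI image_eqI)
    qed
    then have "{v \<in> topspace (subtopology (Euclidean_space n) S). Exp v \<in> e ` (W \<inter> l1ball n \<delta>)}
      = {v \<in> topspace (subtopology (Euclidean_space n) S). f v \<in> W}" by auto
    ultimately show "openin (subtopology (Euclidean_space n) S) {v \<in> topspace (subtopology (Euclidean_space n) S). f v \<in> W}"
      by simp
  qed
  moreover have "inj_on f S"
    using f(2) Exp_inj S(2) by (intro inj_onI) (metis inj_onD subsetD)
  ultimately have "openin (Euclidean_space n) (f ` S)"
    by (rule invariance_of_domain_Euclidean_space[OF S(1)])
  then have "openin T (e ` (f ` S))" using f(1) by (intro e_open) auto
  moreover have "e ` (f ` S) = Exp ` S" using f(2) by (force simp: image_iff)
  ultimately show ?thesis by simp
qed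

lemma Exp_open:
  assumes S: "openin (Euclidean_space n) S"
  shows "openin T (Exp ` S)"
proof (subst openin_subopen, safe)
  fix v assume v: "v \<in> S"
  have vt: "v \<in> \<V> n" using v openin_subset[OF S] by blast
  obtain d where d: "d > 0" "\<And>y. y \<in> \<V> n \<Longrightarrow> l1 n (y - v) < d \<Longrightarrow> y \<in> S"
    using openin_Euclidean_l1D[OF S v] by metis
  let ?B = "l1ball n (min d (\<eta> / 2))"
  have "openin T (Exp ` ?B)"
    by (rule Exp_open_small) (auto simp: openin_l1ball in_ball_mono)
  then have "openin T ((\<lambda>x. Exp v \<otimes> x) ` (Exp ` ?B))"
    using Exp_closed vt by (intro openin_translate) auto
  moreover have "(\<lambda>x. Exp v \<otimes> x) ` (Exp ` ?B) \<subseteq> Exp ` S"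
  proof safe
    fix w assume "w \<in> ?B"
    then have w: "w \<in> \<V> n" "l1 n w < d" by (auto simp: l1ball_def)
    then have "v + w \<in> S" using d(2)[of "v + w"] vt by (simp add: topspace_Euclidean_space_closed)
    then show "Exp v \<otimes> Exp w \<in> Exp ` S" using Exp_add[OF vt w(1)] by (metis imageI)
  qed
  moreover have "Exp v \<in> (\<lambda>x. Exp v \<otimes> x) ` (Exp ` ?B)"
  proof -
    have "0 \<in> ?B" using d(1) \<eta>(1) by simp
    then have "Exp v \<otimes> Exp 0 \<in> (\<lambda>x. Exp v \<otimes> x) ` (Exp ` ?B)" by blast
    then show ?thesis using Exp_zero Exp_closed[OF vt] by simp
  qed
  ultimately show "\<exists>W. openin T W \<and> Exp v \<in> W \<and> W \<subseteq> Exp ` S" by blast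
qed

end

lemma compact_lie_group_exponential:
  assumes "compact_lie_group K T" "essentially_abelian K T"
  obtains n Ex \<eta> where "group_exponential K T n Ex \<eta>"
proof -
  obtain n e m \<delta> r C where "local_chart_group K T n e m \<delta> r C"
    using compact_lie_group_chart[OF assms(1)] .
  then interpret local_chart_group K T n e m \<delta> r C .
  interpret abelian_chart_group K T n e m \<delta> r C
    by (rule essentially_abelian_imp_abelian_chart_group[OF assms(2)])
  have "group_exponential K T n Exp (\<eta> / 2)"
    by unfold_locales (use Exp_continuous Exp_open Exp_add Exp_inj \<eta>(1) in auto)
  then show thesis by (rule that)
qed

section \<open>Lattices\<close>

interpretation rvec: vector_space "vscale :: real \<Rightarrow> (nat \<Rightarrow> real) \<Rightarrow> (nat \<Rightarrow> real)"
  by unfold_locales (auto simp: vscale_def fun_eq_iff algebra_simps)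

lemma basis_vect_in_Euclidean: "i < n \<Longrightarrow> basis_vect i \<in> \<V> n"
  by (auto simp: topspace_Euclidean_space basis_vect_def)

lemma sum_fun_apply: "(\<Sum>i\<in>A. f i) x = (\<Sum>i\<in>A. f i x)"
  for f :: "'i \<Rightarrow> 'b \<Rightarrow> 'c::comm_monoid_add"
  by (induction A rule: infinite_finite_induct) auto

lemma Euclidean_basis_expansion:
  assumes "v \<in> \<V> n"
  shows "v = (\<Sum>i<n. vscale (v i) (basis_vect i))"
  using assms by (auto simp: fun_eq_iff sum_fun_apply vscale_def basis_vect_def topspace_Euclidean_space
      if_distrib[of "\<lambda>x. _ * x"] cong: if_cong)

lemma rvec_independent_Euclidean:
  assumes "rvec.independent B" "B \<subseteq> \<V> n"
  shows "finite B \<and> card B \<le> n"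
proof -
  have "\<V> n \<subseteq> rvec.span (basis_vect ` {..<n})"
  proof
    fix v assume "v \<in> \<V> n"
    then have "v = (\<Sum>i<n. vscale (v i) (basis_vect i))" by (rule Euclidean_basis_expansion)
    also have "\<dots> \<in> rvec.span (basis_vect ` {..<n})"
      by (intro rvec.span_sum rvec.span_scale rvec.span_base) auto
    finally show "v \<in> rvec.span (basis_vect ` {..<n})" .
  qed
  then have "finite B \<and> card B \<le> card (basis_vect ` {..<n} :: (nat \<Rightarrow> real) set)"
    using assms by (intro rvec.independent_span_bound) auto
  then show ?thesis using card_image_le[of "{..<n}" "basis_vect :: nat \<Rightarrow> nat \<Rightarrow> real"] by simp
qed

locale euclidean_lattice =
  fixes n :: nat and L :: "(nat \<Rightarrow> real) set" and M :: real
  assumes L_sub: "L \<subseteq> \<V> n"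
    and L_zero: "0 \<in> L"
    and L_add: "x \<in> L \<Longrightarrow> y \<in> L \<Longrightarrow> x + y \<in> L"
    and L_minus: "x \<in> L \<Longrightarrow> - x \<in> L"
    and L_discrete: "finite {x \<in> L. l1 n x \<le> b}"
    and L_cocompact: "v \<in> \<V> n \<Longrightarrow> \<exists>x\<in>L. l1 n (v - x) \<le> M"
begin

lemma L_sum: "(\<And>i. i \<in> A \<Longrightarrow> f i \<in> L) \<Longrightarrow> (\<Sum>i\<in>A. f i) \<in> L"
  by (induction A rule: infinite_finite_induct) (auto intro: L_zero L_add)

lemma L_nat_scale: "x \<in> L \<Longrightarrow> vscale (of_nat k) x \<in> L"
proof (induction k)
  case (Suc k)
  then have "vscale (of_nat k) x + x \<in> L" by (auto intro: L_add)
  moreover have "vscale (of_nat k) x + x = vscale (of_nat (Suc k)) x"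
    by (auto simp: vscale_def fun_eq_iff algebra_simps)
  ultimately show ?case by simp
qed (use L_zero in \<open>auto simp: vscale_def zero_fun_def\<close>)

lemma L_int_scale: "x \<in> L \<Longrightarrow> z \<in> \<int> \<Longrightarrow> vscale z x \<in> L"
proof -
  assume x: "x \<in> L" and z: "z \<in> \<int>"
  then obtain k where k: "z = of_nat k \<or> z = - of_nat k"
    by (metis Ints_cases int_cases2 of_int_minus of_int_of_nat_eq)
  have "vscale (- of_nat k) x = - vscale (of_nat k) x" by (auto simp: vscale_def)
  then show ?thesis using k L_nat_scale[OF x, of k] L_minus by auto
qed

lemma L_diff: "x \<in> L \<Longrightarrow> y \<in> L \<Longrightarrow> x - y \<in> L"
  using L_add[of x "- y"] L_minus by simp

text \<open>The stages of an induction on the rank: \<open>B\<close> is a Z-basis of those lattice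
  points that lie in its own span.\<close>

definition integral_basis :: "(nat \<Rightarrow> real) set \<Rightarrow> bool" where
  "integral_basis B \<longleftrightarrow> rvec.independent B \<and> B \<subseteq> L \<and>
     (\<forall>x\<in>L \<inter> rvec.span B. \<forall>b\<in>B. rvec.representation B x b \<in> \<int>)"

lemma integral_basis_finite: "integral_basis B \<Longrightarrow> finite B \<and> card B \<le> n"
  using rvec_independent_Euclidean L_sub unfolding integral_basis_def by blast

text \<open>Among the lattice vectors in the half-open box spanned by \<open>B\<close> and a new lattice vector \<open>a\<close>,
  the one with the smallest positive \<open>a\<close>-coordinate extends \<open>B\<close>.\<close>

lemma integral_basis_extend:
  assumes B: "integral_basis B" and a: "a \<in> L" "a \<notin> rvec.span B"
  obtains c where "c \<notin> B" "integral_basis (insert c B)"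
proof -
  have iB: "rvec.independent B" and BL: "B \<subseteq> L" and fB: "finite B"
    and intB: "\<And>x b. x \<in> L \<Longrightarrow> x \<in> rvec.span B \<Longrightarrow> b \<in> B \<Longrightarrow> rvec.representation B x b \<in> \<int>"
    using B integral_basis_finite by (auto simp: integral_basis_def)
  let ?B = "insert a B"
  have aB: "a \<notin> B" using a(2) rvec.span_base by blast
  have i: "rvec.independent ?B" using a(2) iB by (rule rvec.independent_insertI)
  let ?r = "rvec.representation ?B"
  have expand: "x = (\<Sum>b\<in>B. vscale (?r x b) b) + vscale (?r x a) a" if "x \<in> rvec.span ?B" for x
    using rvec.sum_representation_eq[OF i that, of ?B] fB aB by (simp add: add.commute)
  have spanL: "x \<in> rvec.span ?B" if "x \<in> rvec.span B" for x
    using that rvec.span_mono[of B ?B] by blast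
  have spa: "a \<in> rvec.span ?B" "\<And>b. b \<in> B \<Longrightarrow> b \<in> rvec.span ?B" by (auto intro: rvec.span_base)
  have zero_in_span: "x \<in> rvec.span B" if "x \<in> rvec.span ?B" "?r x a = 0" for x
  proof -
    have "x = (\<Sum>b\<in>B. vscale (?r x b) b)" using expand[OF that(1)] that(2) by simp
    also have "\<dots> \<in> rvec.span B" by (intro rvec.span_sum rvec.span_scale rvec.span_base)
    finally show ?thesis .
  qed
  have span_zero: "?r x a = 0" if "x \<in> rvec.span B" for x
    using rvec.representation_extend[OF i that subset_insertI] rvec.representation_ne_zero[of B x a] aB by auto
  \<comment> \<open>The \<open>a\<close>-coordinate ranges from 0 excluded to 1 included, so that
    \<open>a\<close> itself belongs to the box; boundedness makes it finite.\<close>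
  define A where "A = {x \<in> L \<inter> rvec.span ?B. (\<forall>b\<in>B. 0 \<le> ?r x b \<and> ?r x b < 1) \<and> 0 < ?r x a \<and> ?r x a \<le> 1}"
  have "A \<subseteq> {x \<in> L. l1 n x \<le> (\<Sum>b\<in>B. l1 n b) + l1 n a}"
  proof
    fix x assume x: "x \<in> A"
    have 1: "l1 n (\<Sum>b\<in>X. vscale (?r x b) b) \<le> (\<Sum>b\<in>X. l1 n (vscale (?r x b) b))" if "finite X" for X
      using that
    proof (induction X rule: finite_induct)
      case (insert b X)
      then show ?case
        using l1_triangle[of n "vscale (?r x b) b" "\<Sum>b\<in>X. vscale (?r x b) b"]
        unfolding sum.insert[OF insert.hyps] by linarith
    qed (simp only: sum.empty l1_zero order_refl)
    have 2: "(\<Sum>b\<in>B. l1 n (vscale (?r x b) b)) \<le> (\<Sum>b\<in>B. l1 n b)"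
      using x by (intro sum_mono) (auto simp: A_def l1_vscale intro!: mult_left_le_one_le)
    have 3: "l1 n (vscale (?r x a) a) \<le> l1 n a"
      using x by (auto simp: A_def l1_vscale intro!: mult_left_le_one_le)
    have "l1 n x \<le> l1 n (\<Sum>b\<in>B. vscale (?r x b) b) + l1 n (vscale (?r x a) a)"
      using expand[of x] x l1_triangle[of n "\<Sum>b\<in>B. vscale (?r x b) b" "vscale (?r x a) a"] by (simp add: A_def)
    then have "l1 n x \<le> (\<Sum>b\<in>B. l1 n b) + l1 n a" using 1[OF fB] 2 3 by linarith
    then show "x \<in> {x \<in> L. l1 n x \<le> (\<Sum>b\<in>B. l1 n b) + l1 n a}" using x by (simp add: A_def)
  qed
  then have finA: "finite A" using L_discrete finite_subset by blast
  have "?r a a = 1" "\<And>b. b \<in> B \<Longrightarrow> ?r a b = 0"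
    using rvec.representation_basis[OF i, of a] aB by auto
  then have "a \<in> A" using a(1) spa by (simp add: A_def)
  then obtain c where c: "c \<in> A" "\<And>x. x \<in> A \<Longrightarrow> ?r c a \<le> ?r x a"
    using finA arg_min_if_finite(1)[of A "\<lambda>x. ?r x a"] arg_min_least[of A _ "\<lambda>x. ?r x a"] by blast
  have cL: "c \<in> L" "c \<in> rvec.span ?B" and t: "0 < ?r c a" using c(1) by (auto simp: A_def)
  have cS: "c \<notin> rvec.span B" using span_zero t by force
  have cB: "c \<notin> B" using cS rvec.span_base by blast
  have ic: "rvec.independent (insert c B)" using cS iB by (rule rvec.independent_insertI)
  have "rvec.representation (insert c B) x b \<in> \<int>"
    if x: "x \<in> L" "x \<in> rvec.span (insert c B)" and b: "b \<in> insert c B" for x b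
  proof -
    have xs: "x \<in> rvec.span ?B"
      using x(2) cL(2) rvec.span_minimal[OF _ rvec.subspace_span, of "insert c B" ?B] spa by blast
    \<comment> \<open>Division with remainder by \<open>c\<close>: the \<open>a\<close>-coordinate
      of the remainder \<open>y\<close> is nonnegative and below that of \<open>c\<close>.\<close>
    define q where "q = \<lfloor>?r x a / ?r c a\<rfloor>"
    define y where "y = x - vscale (of_int q) c"
    have yL: "y \<in> L" unfolding y_def by (intro L_diff x L_int_scale cL) auto
    have ys: "y \<in> rvec.span ?B" unfolding y_def by (intro rvec.span_diff xs rvec.span_scale cL)
    have ya: "?r y a = ?r x a - of_int q * ?r c a"
      unfolding y_def using xs cL by (simp add: rvec.representation_diff[OF i] rvec.representation_scale[OF i] rvec.span_scale)
    have q: "of_int q \<le> ?r x a / ?r c a" "?r x a / ?r c a < of_int q + 1"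
      unfolding q_def by linarith+
    have ya0: "0 \<le> ?r y a" using q(1) t unfolding ya by (simp add: field_simps)
    have ya1: "?r y a < ?r c a" using q(2) t unfolding ya by (simp add: field_simps)
    \<comment> \<open>Subtracting integral parts along \<open>B\<close> moves the
      \<open>B\<close>-coordinates of \<open>y\<close> into the box and leaves its
      \<open>a\<close>-coordinate unchanged.\<close>
    define z where "z = y - (\<Sum>b\<in>B. vscale (of_int \<lfloor>?r y b\<rfloor>) b)"
    have zL: "z \<in> L" unfolding z_def using BL by (intro L_diff yL L_sum L_int_scale) auto
    have ss: "(\<Sum>b\<in>B. vscale (of_int \<lfloor>?r y b\<rfloor>) b) \<in> rvec.span B"
      by (intro rvec.span_sum rvec.span_scale rvec.span_base)
    have zs: "z \<in> rvec.span ?B" unfolding z_def by (intro rvec.span_diff ys spanL ss)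
    have rs: "?r (\<Sum>b\<in>B. vscale (of_int \<lfloor>?r y b\<rfloor>) b) d = (if d \<in> B then of_int \<lfloor>?r y d\<rfloor> else 0)" for d
    proof -
      have "?r (\<Sum>b\<in>B. vscale (of_int \<lfloor>?r y b\<rfloor>) b) d = (\<Sum>b\<in>B. of_int \<lfloor>?r y b\<rfloor> * ?r b d)"
        using spa(2) by (simp add: rvec.representation_sum[OF i] rvec.representation_scale[OF i] rvec.span_scale sum_fun_apply)
      also have "\<dots> = (\<Sum>b\<in>B. if b = d then of_int \<lfloor>?r y b\<rfloor> else 0)"
        by (intro sum.cong) (auto simp: rvec.representation_basis[OF i])
      also have "\<dots> = (if d \<in> B then of_int \<lfloor>?r y d\<rfloor> else 0)"
        using fB by simp
      finally show ?thesis .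
    qed
    have rz: "?r z d = ?r y d - (if d \<in> B then of_int \<lfloor>?r y d\<rfloor> else 0)" for d
      unfolding z_def using ys spanL[OF ss] rs[of d] by (simp add: rvec.representation_diff[OF i])
    have za: "?r z a = ?r y a" using rz aB by simp
    have zb: "0 \<le> ?r z b \<and> ?r z b < 1" if "b \<in> B" for b
      using rz[of b] that frac_ge_0[of "?r y b"] frac_lt_1[of "?r y b"] by (simp add: frac_def)
    have cl1: "?r c a \<le> 1" using c(1) by (simp add: A_def)
    \<comment> \<open>Otherwise \<open>z\<close> would lie in \<open>A\<close> with a smaller
      \<open>a\<close>-coordinate than \<open>c\<close>.\<close>
    have "?r y a = 0"
    proof (rule ccontr)
      assume "?r y a \<noteq> 0"
      then have "z \<in> A" using ya0 ya1 zL zs za zb cl1 by (auto simp: A_def)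
      then show False using c(2)[of z] za ya1 by simp
    qed
    then have yB: "y \<in> rvec.span B" using ys zero_in_span by blast
    have xy: "x = y + vscale (of_int q) c" by (simp add: y_def)
    have "rvec.representation (insert c B) x b
        = rvec.representation (insert c B) y b + of_int q * rvec.representation (insert c B) c b"
      unfolding xy using yB rvec.span_mono[of B "insert c B"] rvec.span_base[of c "insert c B"]
      by (subst rvec.representation_add[OF ic])
         (auto simp: rvec.representation_scale[OF ic] intro!: rvec.span_scale)
    also have "rvec.representation (insert c B) y = rvec.representation B y"
      by (rule rvec.representation_extend[OF ic yB]) auto
    also have "rvec.representation (insert c B) c b = (if b = c then 1 else 0)"
      using rvec.representation_basis[OF ic, of c] by auto
    also have "rvec.representation B y b \<in> \<int>"
      using intB[OF yL yB] rvec.representation_ne_zero[of B y b] by (cases "b \<in> B") (auto, force)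
    then have "rvec.representation B y b + of_int q * (if b = c then 1 else 0) \<in> \<int>"
      by auto
    finally show ?thesis .
  qed
  then have "integral_basis (insert c B)"
    using ic cL BL by (auto simp: integral_basis_def)
  then show thesis using that cB by blast
qed

lemma ex_spanning_integral_basis:
  obtains B where "integral_basis B" "L \<subseteq> rvec.span B"
proof -
  let ?Q = "\<lambda>k. \<exists>B. integral_basis B \<and> card B = k"
  have "integral_basis {}"
    by (auto simp: integral_basis_def rvec.independent_empty)
  then have "?Q 0" by (intro exI[of _ "{}"]) simp
  moreover have "\<forall>k. ?Q k \<longrightarrow> k \<le> n" using integral_basis_finite by blast
  ultimately obtain k where k: "?Q k" "\<forall>j. ?Q j \<longrightarrow> j \<le> k"
    using Nat.ex_has_greatest_nat[of ?Q 0 n] by blast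
  then obtain B where B: "integral_basis B" "card B = k" by blast
  have "L \<subseteq> rvec.span B"
  proof (rule ccontr)
    assume "\<not> L \<subseteq> rvec.span B"
    then obtain a where "a \<in> L" "a \<notin> rvec.span B" by blast
    then obtain c where "c \<notin> B" "integral_basis (insert c B)"
      using integral_basis_extend[OF B(1)] by blast
    then have "?Q (Suc k)" using B integral_basis_finite[OF B(1)] by (intro exI[of _ "insert c B"]) auto
    then show False using k(2) by force
  qed
  then show thesis using that B by blast
qed

text \<open>A linear functional that vanishes on \<open>L\<close> is bounded by cocompactness, hence
  zero. For \<open>v\<close> outside the span, the \<open>v\<close>-coordinate in a basis extending
  \<open>insert v B\<close> would be such a functional with the value \<open>N\<close> at
  \<open>N\<close> times \<open>v\<close>, for every \<open>N\<close>.\<close>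

lemma span_L:
  assumes BL: "L \<subseteq> rvec.span B" and B: "rvec.independent B" "B \<subseteq> L"
  shows "\<V> n \<subseteq> rvec.span B"
proof (rule ccontr)
  assume "\<not> \<V> n \<subseteq> rvec.span B"
  then obtain v where v: "v \<in> \<V> n" "v \<notin> rvec.span B" by blast
  have iv: "rvec.independent (insert v B)" using v(2) B(1) by (rule rvec.independent_insertI)
  have sub: "insert v B \<subseteq> \<V> n" using v B(2) L_sub by blast
  obtain C where C: "insert v B \<subseteq> C" "C \<subseteq> \<V> n" "rvec.independent C"
     "\<V> n \<subseteq> rvec.span C"
    using rvec.maximal_independent_subset_extend[OF sub iv] .
  let ?f = "\<lambda>x. rvec.representation C x v"
  define S where "S = (\<Sum>i<n. \<bar>?f (basis_vect i)\<bar>)"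
  have bd: "\<bar>?f x\<bar> \<le> S * l1 n x" if x: "x \<in> \<V> n" for x
  proof -
    have "?f x = ?f (\<Sum>i<n. vscale (x i) (basis_vect i))"
      using Euclidean_basis_expansion[OF x] by simp
    also have "\<dots> = (\<Sum>i<n. x i * ?f (basis_vect i))"
      using C(4) basis_vect_in_Euclidean
      by (subst rvec.representation_sum[OF C(3)])
         (auto simp: rvec.representation_scale[OF C(3)] subset_iff sum_fun_apply intro!: rvec.span_scale)
    finally have "\<bar>?f x\<bar> \<le> (\<Sum>i<n. \<bar>x i * ?f (basis_vect i)\<bar>)" by (metis sum_abs)
    also have "\<dots> \<le> (\<Sum>i<n. l1 n x * \<bar>?f (basis_vect i)\<bar>)"
      by (intro sum_mono) (auto simp: abs_mult intro!: mult_right_mono abs_le_l1)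
    finally show ?thesis by (simp add: S_def sum_distrib_left mult.commute)
  qed
  obtain N :: nat where N: "S * M < of_nat N" using reals_Archimedean2 by blast
  have "vscale (of_nat N) v \<in> \<V> n" using v by (simp add: topspace_Euclidean_space_closed)
  then obtain x where x: "x \<in> L" "l1 n (vscale (of_nat N) v - x) \<le> M" using L_cocompact by blast
  have xt: "x \<in> \<V> n" using x L_sub by blast
  have vB: "v \<notin> B" using v(2) rvec.span_base by blast
  have "rvec.representation C x = rvec.representation B x"
    using C(1) BL x by (intro rvec.representation_extend[OF C(3)]) auto
  then have fx: "?f x = 0" using rvec.representation_ne_zero[of B x v] vB by force
  have fv: "?f v = 1" using rvec.representation_basis[OF C(3), of v] C(1) by simp
  have "?f (vscale (of_nat N) v - x) = of_nat N"
    using C(4) v xt fx fv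
    by (subst rvec.representation_diff[OF C(3)])
       (auto simp: rvec.representation_scale[OF C(3)] subset_iff intro!: rvec.span_scale)
  moreover have "\<bar>?f (vscale (of_nat N) v - x)\<bar> \<le> S * l1 n (vscale (of_nat N) v - x)"
    using v xt by (intro bd topspace_Euclidean_space_closed)
  moreover have "S * l1 n (vscale (of_nat N) v - x) \<le> S * M"
    using x(2) by (intro mult_left_mono) (auto simp: S_def sum_nonneg)
  ultimately show False using N by simp
qed

lemma ex_lattice_coordinates:
  obtains B :: "(nat \<Rightarrow> real) set" and c :: "(nat \<Rightarrow> real) \<Rightarrow> (nat \<Rightarrow> real) \<Rightarrow> real"
  where "finite B"
    "\<And>b v w. v \<in> \<V> n \<Longrightarrow> w \<in> \<V> n \<Longrightarrow> c b (v + w) = c b v + c b w"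
    "\<And>b. continuous_map (Euclidean_space n) euclideanreal (c b)"
    "\<And>v. v \<in> \<V> n \<Longrightarrow> v \<in> L \<longleftrightarrow> (\<forall>b\<in>B. c b v \<in> \<int>)"
proof -
  obtain B where B: "integral_basis B" "L \<subseteq> rvec.span B" using ex_spanning_integral_basis .
  then have i: "rvec.independent B" and BL: "B \<subseteq> L" and fB: "finite B"
    and intB: "\<And>x b. x \<in> L \<Longrightarrow> x \<in> rvec.span B \<Longrightarrow> b \<in> B \<Longrightarrow> rvec.representation B x b \<in> \<int>"
    using integral_basis_finite by (auto simp: integral_basis_def)
  have sp: "\<V> n \<subseteq> rvec.span B"
    by (rule span_L[OF B(2) i BL])
  define c where "c b v = rvec.representation B v b" for b v
  have expand: "c b v = (\<Sum>i<n. v i * c b (basis_vect i))" if v: "v \<in> \<V> n" for b v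
  proof -
    have "c b v = c b (\<Sum>i<n. vscale (v i) (basis_vect i))"
      using Euclidean_basis_expansion[OF v] by simp
    also have "\<dots> = (\<Sum>i<n. v i * c b (basis_vect i))"
      unfolding c_def using sp basis_vect_in_Euclidean
      by (subst rvec.representation_sum[OF i])
         (auto simp: rvec.representation_scale[OF i] subset_iff sum_fun_apply intro!: rvec.span_scale)
    finally show ?thesis .
  qed
  show thesis
  proof (rule that[OF fB])
    fix b v w assume "v \<in> \<V> n" "w \<in> \<V> n"
    then show "c b (v + w) = c b v + c b w"
      using sp by (auto simp: c_def rvec.representation_add[OF i] subset_iff)
  next
    fix b
    have "continuous_map (Euclidean_space n) euclideanreal (\<lambda>v. \<Sum>i<n. v i * c b (basis_vect i))"
      by (intro continuous_map_sum continuous_map_real_mult continuous_map_Euclidean_proj) auto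
    then show "continuous_map (Euclidean_space n) euclideanreal (c b)"
      by (rule continuous_map_eq) (simp add: expand)
  next
    fix v assume v: "v \<in> \<V> n"
    have "v = (\<Sum>b\<in>B. vscale (c b v) b)"
      unfolding c_def using rvec.sum_representation_eq[OF i _ fB order_refl, of v] sp v by auto
    moreover have "(\<Sum>b\<in>B. vscale (c b v) b) \<in> L" if "\<forall>b\<in>B. c b v \<in> \<int>"
      using that BL by (intro L_sum L_int_scale) auto
    ultimately show "v \<in> L \<longleftrightarrow> (\<forall>b\<in>B. c b v \<in> \<int>)"
      using intB sp v by (auto simp: c_def)
  qed
qed

end

section \<open>Characters of the identity component\<close>

context compact_top_group begin

lemma open_subgroup_closed:
  assumes H: "subgroup H K" "openin T H"
  shows "closedin T H"
proof -
  have "openin T (\<Union>a\<in>carrier K - H. (\<lambda>x. a \<otimes> x) ` H)"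
    using H(2) by (intro openin_Union) (auto intro: openin_translate)
  moreover have "(\<Union>a\<in>carrier K - H. (\<lambda>x. a \<otimes> x) ` H) = topspace T - H"
  proof (intro equalityI subsetI)
    fix y assume "y \<in> (\<Union>a\<in>carrier K - H. (\<lambda>x. a \<otimes> x) ` H)"
    then obtain a x where a: "a \<in> carrier K" "a \<notin> H" "x \<in> H" "y = a \<otimes> x" by auto
    have x: "x \<in> carrier K" using a(3) subgroup.subset[OF H(1)] by blast
    have "y \<notin> H"
    proof
      assume "y \<in> H"
      then have "y \<otimes> inv x \<in> H" using H(1) a(3) by (simp add: subgroup.m_closed subgroup.m_inv_closed)
      moreover have "y \<otimes> inv x = a" using a x by (simp add: m_assoc)
      ultimately show False using a by simp
    qed
    then show "y \<in> topspace T - H" using a x by (simp add: topspace_eq)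
  next
    fix y assume y: "y \<in> topspace T - H"
    then have "y \<otimes> \<one> \<in> (\<lambda>x. y \<otimes> x) ` H" using subgroup.one_closed[OF H(1)] by blast
    then show "y \<in> (\<Union>a\<in>carrier K - H. (\<lambda>x. a \<otimes> x) ` H)" using y topspace_eq by auto
  qed
  ultimately show ?thesis
    using subgroup.subset[OF H(1)] by (auto simp: closedin_def topspace_eq)
qed

end

context group_exponential begin

lemma Ex_closed: "v \<in> \<V> n \<Longrightarrow> Ex v \<in> carrier K"
  using continuous_map_image_subset_topspace[OF Ex_cont] topspace_eq by auto

lemma Ex_zero: "Ex 0 = \<one>"
  using Ex_add[of 0 0] Ex_closed[of 0] by simp

lemma Ex_diff: "v \<in> \<V> n \<Longrightarrow> w \<in> \<V> n \<Longrightarrow> Ex (v - w) \<otimes> Ex w = Ex v"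
  using Ex_add[of "v - w" w] by (simp add: topspace_Euclidean_space_closed)

lemma Ex_eq_iff: "v \<in> \<V> n \<Longrightarrow> w \<in> \<V> n \<Longrightarrow> Ex v = Ex w \<longleftrightarrow> Ex (v - w) = \<one>"
  using Ex_diff[of v w] Ex_closed[of w] Ex_closed[of "v - w"]
  by (auto simp: topspace_Euclidean_space_closed)

lemma Ex_inv: "v \<in> \<V> n \<Longrightarrow> inv (Ex v) = Ex (0 - v)"
  using Ex_diff[of 0 v] Ex_closed[of v] Ex_closed[of "0 - v"] topspace_Euclidean_space_closed(2)[of 0 n v] Ex_zero
  by (intro inv_equality) auto

lemma range_subgroup: "subgroup (Ex ` \<V> n) K"
proof (rule subgroupI)
  fix a b assume "a \<in> Ex ` \<V> n" "b \<in> Ex ` \<V> n"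
  then obtain v w where "v \<in> \<V> n" "a = Ex v" "w \<in> \<V> n" "b = Ex w" by blast
  then show "a \<otimes> b \<in> Ex ` \<V> n"
    using Ex_add topspace_Euclidean_space_closed(1) by (metis image_eqI)
next
  fix a assume "a \<in> Ex ` \<V> n"
  then obtain v where v: "v \<in> \<V> n" "a = Ex v" by blast
  show "inv a \<in> Ex ` \<V> n"
    unfolding v(2) Ex_inv[OF v(1)] using v by (intro imageI topspace_Euclidean_space_closed) auto
qed (use Ex_closed nontrivial_Euclidean_space in auto)

lemma range_open: "openin T (Ex ` \<V> n)"
  by (rule Ex_open) simp

definition L where "L = {v \<in> \<V> n. Ex v = \<one>}"

text \<open>Space is cut into cubes of side \<open>s\<close> with \<open>n * s < \<eta>\<close>. Two
  points of \<open>L\<close> in the same cube differ by an element of \<open>l1ball n \<eta>\<close>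
  on which \<open>Ex\<close> takes the value \<open>\<one>\<close>, and local injectivity makes it
  0. A bounded region meets finitely many cubes.\<close>

lemma L_finite: "finite {x \<in> L. l1 n x \<le> b}"
proof -
  define s where "s = \<eta> / (real n + 1)"
  have s: "s > 0" "real n * s < \<eta>" using \<eta>_pos by (auto simp: s_def field_simps)
  define f where "f x = (\<lambda>i\<in>{..<n}. \<lfloor>x i / s\<rfloor>)" for x :: "nat \<Rightarrow> real"
  have "f ` {x \<in> L. l1 n x \<le> b} \<subseteq> (\<Pi>\<^sub>E i\<in>{..<n}. {\<lfloor>- b / s\<rfloor>..\<lfloor>b / s\<rfloor>})"
  proof
    fix y assume "y \<in> f ` {x \<in> L. l1 n x \<le> b}"
    then obtain x where x: "y = f x" "l1 n x \<le> b" by auto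
    have "- b / s \<le> x i / s" "x i / s \<le> b / s" if "i < n" for i
      using abs_le_l1[OF that, of x] x(2) s(1) by (intro divide_right_mono; simp)+
    then show "y \<in> (\<Pi>\<^sub>E i\<in>{..<n}. {\<lfloor>- b / s\<rfloor>..\<lfloor>b / s\<rfloor>})"
      unfolding x(1) f_def by (intro restrict_PiE_iff[THEN iffD2] ballI) (simp add: floor_mono)
  qed
  then have "finite (f ` {x \<in> L. l1 n x \<le> b})"
    by (rule finite_subset) (intro finite_PiE; simp)
  moreover have "inj_on f {x \<in> L. l1 n x \<le> b}"
  proof (rule inj_onI)
    fix x y assume "x \<in> {x \<in> L. l1 n x \<le> b}" "y \<in> {x \<in> L. l1 n x \<le> b}" and eq: "f x = f y"
    then have xy: "x \<in> \<V> n" "y \<in> \<V> n" "Ex x = \<one>" "Ex y = \<one>" by (auto simp: L_def)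
    have "\<bar>x i - y i\<bar> \<le> s" if "i < n" for i
    proof -
      have "\<lfloor>x i / s\<rfloor> = \<lfloor>y i / s\<rfloor>" using fun_cong[OF eq, of i] that by (simp add: f_def)
      then have "\<bar>x i / s - y i / s\<bar> \<le> 1" by linarith
      then have "\<bar>(x i - y i) / s\<bar> \<le> 1" by (simp add: diff_divide_distrib)
      then show ?thesis using s(1) by (simp add: abs_divide field_simps)
    qed
    then have "l1 n (x - y) \<le> (\<Sum>i<n. s)" unfolding l1_def by (intro sum_mono) auto
    then have "l1 n (x - y) < \<eta>" using s(2) by simp
    then have "x - y \<in> l1ball n \<eta>" using xy by (simp add: l1ball_def topspace_Euclidean_space_closed)
    moreover have "Ex (x - y) = Ex 0" using Ex_eq_iff[OF xy(1,2)] xy Ex_zero by simp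
    ultimately have "x - y = 0" using Ex_inj \<eta>_pos by (auto dest: inj_onD)
    then show "x = y" by simp
  qed
  ultimately show ?thesis by (rule finite_imageD)
qed

text \<open>The range of \<open>Ex\<close> is an open subgroup, hence closed and compact, so
  finitely many images of balls cover it. A preimage of \<open>Ex v\<close> in one of these balls
  differs from \<open>v\<close> by an element of \<open>L\<close>.\<close>

lemma ex_cocompact: "\<exists>M. \<forall>v\<in>\<V> n. \<exists>x\<in>L. l1 n (v - x) \<le> M"
proof -
  have "compactin T (Ex ` \<V> n)"
    using open_subgroup_closed[OF range_subgroup range_open] compact closedin_compact_space by blast
  moreover have "\<forall>W\<in>range (\<lambda>k::nat. Ex ` l1ball n (real k)). openin T W"
    using Ex_open openin_l1ball by auto
  moreover have "Ex ` \<V> n \<subseteq> \<Union> (range (\<lambda>k::nat. Ex ` l1ball n (real k)))"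
  proof safe
    fix v assume "v \<in> \<V> n"
    moreover obtain k :: nat where "l1 n v < real k" using reals_Archimedean2 by blast
    ultimately show "Ex v \<in> \<Union> (range (\<lambda>k::nat. Ex ` l1ball n (real k)))" by (auto simp: l1ball_def)
  qed
  ultimately obtain F where F: "finite F" "F \<subseteq> range (\<lambda>k::nat. Ex ` l1ball n (real k))" "Ex ` \<V> n \<subseteq> \<Union> F"
    unfolding compactin_def by meson
  obtain I :: "nat set" where I: "finite I" "F = (\<lambda>k. Ex ` l1ball n (real k)) ` I"
    using finite_subset_image[OF F(1,2)] by blast
  have "\<exists>x\<in>L. l1 n (v - x) \<le> real (Max (insert 0 I))" if v: "v \<in> \<V> n" for v
  proof -
    obtain k w where k: "k \<in> I" "w \<in> l1ball n (real k)" "Ex v = Ex w" using F(3) I(2) v by blast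
    have w: "w \<in> \<V> n" "l1 n w < real k" using k(2) by (auto simp: l1ball_def)
    have "v - w \<in> L" using Ex_eq_iff[OF v w(1)] k(3) v w by (simp add: L_def topspace_Euclidean_space_closed)
    moreover have "k \<le> Max (insert 0 I)" using k(1) I(1) by (intro Max_ge) auto
    then have "l1 n (v - (v - w)) \<le> real (Max (insert 0 I))" using w(2) by simp
    ultimately show ?thesis by blast
  qed
  then show ?thesis by blast
qed

text \<open>Integrality of all coordinates describes \<open>L\<close>, the kernel of
  \<open>Ex\<close>. In one direction this makes \<open>cis (2 * pi * c b v)\<close> depend on
  \<open>Ex v\<close> only, in the other it makes these characters separate points. Continuity
  descends because \<open>Ex\<close> is open.\<close>

lemma ex_separating_characters:
  obtains B :: "(nat \<Rightarrow> real) set" and \<psi> :: "(nat \<Rightarrow> real) \<Rightarrow> 'a \<Rightarrow> complex" where "finite B"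
    "\<And>b x y. b \<in> B \<Longrightarrow> x \<in> Ex ` \<V> n \<Longrightarrow> y \<in> Ex ` \<V> n \<Longrightarrow> \<psi> b (x \<otimes> y) = \<psi> b x * \<psi> b y"
    "\<And>b x. b \<in> B \<Longrightarrow> x \<in> Ex ` \<V> n \<Longrightarrow> norm (\<psi> b x) = 1"
    "\<And>b. b \<in> B \<Longrightarrow> continuous_map (subtopology T (Ex ` \<V> n)) euclidean (\<psi> b)"
    "\<And>x. x \<in> Ex ` \<V> n \<Longrightarrow> (\<And>b. b \<in> B \<Longrightarrow> \<psi> b x = 1) \<Longrightarrow> x = \<one>"
proof -
  obtain M where M: "\<And>v. v \<in> \<V> n \<Longrightarrow> \<exists>x\<in>L. l1 n (v - x) \<le> M" using ex_cocompact by blast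
  interpret euclidean_lattice n L M
  proof
    fix x y assume "x \<in> L" "y \<in> L"
    then show "x + y \<in> L" using Ex_add by (auto simp: L_def topspace_Euclidean_space_closed)
  next
    fix x assume "x \<in> L"
    then show "- x \<in> L" using Ex_inv[of x] topspace_Euclidean_space_closed(2)[of 0 n x] by (auto simp: L_def)
  qed (use Ex_zero L_finite M in \<open>auto simp: L_def\<close>)
  obtain B :: "(nat \<Rightarrow> real) set" and c :: "(nat \<Rightarrow> real) \<Rightarrow> (nat \<Rightarrow> real) \<Rightarrow> real" where B: "finite B"
    "\<And>b v w. v \<in> \<V> n \<Longrightarrow> w \<in> \<V> n \<Longrightarrow> c b (v + w) = c b v + c b w"
    "\<And>b. continuous_map (Euclidean_space n) euclideanreal (c b)"
    "\<And>v. v \<in> \<V> n \<Longrightarrow> v \<in> L \<longleftrightarrow> (\<forall>b\<in>B. c b v \<in> \<int>)"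
    by (rule ex_lattice_coordinates) blast
  \<comment> \<open>\<open>inv_into\<close> picks some logarithm of \<open>h\<close>; any two differ
    by an element of \<open>L\<close>, so the next fact frees the formula from the choice.\<close>
  define \<psi> where "\<psi> b h = cis (2 * pi * c b (inv_into (\<V> n) Ex h))" for b h
  have \<psi>: "\<psi> b (Ex v) = cis (2 * pi * c b v)" if b: "b \<in> B" and v: "v \<in> \<V> n" for b v
  proof -
    define w where "w = inv_into (\<V> n) Ex (Ex v)"
    have w: "w \<in> \<V> n" "Ex w = Ex v" using v by (auto simp: w_def inv_into_into f_inv_into_f)
    have vw: "w - v \<in> \<V> n" using v w by (simp add: topspace_Euclidean_space_closed)
    then have "w - v \<in> L" using Ex_eq_iff[OF w(1) v] w(2) by (simp add: L_def)
    then have "c b (w - v) \<in> \<int>" using B(4)[OF vw] b by blast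
    moreover have "c b w = c b (w - v) + c b v" using B(2)[OF vw v, of b] by simp
    ultimately show ?thesis
      unfolding \<psi>_def w_def[symmetric] by (simp add: distrib_left cis_mult[symmetric] cis_multiple_2pi)
  qed
  show thesis
  proof (rule that[OF B(1)])
    fix b x y assume b: "b \<in> B" and "x \<in> Ex ` \<V> n" "y \<in> Ex ` \<V> n"
    then obtain v w where vw: "v \<in> \<V> n" "x = Ex v" "w \<in> \<V> n" "y = Ex w" by blast
    have "x \<otimes> y = Ex (v + w)" using Ex_add vw by simp
    then show "\<psi> b (x \<otimes> y) = \<psi> b x * \<psi> b y"
      using vw b by (simp add: \<psi> B(2) topspace_Euclidean_space_closed distrib_left cis_mult)
  next
    fix b x assume "b \<in> B" "x \<in> Ex ` \<V> n"
    then show "norm (\<psi> b x) = 1" by (auto simp: \<psi>_def)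
  next
    fix b assume b: "b \<in> B"
    show "continuous_map (subtopology T (Ex ` \<V> n)) euclidean (\<psi> b)"
      unfolding continuous_map
    proof (intro conjI allI impI)
      fix W :: "complex set" assume W: "openin euclidean W"
      have "continuous_map (Euclidean_space n) euclidean (\<lambda>v. cis (2 * pi * c b v))"
      proof -
        have "continuous_map euclideanreal euclidean (\<lambda>t. cis (2 * pi * t))"
          by (auto intro!: continuous_intros)
        from continuous_map_compose[OF B(3) this] show ?thesis by (simp add: o_def)
      qed
      from openin_continuous_map_preimage[OF this W]
      have "openin T (Ex ` {v \<in> \<V> n. cis (2 * pi * c b v) \<in> W})" by (rule Ex_open)
      moreover have "Ex ` {v \<in> \<V> n. cis (2 * pi * c b v) \<in> W} = {x \<in> topspace (subtopology T (Ex ` \<V> n)). \<psi> b x \<in> W}"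
        using \<psi>[OF b] Ex_closed by (auto simp: topspace_eq)
      ultimately show "openin (subtopology T (Ex ` \<V> n)) {x \<in> topspace (subtopology T (Ex ` \<V> n)). \<psi> b x \<in> W}"
        using openin_open_subtopology[OF range_open] by auto
    qed auto
  next
    fix x assume "x \<in> Ex ` \<V> n" and 1: "\<And>b. b \<in> B \<Longrightarrow> \<psi> b x = 1"
    then obtain v where v: "v \<in> \<V> n" "x = Ex v" by blast
    have "c b v \<in> \<int>" if b: "b \<in> B" for b
    proof -
      have "cis (2 * pi * c b v) = 1" using 1[OF b] \<psi>[OF b v(1)] v(2) by simp
      then have "cos (2 * pi * c b v) = 1" by (metis Re_complex_of_real cis.sel(1) of_real_1)
      then obtain k :: int where "2 * pi * c b v = of_int k * 2 * pi" using cos_one_2pi_int by auto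
      then have "c b v = of_int k" by simp
      then show ?thesis by simp
    qed
    then have "v \<in> L" using B(4)[OF v(1)] by blast
    then show "x = \<one>" using v(2) by (simp add: L_def)
  qed
qed

end

section \<open>Null-homotopic matrices\<close>

definition mmul :: "'i set \<Rightarrow> ('i \<Rightarrow> 'i \<Rightarrow> 'c::comm_semiring_1) \<Rightarrow> ('i \<Rightarrow> 'i \<Rightarrow> 'c) \<Rightarrow> 'i \<Rightarrow> 'i \<Rightarrow> 'c" where
  "mmul I A B i k = (\<Sum>j\<in>I. A i j * B j k)"

definition mid :: "'i \<Rightarrow> 'i \<Rightarrow> 'c::comm_semiring_1" where
  "mid i j = (if i = j then 1 else 0)"

text \<open>Matrices are total functions whose entries outside \<open>I\<close> carry no meaning, so
  equality is tested on \<open>I\<close> only.\<close>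

definition eq_on :: "'i set \<Rightarrow> ('i \<Rightarrow> 'i \<Rightarrow> 'c) \<Rightarrow> ('i \<Rightarrow> 'i \<Rightarrow> 'c) \<Rightarrow> bool" where
  "eq_on I A B \<longleftrightarrow> (\<forall>i\<in>I. \<forall>j\<in>I. A i j = B i j)"

definition inverse_on :: "'i set \<Rightarrow> ('i \<Rightarrow> 'i \<Rightarrow> 'c::comm_semiring_1) \<Rightarrow> ('i \<Rightarrow> 'i \<Rightarrow> 'c) \<Rightarrow> bool" where
  "inverse_on I A B \<longleftrightarrow> eq_on I (mmul I A B) mid \<and> eq_on I (mmul I B A) mid"

lemma eq_on_refl [simp]: "eq_on I A A"
  by (simp add: eq_on_def)

lemma eq_on_sym: "eq_on I A B \<Longrightarrow> eq_on I B A"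
  by (simp add: eq_on_def)

lemma eq_on_trans: "eq_on I A B \<Longrightarrow> eq_on I B C \<Longrightarrow> eq_on I A C"
  by (simp add: eq_on_def)

lemma mmul_cong: "eq_on I A A' \<Longrightarrow> eq_on I B B' \<Longrightarrow> eq_on I (mmul I A B) (mmul I A' B')"
  unfolding eq_on_def mmul_def by (auto intro!: sum.cong)

lemma mmul_assoc: "mmul I (mmul I A B) C = mmul I A (mmul I B C)"
proof (intro ext)
  fix i k
  have "mmul I (mmul I A B) C i k = (\<Sum>j\<in>I. \<Sum>l\<in>I. A i l * B l j * C j k)"
    by (simp add: mmul_def sum_distrib_right)
  also have "\<dots> = (\<Sum>l\<in>I. \<Sum>j\<in>I. A i l * B l j * C j k)" by (rule sum.swap)
  also have "\<dots> = mmul I A (mmul I B C) i k"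
    by (simp add: mmul_def sum_distrib_left mult.assoc)
  finally show "mmul I (mmul I A B) C i k = mmul I A (mmul I B C) i k" .
qed

lemma mmul_mid_left: "finite I \<Longrightarrow> eq_on I (mmul I mid A) A"
  by (auto simp: eq_on_def mmul_def mid_def if_distrib[of "\<lambda>x. x * _"] cong: if_cong)

lemma mmul_mid_right: "finite I \<Longrightarrow> eq_on I (mmul I A mid) A"
  by (auto simp: eq_on_def mmul_def mid_def if_distrib[of "\<lambda>x. _ * x"] cong: if_cong)

lemma inverse_on_sym: "inverse_on I A B \<Longrightarrow> inverse_on I B A"
  by (simp add: inverse_on_def)

lemma inverse_on_mmul:
  assumes I: "finite I" and 1: "inverse_on I A A'" and 2: "inverse_on I B B'"
  shows "inverse_on I (mmul I A B) (mmul I B' A')"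
proof -
  have *: "eq_on I (mmul I (mmul I A B) (mmul I B' A')) mid"
    if 1: "eq_on I (mmul I A A') mid" and 2: "eq_on I (mmul I B B') mid" for A A' B B' :: "'a \<Rightarrow> 'a \<Rightarrow> 'b"
  proof -
    have "eq_on I (mmul I A (mmul I (mmul I B B') A')) (mmul I A (mmul I mid A'))"
      by (intro mmul_cong eq_on_refl 2)
    moreover have "eq_on I (mmul I A (mmul I mid A')) (mmul I A A')"
      by (intro mmul_cong eq_on_refl mmul_mid_left I)
    moreover have "mmul I (mmul I A B) (mmul I B' A') = mmul I A (mmul I (mmul I B B') A')"
      by (simp only: mmul_assoc)
    ultimately show ?thesis using 1 eq_on_trans by metis
  qed
  then show ?thesis using 1 2 by (auto simp: inverse_on_def)
qed

text \<open>The path of inverses is carried along with its own continuity, so that neither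
  determinants nor the continuity of matrix inversion enter.\<close>

definition path_to_id :: "'i set \<Rightarrow> (real \<Rightarrow> 'i \<Rightarrow> 'i \<Rightarrow> real) \<Rightarrow> (real \<Rightarrow> 'i \<Rightarrow> 'i \<Rightarrow> real) \<Rightarrow> ('i \<Rightarrow> 'i \<Rightarrow> real) \<Rightarrow> bool" where
  "path_to_id I \<gamma> \<gamma>' M \<longleftrightarrow>
     (\<forall>i\<in>I. \<forall>j\<in>I. continuous_on {0..1} (\<lambda>t. \<gamma> t i j)) \<and>
     (\<forall>i\<in>I. \<forall>j\<in>I. continuous_on {0..1} (\<lambda>t. \<gamma>' t i j)) \<and>
     (\<forall>t\<in>{0..1}. inverse_on I (\<gamma> t) (\<gamma>' t)) \<and>
     eq_on I (\<gamma> 0) mid \<and> eq_on I (\<gamma> 1) M"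

definition null_homotopic :: "'i set \<Rightarrow> ('i \<Rightarrow> 'i \<Rightarrow> real) \<Rightarrow> bool" where
  "null_homotopic I M \<longleftrightarrow> (\<exists>\<gamma> \<gamma>'. path_to_id I \<gamma> \<gamma>' M)"

lemma null_homotopic_cong: "eq_on I M M' \<Longrightarrow> null_homotopic I M \<Longrightarrow> null_homotopic I M'"
  unfolding null_homotopic_def path_to_id_def by (blast intro: eq_on_trans)

lemma null_homotopic_mid:
  assumes "finite I"
  shows "null_homotopic I mid"
proof -
  have "inverse_on I mid (mid :: 'a \<Rightarrow> 'a \<Rightarrow> real)"
    using mmul_mid_left[OF assms] by (auto simp: inverse_on_def)
  then show ?thesis
    unfolding null_homotopic_def path_to_id_def
    by (intro exI[of _ "\<lambda>_. mid"]) (auto intro: continuous_intros)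
qed

lemma null_homotopic_mmul:
  assumes I: "finite I" and "null_homotopic I M" "null_homotopic I N"
  shows "null_homotopic I (mmul I M N)"
proof -
  obtain f f' where f: "path_to_id I f f' M" using assms(2) by (auto simp: null_homotopic_def)
  obtain g g' where g: "path_to_id I g g' N" using assms(3) by (auto simp: null_homotopic_def)
  have "path_to_id I (\<lambda>t. mmul I (f t) (g t)) (\<lambda>t. mmul I (g' t) (f' t)) (mmul I M N)"
    unfolding path_to_id_def
  proof (intro conjI ballI)
    fix i j assume "i \<in> I" "j \<in> I"
    then show "continuous_on {0..1} (\<lambda>t. mmul I (f t) (g t) i j)"
      "continuous_on {0..1} (\<lambda>t. mmul I (g' t) (f' t) i j)"
      unfolding mmul_def using f g by (auto simp: path_to_id_def intro!: continuous_intros)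
  next
    fix t :: real assume "t \<in> {0..1}"
    then show "inverse_on I (mmul I (f t) (g t)) (mmul I (g' t) (f' t))"
      using f g I by (intro inverse_on_mmul) (auto simp: path_to_id_def)
  next
    have "eq_on I (mmul I (f 0) (g 0)) (mmul I mid mid)"
      using f g by (intro mmul_cong) (auto simp: path_to_id_def)
    then show "eq_on I (mmul I (f 0) (g 0)) mid" using mmul_mid_left[OF I] eq_on_trans by blast
    show "eq_on I (mmul I (f 1) (g 1)) (mmul I M N)"
      using f g by (intro mmul_cong) (auto simp: path_to_id_def)
  qed
  then show ?thesis by (auto simp: null_homotopic_def)
qed

text \<open>A complex structure \<open>J\<close> is joined to the identity by \<open>cos \<theta> + sin \<theta> J\<close>.\<close>

lemma null_homotopic_complex_structure:
  assumes I: "finite I" and J: "eq_on I (mmul I J J) (\<lambda>i k. - mid i k)"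
  shows "null_homotopic I J"
proof -
  \<comment> \<open>\<open>s = -1\<close> gives the inverse path: the product of
    \<open>cos + sin J\<close> and \<open>cos - sin J\<close> is
    \<open>cos^2 - sin^2 J^2 = 1\<close>.\<close>
  define f where "f s t = (\<lambda>i k. cos (pi / 2 * t) * mid i k + s * sin (pi / 2 * t) * J i k)" for s t :: real
  have inv: "eq_on I (mmul I (f s t) (f s' t)) mid" if s: "s = 1 \<and> s' = -1 \<or> s = -1 \<and> s' = 1" for s s' t
    unfolding eq_on_def
  proof (intro ballI)
    fix i k assume ik: "i \<in> I" "k \<in> I"
    let ?c = "cos (pi / 2 * t)" and ?s = "sin (pi / 2 * t)"
    have alg: "c * c * m + c * (s' * x) * j + s * x * c * j + s * x * (s' * x) * - m = (c * c + x * x) * m"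
      for c x m j :: real
      using s by (auto simp: algebra_simps)
    have "mmul I (f s t) (f s' t) i k = ?c * ?c * mmul I mid mid i k + ?c * (s' * ?s) * mmul I mid J i k
       + s * ?s * ?c * mmul I J mid i k + s * ?s * (s' * ?s) * mmul I J J i k"
      unfolding mmul_def f_def sum_distrib_left sum.distrib[symmetric]
      by (intro sum.cong refl) (simp add: algebra_simps)
    also have "\<dots> = ?c * ?c * mid i k + ?c * (s' * ?s) * J i k + s * ?s * ?c * J i k + s * ?s * (s' * ?s) * - mid i k"
      using mmul_mid_left[OF I, of "mid :: _ \<Rightarrow> _ \<Rightarrow> real"] mmul_mid_left[OF I, of J] mmul_mid_right[OF I, of J] J ik
      by (simp add: eq_on_def)
    also have "\<dots> = (?c * ?c + ?s * ?s) * mid i k"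
      by (rule alg)
    finally show "mmul I (f s t) (f s' t) i k = mid i k" by (simp only: sin_cos_squared_add3 mult_1)
  qed
  have "path_to_id I (f 1) (f (-1)) J"
  proof -
    have "continuous_on {0..1} (\<lambda>t. f s t i j)" for s i j
      unfolding f_def by (intro continuous_intros)
    moreover have "eq_on I (f 1 0) mid" "eq_on I (f 1 1) J"
      by (auto simp: f_def eq_on_def)
    ultimately show ?thesis using inv by (simp add: path_to_id_def inverse_on_def)
  qed
  then show ?thesis by (auto simp: null_homotopic_def)
qed

section \<open>Quaternionic monomial matrices\<close>

text \<open>Left multiplication by the quaternion \<open>a + b i + c j + d k\<close>.\<close>

definition quat :: "real \<Rightarrow> real \<Rightarrow> real \<Rightarrow> real \<Rightarrow> nat \<Rightarrow> nat \<Rightarrow> real" where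
  "quat a b c d u v = [[a, -b, -c, -d], [b, a, -d, c], [c, d, a, -b], [d, -c, b, a]] ! u ! v"

lemma less_4_cases: "u < 4 \<longleftrightarrow> u = 0 \<or> u = 1 \<or> u = 2 \<or> u = (3::nat)"
  by auto

lemma quat_mult:
  assumes "u < (4::nat)" "v < 4"
  shows "(\<Sum>w<4. quat a b c d u w * quat a' b' c' d' w v) =
    quat (a * a' - b * b' - c * c' - d * d') (a * b' + b * a' + c * d' - d * c')
      (a * c' - b * d' + c * a' + d * b') (a * d' + b * c' - c * b' + d * a') u v"
proof -
  have "{..<4} = {0, 1, 2, 3::nat}" by auto
  then show ?thesis
    using assms unfolding less_4_cases by (elim disjE; simp add: quat_def algebra_simps)
qed

lemma quat_one: "u < 4 \<Longrightarrow> v < 4 \<Longrightarrow> quat r 0 0 0 u v = (if u = v then r else 0)"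
  unfolding less_4_cases by (auto simp: quat_def)

text \<open>Block monomial matrices with index set \<open>J \<times> {..<4}\<close>: the block in column \<open>b\<close> sits in row \<open>\<pi> b\<close>.
  The blocks of \<open>monomial_inv\<close> sit in the transposed positions.\<close>

definition monomial :: "('b \<Rightarrow> 'b) \<Rightarrow> ('b \<Rightarrow> nat \<Rightarrow> nat \<Rightarrow> real) \<Rightarrow> 'b \<times> nat \<Rightarrow> 'b \<times> nat \<Rightarrow> real" where
  "monomial \<pi> \<kappa> = (\<lambda>(a, u) (b, v). if a = \<pi> b then \<kappa> b u v else 0)"

definition monomial_inv :: "('b \<Rightarrow> 'b) \<Rightarrow> ('b \<Rightarrow> nat \<Rightarrow> nat \<Rightarrow> real) \<Rightarrow> 'b \<times> nat \<Rightarrow> 'b \<times> nat \<Rightarrow> real" where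
  "monomial_inv \<pi> \<kappa> = (\<lambda>(b, v) (a, u). if a = \<pi> b then \<kappa> b v u else 0)"

lemma sum_block: "finite J \<Longrightarrow> (\<Sum>x\<in>J \<times> {..<4::nat}. f x) = (\<Sum>c\<in>J. \<Sum>w<4. f (c, w))"
  by (simp add: sum.cartesian_product)

lemma monomial_mult:
  assumes J: "finite J" and \<pi>': "\<pi>' ` J \<subseteq> J"
  shows "eq_on (J \<times> {..<4}) (mmul (J \<times> {..<4}) (monomial \<pi> \<kappa>) (monomial \<pi>' \<kappa>'))
     (monomial (\<pi> \<circ> \<pi>') (\<lambda>b u v. \<Sum>w<4. \<kappa> (\<pi>' b) u w * \<kappa>' b w v))"
  unfolding eq_on_def
proof (intro ballI, clarsimp)
  fix a u b v assume "a \<in> J" "u < (4::nat)" "b \<in> J" "v < (4::nat)"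
  then have "\<pi>' b \<in> J" using \<pi>' by auto
  have "mmul (J \<times> {..<4}) (monomial \<pi> \<kappa>) (monomial \<pi>' \<kappa>') (a, u) (b, v)
     = (\<Sum>c\<in>J. if c = \<pi>' b then (\<Sum>w<4. monomial \<pi> \<kappa> (a, u) (c, w) * \<kappa>' b w v) else 0)"
    unfolding mmul_def sum_block[OF J] by (intro sum.cong) (auto simp: monomial_def)
  also have "\<dots> = (\<Sum>w<4. monomial \<pi> \<kappa> (a, u) (\<pi>' b, w) * \<kappa>' b w v)"
    using J \<open>\<pi>' b \<in> J\<close> by simp
  also have "\<dots> = monomial (\<pi> \<circ> \<pi>') (\<lambda>b u v. \<Sum>w<4. \<kappa> (\<pi>' b) u w * \<kappa>' b w v) (a, u) (b, v)"
    by (simp add: monomial_def)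
  finally show "mmul (J \<times> {..<4}) (monomial \<pi> \<kappa>) (monomial \<pi>' \<kappa>') (a, u) (b, v)
     = monomial (\<pi> \<circ> \<pi>') (\<lambda>b u v. \<Sum>w<4. \<kappa> (\<pi>' b) u w * \<kappa>' b w v) (a, u) (b, v)" .
qed

lemma monomial_inverse:
  assumes J: "finite J" and \<pi>: "bij_betw \<pi> J J"
    and 1: "\<And>b u v. b \<in> J \<Longrightarrow> u < 4 \<Longrightarrow> v < 4 \<Longrightarrow> (\<Sum>w<4. \<kappa> b u w * \<kappa>' b w v) = (if u = v then 1 else 0)"
    and 2: "\<And>b u v. b \<in> J \<Longrightarrow> u < 4 \<Longrightarrow> v < 4 \<Longrightarrow> (\<Sum>w<4. \<kappa>' b u w * \<kappa> b w v) = (if u = v then 1 else 0)"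
  shows "inverse_on (J \<times> {..<4}) (monomial \<pi> \<kappa>) (monomial_inv \<pi> \<kappa>')"
  unfolding inverse_on_def eq_on_def
proof (intro conjI ballI; clarsimp)
  fix a u a' u' assume *: "a \<in> J" "u < (4::nat)" "a' \<in> J" "u' < (4::nat)"
  obtain b where b: "b \<in> J" "\<pi> b = a" using \<pi> * by (metis bij_betw_def imageE)
  have eq: "a = \<pi> c \<longleftrightarrow> c = b" if "c \<in> J" for c using \<pi> b that by (auto simp: bij_betw_def inj_on_def)
  have "mmul (J \<times> {..<4}) (monomial \<pi> \<kappa>) (monomial_inv \<pi> \<kappa>') (a, u) (a', u')
     = (\<Sum>c\<in>J. if c = b then (if a' = a then \<Sum>w<4. \<kappa> c u w * \<kappa>' c w u' else 0) else 0)"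
    unfolding mmul_def sum_block[OF J] by (intro sum.cong) (use eq b in \<open>auto simp: monomial_def monomial_inv_def\<close>)
  also have "\<dots> = mid (a, u) (a', u')"
    using J b(1) 1[OF b(1) *(2,4)] by (auto simp: mid_def)
  finally show "mmul (J \<times> {..<4}) (monomial \<pi> \<kappa>) (monomial_inv \<pi> \<kappa>') (a, u) (a', u') = mid (a, u) (a', u')" .
next
  fix b v b' v' assume *: "b \<in> J" "v < (4::nat)" "b' \<in> J" "v' < (4::nat)"
  have "\<pi> b \<in> J" using \<pi> * by (auto simp: bij_betw_def)
  have eq: "\<pi> b = \<pi> b' \<longleftrightarrow> b = b'" using \<pi> * by (auto simp: bij_betw_def inj_on_def)
  have "mmul (J \<times> {..<4}) (monomial_inv \<pi> \<kappa>') (monomial \<pi> \<kappa>) (b, v) (b', v')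
     = (\<Sum>c\<in>J. if c = \<pi> b then (if b = b' then \<Sum>w<4. \<kappa>' b v w * \<kappa> b w v' else 0) else 0)"
    unfolding mmul_def sum_block[OF J] by (intro sum.cong) (use eq in \<open>auto simp: monomial_def monomial_inv_def\<close>)
  also have "\<dots> = mid (b, v) (b', v')"
    using J \<open>\<pi> b \<in> J\<close> 2[OF *(1,2,4)] by (auto simp: mid_def)
  finally show "mmul (J \<times> {..<4}) (monomial_inv \<pi> \<kappa>') (monomial \<pi> \<kappa>) (b, v) (b', v') = mid (b, v) (b', v')" .
qed

text \<open>All blocks being equal, the square has the permutation
  \<open>\<pi> \<circ> \<pi>\<close>, which is trivial, and the squared quaternion as block. A unit
  imaginary quaternion squares to -1, so the matrix is a complex structure.\<close>

lemma null_homotopic_monomial_imaginary: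
  assumes J: "finite J" and \<pi>: "\<pi> ` J \<subseteq> J" "\<And>b. b \<in> J \<Longrightarrow> \<pi> (\<pi> b) = b"
    and q: "b\<^sup>2 + c\<^sup>2 + d\<^sup>2 = 1"
  shows "null_homotopic (J \<times> {..<4}) (monomial \<pi> (\<lambda>_. quat 0 b c d))"
proof (rule null_homotopic_complex_structure)
  have "eq_on (J \<times> {..<4}) (monomial (\<pi> \<circ> \<pi>) (\<lambda>_ u v. \<Sum>w<4. quat 0 b c d u w * quat 0 b c d w v)) (\<lambda>i k. - mid i k)"
    unfolding eq_on_def
  proof (intro ballI, clarsimp)
    fix x u y v assume *: "x \<in> J" "u < (4::nat)" "y \<in> J" "v < (4::nat)"
    have "- (b * b) - c * c - d * d = -1" using q by (simp add: power2_eq_square)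
    then show "monomial (\<pi> \<circ> \<pi>) (\<lambda>_ u v. \<Sum>w<4. quat 0 b c d u w * quat 0 b c d w v) (x, u) (y, v) = - mid (x, u) (y, v)"
      using * \<pi>(2) by (auto simp: monomial_def quat_mult quat_one mid_def)
  qed
  then show "eq_on (J \<times> {..<4}) (mmul (J \<times> {..<4}) (monomial \<pi> (\<lambda>_. quat 0 b c d)) (monomial \<pi> (\<lambda>_. quat 0 b c d))) (\<lambda>i k. - mid i k)"
    using eq_on_trans[OF monomial_mult[OF J \<pi>(1), of \<pi> "\<lambda>_. quat 0 b c d" "\<lambda>_. quat 0 b c d"]] by blast
qed (use J in auto)

lemma null_homotopic_monomial_mult:
  assumes J: "finite J" and "\<pi>' ` J \<subseteq> J"
    and "null_homotopic (J \<times> {..<4}) (monomial \<pi> (\<lambda>_. q))" "null_homotopic (J \<times> {..<4}) (monomial \<pi>' (\<lambda>_. q'))"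
    and qq: "\<And>u v. u < 4 \<Longrightarrow> v < 4 \<Longrightarrow> (\<Sum>w<4. q u w * q' w v) = q'' u v"
  shows "null_homotopic (J \<times> {..<4}) (monomial (\<pi> \<circ> \<pi>') (\<lambda>_. q''))"
proof -
  have "null_homotopic (J \<times> {..<4}) (mmul (J \<times> {..<4}) (monomial \<pi> (\<lambda>_. q)) (monomial \<pi>' (\<lambda>_. q')))"
    using assms by (intro null_homotopic_mmul) auto
  moreover have "eq_on (J \<times> {..<4}) (monomial (\<pi> \<circ> \<pi>') (\<lambda>_ u v. \<Sum>w<4. q u w * q' w v)) (monomial (\<pi> \<circ> \<pi>') (\<lambda>_. q''))"
    using qq by (auto simp: eq_on_def monomial_def)
  ultimately show ?thesis
    using monomial_mult[OF J assms(2), of \<pi> "\<lambda>_. q" "\<lambda>_. q'"] null_homotopic_cong by blast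
qed

text \<open>A transposition with blocks 1 is the product of the same transposition with blocks
  \<open>i\<close> and a diagonal matrix with blocks \<open>-i\<close>. Both factors are complex
  structures, and transpositions generate.\<close>

lemma null_homotopic_permutation:
  assumes J: "finite J" and p: "p permutes J"
  shows "null_homotopic (J \<times> {..<4}) (monomial p (\<lambda>_. quat 1 0 0 0))"
  using p J
proof (induction rule: permutes_induct)
  case id
  have "eq_on (J \<times> {..<4}) mid (monomial id (\<lambda>_. quat 1 0 0 0))"
    by (auto simp: eq_on_def monomial_def mid_def quat_one)
  then show ?case
    by (rule null_homotopic_cong) (use J in \<open>simp add: null_homotopic_mid\<close>)
next
  case (swap a b p)
  note * = swap.hyps(1,2) swap.IH swap.hyps(4)
  have pJ: "p ` J \<subseteq> J" using permutes_image[OF *(4)] by simp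
  have "null_homotopic (J \<times> {..<4}) (monomial (Transposition.transpose a b) (\<lambda>_. quat 0 1 0 0))"
    using * by (intro null_homotopic_monomial_imaginary J) (auto simp: Transposition.transpose_def)
  moreover have "null_homotopic (J \<times> {..<4}) (monomial id (\<lambda>_. quat 0 (-1) 0 0))"
    by (intro null_homotopic_monomial_imaginary J) auto
  ultimately have "null_homotopic (J \<times> {..<4}) (monomial (Transposition.transpose a b \<circ> id) (\<lambda>_. quat 1 0 0 0))"
    by (intro null_homotopic_monomial_mult[OF J]) (auto simp: quat_mult)
  then show ?case
    using * pJ by (intro null_homotopic_monomial_mult[OF J]) (auto simp: quat_mult)
qed

lemma null_homotopic_bij:
  assumes J: "finite J" and \<pi>: "bij_betw \<pi> J J"
  shows "null_homotopic (J \<times> {..<4}) (monomial \<pi> (\<lambda>_. quat 0 0 1 0))"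
proof -
  \<comment> \<open>\<open>permutes\<close> demands the identity outside \<open>J\<close>, about
    which \<open>bij_betw\<close> says nothing.\<close>
  define p where "p x = (if x \<in> J then \<pi> x else x)" for x
  have "bij_betw p J J" using \<pi> by (simp add: p_def cong: bij_betw_cong)
  then have p: "p permutes J" by (rule bij_imp_permutes) (simp add: p_def)
  have "null_homotopic (J \<times> {..<4}) (monomial id (\<lambda>_. quat 0 0 1 0))"
    by (intro null_homotopic_monomial_imaginary J) auto
  then have "null_homotopic (J \<times> {..<4}) (monomial (p \<circ> id) (\<lambda>_. quat 0 0 1 0))"
    using null_homotopic_permutation[OF J p] by (intro null_homotopic_monomial_mult[OF J]) (auto simp: quat_mult)
  moreover have "eq_on (J \<times> {..<4}) (monomial (p \<circ> id) (\<lambda>_. quat 0 0 1 0)) (monomial \<pi> (\<lambda>_. quat 0 0 1 0))"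
    by (auto simp: eq_on_def monomial_def p_def)
  ultimately show ?thesis using null_homotopic_cong by blast
qed

section \<open>Null-homotopic faithful representations\<close>

text \<open>Only at \<open>t = 1\<close> is \<open>A\<close> a faithful representation; on the way
  there from the identity at \<open>t = 0\<close> its matrices are merely invertible, and
  \<open>A'\<close> records the inverses.\<close>

definition null_homotopic_rep :: "'a monoid \<Rightarrow> 'a topology \<Rightarrow> 'i set \<Rightarrow> (real \<Rightarrow> 'a \<Rightarrow> 'i \<Rightarrow> 'i \<Rightarrow> real) \<Rightarrow>
    (real \<Rightarrow> 'a \<Rightarrow> 'i \<Rightarrow> 'i \<Rightarrow> real) \<Rightarrow> bool" where
  "null_homotopic_rep K T I A A' \<longleftrightarrow> finite I \<and>
     (\<forall>i\<in>I. \<forall>j\<in>I. continuous_map (prod_topology (top_of_set {0..1}) T) euclideanreal (\<lambda>(t, g). A t g i j)) \<and>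
     (\<forall>i\<in>I. \<forall>j\<in>I. continuous_map (prod_topology (top_of_set {0..1}) T) euclideanreal (\<lambda>(t, g). A' t g i j)) \<and>
     (\<forall>t\<in>{0..1}. \<forall>g\<in>carrier K. inverse_on I (A t g) (A' t g)) \<and>
     (\<forall>g\<in>carrier K. eq_on I (A 0 g) mid) \<and>
     (\<forall>g\<in>carrier K. \<forall>h\<in>carrier K. eq_on I (A 1 (g \<otimes>\<^bsub>K\<^esub> h)) (mmul I (A 1 g) (A 1 h))) \<and>
     (\<forall>g\<in>carrier K. \<forall>h\<in>carrier K. eq_on I (A 1 g) (A 1 h) \<longrightarrow> g = h)"

lemma null_homotopic_rep_reindex:
  assumes rep: "null_homotopic_rep K T I A A'" and h: "bij_betw h I' I"
  shows "null_homotopic_rep K T I' (\<lambda>t g i j. A t g (h i) (h j)) (\<lambda>t g i j. A' t g (h i) (h j))"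
proof -
  have inj: "inj_on h I'" and im: "h ` I' = I" using h by (auto simp: bij_betw_def)
  have mem: "h i \<in> I" if "i \<in> I'" for i using im that by blast
  have mm: "mmul I' (\<lambda>i j. M (h i) (h j)) (\<lambda>i j. N (h i) (h j)) = (\<lambda>i j. mmul I M N (h i) (h j))"
    for M N :: "'b \<Rightarrow> 'b \<Rightarrow> real"
    unfolding mmul_def im[symmetric] sum.reindex[OF inj] by (simp add: o_def)
  have mi: "mid (h i) (h j) = (mid i j :: real)" if "i \<in> I'" "j \<in> I'" for i j
    using inj that by (auto simp: mid_def dest: inj_onD)
  have eq: "eq_on I' (\<lambda>i j. M (h i) (h j)) (\<lambda>i j. N (h i) (h j)) \<longleftrightarrow> eq_on I M N" for M N :: "'b \<Rightarrow> 'b \<Rightarrow> real"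
    unfolding eq_on_def im[symmetric] by auto
  have eqm: "eq_on I' (\<lambda>i j. M (h i) (h j)) mid \<longleftrightarrow> eq_on I M mid" for M :: "'b \<Rightarrow> 'b \<Rightarrow> real"
    using mi unfolding eq_on_def im[symmetric] by auto
  have "finite I'" using rep h bij_betw_finite by (auto simp: null_homotopic_rep_def)
  then show ?thesis
    using rep unfolding null_homotopic_rep_def inverse_on_def mm eq eqm
    by (simp add: mem)
qed

context compact_top_group begin

lemma mult_inv_cancel: "x \<in> carrier K \<Longrightarrow> y \<in> carrier K \<Longrightarrow> x \<otimes> (inv x \<otimes> y) = y"
  by (simp add: m_assoc[symmetric])

text \<open>Compactness gives a finite set that meets every left coset. One of minimal cardinality
  meets each of them only once, since of two representatives of the same coset one could be
  dropped.\<close>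

lemma ex_coset_representatives:
  assumes H: "subgroup H K" "openin T H"
  obtains S where "finite S" "S \<subseteq> carrier K" "\<And>k. k \<in> carrier K \<Longrightarrow> \<exists>!s. s \<in> S \<and> inv s \<otimes> k \<in> H"
proof -
  have Hc: "x \<in> carrier K" if "x \<in> H" for x using that subgroup.subset[OF H(1)] by blast
  let ?Q = "\<lambda>F. finite F \<and> F \<subseteq> carrier K \<and> (\<forall>k\<in>carrier K. \<exists>s\<in>F. inv s \<otimes> k \<in> H)"
  have "compactin T (carrier K)" using compact by (simp add: compact_space_def topspace_eq)
  moreover have "\<forall>W\<in>(\<lambda>a. (\<lambda>x. a \<otimes> x) ` H) ` carrier K. openin T W"
    using openin_translate H(2) by auto
  moreover have "carrier K \<subseteq> \<Union> ((\<lambda>a. (\<lambda>x. a \<otimes> x) ` H) ` carrier K)"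
  proof
    fix k assume k: "k \<in> carrier K"
    then have "k \<otimes> \<one> \<in> (\<lambda>x. k \<otimes> x) ` H" using subgroup.one_closed[OF H(1)] by blast
    then show "k \<in> \<Union> ((\<lambda>a. (\<lambda>x. a \<otimes> x) ` H) ` carrier K)" using k by auto
  qed
  ultimately obtain \<F> where \<F>: "finite \<F>" "\<F> \<subseteq> (\<lambda>a. (\<lambda>x. a \<otimes> x) ` H) ` carrier K" "carrier K \<subseteq> \<Union> \<F>"
    unfolding compactin_def by meson
  obtain F where F: "finite F" "F \<subseteq> carrier K" "\<F> = (\<lambda>a. (\<lambda>x. a \<otimes> x) ` H) ` F"
    using finite_subset_image[OF \<F>(1,2)] by blast
  have "\<exists>s\<in>F. inv s \<otimes> k \<in> H" if k: "k \<in> carrier K" for k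
  proof -
    obtain a x where a: "a \<in> F" "x \<in> H" "k = a \<otimes> x" using \<F>(3) F(3) k by blast
    then have "inv a \<otimes> k = x" using F(2) Hc by (auto simp: m_assoc[symmetric])
    then show ?thesis using a by (intro bexI[of _ a]) auto
  qed
  then have "?Q F" using F by blast
  then obtain S where S: "?Q S" "\<And>S'. ?Q S' \<Longrightarrow> card S \<le> card S'"
    using ex_has_least_nat[of ?Q F card] by blast
  have "s = s'" if s: "s \<in> S" "s' \<in> S" "inv s \<otimes> k \<in> H" "inv s' \<otimes> k \<in> H" "k \<in> carrier K" for s s' k
  proof (rule ccontr)
    assume ne: "s \<noteq> s'"
    have c: "s \<in> carrier K" "s' \<in> carrier K" using S s by auto
    have "\<exists>r\<in>S - {s'}. inv r \<otimes> x \<in> H" if x: "x \<in> carrier K" for x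
    proof -
      obtain r where r: "r \<in> S" "inv r \<otimes> x \<in> H" using S x by blast
      have "inv s \<otimes> x \<in> H" if "inv s' \<otimes> x \<in> H"
      proof -
        have "inv s \<otimes> k \<otimes> inv (inv s' \<otimes> k) \<otimes> (inv s' \<otimes> x) \<in> H"
          using H(1) s that by (simp add: subgroup.m_closed subgroup.m_inv_closed)
        also have "inv s \<otimes> k \<otimes> inv (inv s' \<otimes> k) \<otimes> (inv s' \<otimes> x) = inv s \<otimes> (k \<otimes> (inv k \<otimes> (s' \<otimes> (inv s' \<otimes> x))))"
          using c x s(5) by (simp add: m_assoc inv_mult_group)
        also have "\<dots> = inv s \<otimes> x"
          using c x s(5) by (simp add: m_assoc[symmetric])
        finally show ?thesis .
      qed
      then show ?thesis using r s(1) ne by (cases "r = s'") auto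
    qed
    then have "?Q (S - {s'})" using S(1) by blast
    then have "card S \<le> card (S - {s'})" by (rule S(2))
    then show False using S(1) s(2) by (metis card_Diff1_less not_less)
  qed
  then have "\<exists>!s. s \<in> S \<and> inv s \<otimes> k \<in> H" if "k \<in> carrier K" for k
    using S(1) that by blast
  then show thesis using that S(1) by blast
qed

end

lemma continuous_map_if_clopen:
  fixes f :: "'x \<Rightarrow> real"
  assumes U: "openin X U" "closedin X U" and f: "continuous_map (subtopology X U) euclideanreal f"
  shows "continuous_map X euclideanreal (\<lambda>x. if x \<in> U then f x else 0)"
  unfolding continuous_map
proof (intro conjI allI impI)
  fix W :: "real set" assume W: "openin euclideanreal W"
  have "openin (subtopology X U) {x \<in> topspace (subtopology X U). f x \<in> W}"
    by (rule openin_continuous_map_preimage[OF f W])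
  then have 1: "openin X {x \<in> topspace (subtopology X U). f x \<in> W}"
    using U(1) openin_trans_full by blast
  have 2: "openin X (topspace X - U)" using U(2) by (simp add: openin_diff)
  have "{x \<in> topspace X. (if x \<in> U then f x else 0) \<in> W} =
     {x \<in> topspace (subtopology X U). f x \<in> W} \<union> (if 0 \<in> W then topspace X - U else {})"
    by auto
  then show "openin X {x \<in> topspace X. (if x \<in> U then f x else 0) \<in> W}"
    using 1 2 by (auto intro: openin_Un)
qed auto

lemma continuous_map_quat:
  assumes "continuous_map X euclideanreal a" "continuous_map X euclideanreal b"
    "continuous_map X euclideanreal c" "continuous_map X euclideanreal d" "u < 4" "v < 4"
  shows "continuous_map X euclideanreal (\<lambda>x. quat (a x) (b x) (c x) (d x) u v)"
  using assms(5,6) unfolding less_4_cases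
  by (elim disjE) (use assms(1-4) in \<open>simp_all add: quat_def continuous_map_minus\<close>)

section \<open>The representation induced from characters of an open subgroup\<close>

locale induced_rep = compact_top_group +
  fixes H S :: "'a set" and C :: "'c set" and \<psi> :: "'c \<Rightarrow> 'a \<Rightarrow> complex"
  assumes H: "subgroup H K" "openin T H"
    and S: "finite S" "S \<subseteq> carrier K"
    and reps: "k \<in> carrier K \<Longrightarrow> \<exists>!s. s \<in> S \<and> inv s \<otimes> k \<in> H"
    and C: "finite C" "C \<noteq> {}"
    and \<psi>_mult: "c \<in> C \<Longrightarrow> x \<in> H \<Longrightarrow> y \<in> H \<Longrightarrow> \<psi> c (x \<otimes> y) = \<psi> c x * \<psi> c y"
    and \<psi>_norm: "c \<in> C \<Longrightarrow> x \<in> H \<Longrightarrow> norm (\<psi> c x) = 1"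
    and \<psi>_cont: "c \<in> C \<Longrightarrow> continuous_map (subtopology T H) euclidean (\<psi> c)"
    and \<psi>_separates: "x \<in> H \<Longrightarrow> (\<And>c. c \<in> C \<Longrightarrow> \<psi> c x = 1) \<Longrightarrow> x = \<one>"
begin

text \<open>Left translation by \<open>g\<close> on the cosets of \<open>H\<close>, read on
  representatives. The identity off \<open>S\<close> makes the function depend only on the
  permutation of the cosets, so that \<open>locally_constant_cont\<close> can compare such functions
  by equality.\<close>

definition \<sigma> :: "'a \<Rightarrow> 'a \<Rightarrow> 'a" where
  "\<sigma> g s = (if s \<in> S then THE s'. s' \<in> S \<and> inv s' \<otimes> (g \<otimes> s) \<in> H else s)"

definition \<pi> :: "'a \<Rightarrow> 'c \<times> 'a \<Rightarrow> 'c \<times> 'a" where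
  "\<pi> g = (\<lambda>(c, s). (c, \<sigma> g s))"

text \<open>The nonzero entries of the induced monomial matrix: \<open>g \<otimes> s\<close> is the
  representative \<open>\<sigma> g s\<close> times an element of \<open>H\<close>, and the character
  is evaluated at the latter.\<close>

definition \<zeta> :: "'a \<Rightarrow> 'c \<times> 'a \<Rightarrow> complex" where
  "\<zeta> g = (\<lambda>(c, s). \<psi> c (inv (\<sigma> g s) \<otimes> (g \<otimes> s)))"

text \<open>The quaternions \<open>t z + (1 - t) j\<close> with \<open>\<bar>z\<bar> = 1\<close> are invertible for all \<open>t\<close>.\<close>

definition \<kappa> :: "real \<Rightarrow> 'a \<Rightarrow> 'c \<times> 'a \<Rightarrow> nat \<Rightarrow> nat \<Rightarrow> real" where
  "\<kappa> t g b = quat (t * Re (\<zeta> g b)) (t * Im (\<zeta> g b)) (1 - t) 0"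

text \<open>The conjugate quaternion divided by the squared norm, which is
  \<open>t^2 + (1 - t)^2\<close> because \<open>\<zeta> g b\<close> has modulus 1.\<close>

definition \<kappa>' :: "real \<Rightarrow> 'a \<Rightarrow> 'c \<times> 'a \<Rightarrow> nat \<Rightarrow> nat \<Rightarrow> real" where
  "\<kappa>' t g b = (let r = 1 / (t\<^sup>2 + (1 - t)\<^sup>2) in
     quat (r * (t * Re (\<zeta> g b))) (r * - (t * Im (\<zeta> g b))) (r * - (1 - t)) (r * 0))"

abbreviation (input) J where "J \<equiv> C \<times> S"
abbreviation (input) I where "I \<equiv> (C \<times> S) \<times> {..<4::nat}"

lemma J_finite: "finite J" "finite I" using C S by auto

lemma S_carrier: "s \<in> S \<Longrightarrow> s \<in> carrier K" using S by blast
lemma H_carrier: "s \<in> H \<Longrightarrow> s \<in> carrier K" using subgroup.subset[OF H(1)] by blast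

lemma \<sigma>_mem:
  assumes "g \<in> carrier K" "s \<in> S"
  shows "\<sigma> g s \<in> S" "inv (\<sigma> g s) \<otimes> (g \<otimes> s) \<in> H"
proof -
  have ex1: "\<exists>!s'. s' \<in> S \<and> inv s' \<otimes> (g \<otimes> s) \<in> H"
    using assms S_carrier by (intro reps) auto
  from theI'[OF ex1] show "\<sigma> g s \<in> S" "inv (\<sigma> g s) \<otimes> (g \<otimes> s) \<in> H"
    using assms by (auto simp: \<sigma>_def)
qed

lemma \<sigma>_iff:
  assumes "g \<in> carrier K" "s \<in> S" "s' \<in> S"
  shows "\<sigma> g s = s' \<longleftrightarrow> inv s' \<otimes> (g \<otimes> s) \<in> H"
proof -
  have "\<exists>!s'. s' \<in> S \<and> inv s' \<otimes> (g \<otimes> s) \<in> H"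
    using assms S_carrier by (intro reps) auto
  with \<sigma>_mem[OF assms(1,2)] assms(3) show ?thesis by blast
qed

text \<open>The second equation is the cocycle identity of the factors in \<open>H\<close>; it
  places the left side in \<open>H\<close> and so implies the first by uniqueness of
  representatives.\<close>

lemma \<sigma>_mult:
  assumes g: "g \<in> carrier K" and h: "h \<in> carrier K" and s: "s \<in> S"
  shows "\<sigma> (g \<otimes> h) s = \<sigma> g (\<sigma> h s)"
    "inv (\<sigma> g (\<sigma> h s)) \<otimes> ((g \<otimes> h) \<otimes> s) = (inv (\<sigma> g (\<sigma> h s)) \<otimes> (g \<otimes> \<sigma> h s)) \<otimes> (inv (\<sigma> h s) \<otimes> (h \<otimes> s))"
proof -
  note m = \<sigma>_mem[OF h s] \<sigma>_mem[OF g \<sigma>_mem(1)[OF h s]]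
  have c: "\<sigma> h s \<in> carrier K" "\<sigma> g (\<sigma> h s) \<in> carrier K" "s \<in> carrier K"
    using m s S_carrier by auto
  have "(inv (\<sigma> g (\<sigma> h s)) \<otimes> (g \<otimes> \<sigma> h s)) \<otimes> (inv (\<sigma> h s) \<otimes> (h \<otimes> s))
     = inv (\<sigma> g (\<sigma> h s)) \<otimes> (g \<otimes> ((\<sigma> h s \<otimes> inv (\<sigma> h s)) \<otimes> (h \<otimes> s)))"
    using c g h by (simp add: m_assoc mult_inv_cancel del: r_inv)
  also have "\<dots> = inv (\<sigma> g (\<sigma> h s)) \<otimes> ((g \<otimes> h) \<otimes> s)"
    using c g h by (simp add: m_assoc)
  finally show eq: "inv (\<sigma> g (\<sigma> h s)) \<otimes> ((g \<otimes> h) \<otimes> s) = (inv (\<sigma> g (\<sigma> h s)) \<otimes> (g \<otimes> \<sigma> h s)) \<otimes> (inv (\<sigma> h s) \<otimes> (h \<otimes> s))"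
    by simp
  have "inv (\<sigma> g (\<sigma> h s)) \<otimes> ((g \<otimes> h) \<otimes> s) \<in> H"
    unfolding eq using m H(1) by (simp add: subgroup.m_closed)
  then show "\<sigma> (g \<otimes> h) s = \<sigma> g (\<sigma> h s)"
    using \<sigma>_iff g h s m by simp
qed

lemma \<pi>_bij: "g \<in> carrier K \<Longrightarrow> bij_betw (\<pi> g) J J"
proof -
  assume g: "g \<in> carrier K"
  have "inj_on (\<sigma> g) S"
  proof (rule inj_onI)
    fix s r assume sr: "s \<in> S" "r \<in> S" "\<sigma> g s = \<sigma> g r"
    have c: "s \<in> carrier K" "r \<in> carrier K" "\<sigma> g r \<in> carrier K"
      using sr S_carrier \<sigma>_mem(1)[OF g] by auto
    have "inv (inv (\<sigma> g r) \<otimes> (g \<otimes> s)) \<otimes> (inv (\<sigma> g r) \<otimes> (g \<otimes> r)) \<in> H"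
      using \<sigma>_mem(2)[OF g sr(1)] \<sigma>_mem(2)[OF g sr(2)] sr(3) H(1)
      by (simp add: subgroup.m_closed subgroup.m_inv_closed)
    also have "inv (inv (\<sigma> g r) \<otimes> (g \<otimes> s)) \<otimes> (inv (\<sigma> g r) \<otimes> (g \<otimes> r))
      = inv s \<otimes> (inv g \<otimes> ((\<sigma> g r \<otimes> inv (\<sigma> g r)) \<otimes> (g \<otimes> r)))"
      using c g by (simp add: m_assoc inv_mult_group mult_inv_cancel del: r_inv)
    also have "\<dots> = inv s \<otimes> ((inv g \<otimes> g) \<otimes> r)" using c g by (simp add: m_assoc[symmetric])
    also have "\<dots> = inv s \<otimes> r" using c g by simp
    finally have "inv s \<otimes> r \<in> H" .
    moreover have "inv r \<otimes> r \<in> H" using c subgroup.one_closed[OF H(1)] by simp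
    ultimately show "s = r" using reps[OF c(2)] sr by blast
  qed
  moreover have "\<sigma> g ` S \<subseteq> S" using \<sigma>_mem(1)[OF g] by blast
  ultimately have "bij_betw (\<sigma> g) S S" using endo_inj_surj[OF S(1)] by (simp add: bij_betw_def)
  then have "bij_betw (map_prod id (\<sigma> g)) J J" by (intro bij_betw_map_prod) auto
  moreover have "map_prod id (\<sigma> g) = \<pi> g" by (auto simp: \<pi>_def map_prod_def)
  ultimately show ?thesis by simp
qed

lemma \<zeta>_norm:
  assumes "g \<in> carrier K" "b \<in> J"
  shows "(Re (\<zeta> g b))\<^sup>2 + (Im (\<zeta> g b))\<^sup>2 = 1"
proof -
  obtain c s where b: "b = (c, s)" "c \<in> C" "s \<in> S" using assms by auto
  then have "norm (\<zeta> g b) = 1" using \<psi>_norm \<sigma>_mem(2)[OF assms(1)] by (simp add: \<zeta>_def)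
  then show ?thesis by (metis cmod_power2 one_power2)
qed

definition W :: "real \<Rightarrow> 'a \<Rightarrow> ('c \<times> 'a) \<times> nat \<Rightarrow> ('c \<times> 'a) \<times> nat \<Rightarrow> real" where
  "W t g = monomial (\<pi> g) (\<kappa> t g)"

definition W' :: "real \<Rightarrow> 'a \<Rightarrow> ('c \<times> 'a) \<times> nat \<Rightarrow> ('c \<times> 'a) \<times> nat \<Rightarrow> real" where
  "W' t g = monomial_inv (\<pi> g) (\<kappa>' t g)"

lemma denominator_pos: "t\<^sup>2 + (1 - t)\<^sup>2 > (0::real)"
  by (smt (verit) power2_less_0 zero_eq_power2)

lemma W_inverse:
  assumes g: "g \<in> carrier K"
  shows "inverse_on I (W t g) (W' t g)"
  unfolding W_def W'_def
proof (rule monomial_inverse[OF J_finite(1) \<pi>_bij[OF g]])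
  fix b u v assume b: "b \<in> J" and uv: "u < (4::nat)" "v < (4::nat)"
  define x y z r where "x = t * Re (\<zeta> g b)" and "y = t * Im (\<zeta> g b)" and "z = 1 - t" and "r = 1 / (t\<^sup>2 + (1 - t)\<^sup>2)"
  have "x\<^sup>2 + y\<^sup>2 = t\<^sup>2 * ((Re (\<zeta> g b))\<^sup>2 + (Im (\<zeta> g b))\<^sup>2)"
    by (simp add: x_def y_def power_mult_distrib distrib_left)
  then have n: "x\<^sup>2 + y\<^sup>2 + z\<^sup>2 = t\<^sup>2 + (1 - t)\<^sup>2" using \<zeta>_norm[OF g b] by (simp add: z_def)
  have r: "r * x * x + r * y * y + r * z * z = 1"
  proof -
    have "r * x * x + r * y * y + r * z * z = r * (x\<^sup>2 + y\<^sup>2 + z\<^sup>2)" by (simp add: power2_eq_square algebra_simps)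
    also have "\<dots> = 1" unfolding n using denominator_pos[of t] by (simp add: r_def)
    finally show ?thesis .
  qed
  have \<kappa>: "\<kappa> t g b = quat x y z 0" "\<kappa>' t g b = quat (r * x) (r * - y) (r * - z) (r * 0)"
    by (simp_all add: \<kappa>_def \<kappa>'_def x_def y_def z_def r_def Let_def)
  have 1: "x * (r * x) - y * (r * - y) - z * (r * - z) - 0 * (r * 0) = 1"
    "r * x * x - r * - y * y - r * - z * z - r * 0 * 0 = 1"
    using r by (simp_all add: algebra_simps)
  show "(\<Sum>w<4. \<kappa> t g b u w * \<kappa>' t g b w v) = (if u = v then 1 else 0)"
    unfolding \<kappa> quat_mult[OF uv] 1(1) using uv by (simp add: quat_one)
  show "(\<Sum>w<4. \<kappa>' t g b u w * \<kappa> t g b w v) = (if u = v then 1 else 0)"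
    unfolding \<kappa> quat_mult[OF uv] 1(2) using uv by (simp add: quat_one)
qed

lemma W_zero: "eq_on I (W 0 g) (monomial (\<pi> g) (\<lambda>_. quat 0 0 1 0))"
  by (auto simp: eq_on_def W_def monomial_def \<kappa>_def)

text \<open>At \<open>t = 1\<close> the blocks lie in the copy of the complex numbers, where the
  product of quaternions is the complex one; the cocycle identity of \<open>\<sigma>_mult\<close>
  then multiplies the entries.\<close>

lemma W_mult:
  assumes g: "g \<in> carrier K" and h: "h \<in> carrier K"
  shows "eq_on I (mmul I (W 1 g) (W 1 h)) (W 1 (g \<otimes> h))"
proof -
  have "\<pi> h ` J \<subseteq> J" using \<pi>_bij[OF h] by (simp add: bij_betw_def)
  from monomial_mult[OF J_finite(1) this, of "\<pi> g" "\<kappa> 1 g" "\<kappa> 1 h"]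
  have "eq_on I (mmul I (W 1 g) (W 1 h)) (monomial (\<pi> g \<circ> \<pi> h) (\<lambda>b u v. \<Sum>w<4. \<kappa> 1 g (\<pi> h b) u w * \<kappa> 1 h b w v))"
    by (simp add: W_def)
  moreover have "eq_on I (monomial (\<pi> g \<circ> \<pi> h) (\<lambda>b u v. \<Sum>w<4. \<kappa> 1 g (\<pi> h b) u w * \<kappa> 1 h b w v)) (W 1 (g \<otimes> h))"
    unfolding eq_on_def
  proof (intro ballI, clarify)
    fix a r u c s v assume *: "a \<in> C" "r \<in> S" "u < (4::nat)" "c \<in> C" "s \<in> S" "v < (4::nat)"
    have \<pi>: "\<pi> (g \<otimes> h) (c, s) = \<pi> g (\<pi> h (c, s))"
      using \<sigma>_mult[OF g h] * by (simp add: \<pi>_def)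
    have "\<zeta> (g \<otimes> h) (c, s) = \<zeta> g (\<pi> h (c, s)) * \<zeta> h (c, s)"
      unfolding \<zeta>_def \<pi>_def using \<sigma>_mult[OF g h *(5)] \<sigma>_mem[OF h *(5)] \<sigma>_mem[OF g] * \<psi>_mult
      by simp
    then show "monomial (\<pi> g \<circ> \<pi> h) (\<lambda>b u v. \<Sum>w<4. \<kappa> 1 g (\<pi> h b) u w * \<kappa> 1 h b w v) ((a, r), u) ((c, s), v)
       = W 1 (g \<otimes> h) ((a, r), u) ((c, s), v)"
      using * \<pi> by (simp add: W_def monomial_def \<kappa>_def quat_mult)
  qed
  ultimately show ?thesis using eq_on_trans by blast
qed

text \<open>The block columns of one representative \<open>s\<close> are enough. The position of the
  nonzero blocks gives \<open>\<sigma> g s\<close>, their values give all characters of the factor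
  in \<open>H\<close>, and the characters separate.\<close>

lemma W_inj:
  assumes g: "g \<in> carrier K" and h: "h \<in> carrier K" and eq: "eq_on I (W 1 g) (W 1 h)"
  shows "g = h"
proof -
  obtain s where s: "s \<in> S" using reps[OF one_closed] by blast
  obtain c0 where c0: "c0 \<in> C" using C(2) by blast
  have sc: "s \<in> carrier K" "\<sigma> g s \<in> S" "\<sigma> g s \<in> carrier K" using s S_carrier \<sigma>_mem(1)[OF g s] by auto
  have entry: "W 1 g ((c, \<sigma> g s), u) ((c, s), 0) = W 1 h ((c, \<sigma> g s), u) ((c, s), 0)" if "c \<in> C" "u < 4" for c u
    using eq that s sc by (simp add: eq_on_def)
  have e: "\<sigma> h s = \<sigma> g s \<and> \<zeta> g (c, s) = \<zeta> h (c, s)" if c: "c \<in> C" for c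
  proof -
    have 0: "Re (\<zeta> g (c, s)) = (if \<sigma> g s = \<sigma> h s then Re (\<zeta> h (c, s)) else 0)"
      using entry[OF c, of 0] by (simp add: W_def monomial_def \<pi>_def \<kappa>_def quat_def split: if_splits)
    have 1: "Im (\<zeta> g (c, s)) = (if \<sigma> g s = \<sigma> h s then Im (\<zeta> h (c, s)) else 0)"
      using entry[OF c, of 1] by (simp add: W_def monomial_def \<pi>_def \<kappa>_def quat_def split: if_splits)
    have "(Re (\<zeta> g (c, s)))\<^sup>2 + (Im (\<zeta> g (c, s)))\<^sup>2 = 1" using \<zeta>_norm[OF g] c s by simp
    then have "\<sigma> g s = \<sigma> h s" using 0 1 by (auto split: if_splits)
    then show ?thesis using 0 1 by (simp add: complex_eq_iff)
  qed
  define x y where "x = inv (\<sigma> g s) \<otimes> (g \<otimes> s)" and "y = inv (\<sigma> g s) \<otimes> (h \<otimes> s)"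
  have xy: "x \<in> H" "y \<in> H" using \<sigma>_mem(2)[OF g s] \<sigma>_mem(2)[OF h s] e[OF c0] by (auto simp: x_def y_def)
  have xyc: "x \<in> carrier K" "y \<in> carrier K" using xy H_carrier by auto
  have ix: "inv x \<in> H" using xy H(1) by (simp add: subgroup.m_inv_closed)
  have "\<psi> c (inv x \<otimes> y) = 1" if c: "c \<in> C" for c
  proof -
    have "\<psi> c x = \<psi> c y" using e[OF c] by (simp add: \<zeta>_def x_def y_def)
    moreover have "\<psi> c (inv x \<otimes> x) = \<psi> c (inv x) * \<psi> c x" by (rule \<psi>_mult[OF c ix xy(1)])
    moreover have "\<psi> c (inv x \<otimes> y) = \<psi> c (inv x) * \<psi> c y" by (rule \<psi>_mult[OF c ix xy(2)])
    moreover have "\<psi> c \<one> = 1"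
    proof -
      have "\<psi> c \<one> * \<psi> c \<one> = \<psi> c \<one>"
        using \<psi>_mult[OF c, of \<one> \<one>] subgroup.one_closed[OF H(1)] by simp
      moreover have "\<psi> c \<one> \<noteq> 0" using \<psi>_norm[OF c, of \<one>] subgroup.one_closed[OF H(1)] by auto
      ultimately show ?thesis by simp
    qed
    ultimately show ?thesis using xyc by simp
  qed
  then have "inv x \<otimes> y = \<one>" using ix xy H(1) by (intro \<psi>_separates) (auto simp: subgroup.m_closed)
  then have "x = y" using xyc by (metis inv_closed inv_equality inv_inv)
  then have "g \<otimes> s = h \<otimes> s" using sc g h by (simp add: x_def y_def)
  then show ?thesis using sc g h by simp
qed

abbreviation (input) X where "X \<equiv> prod_topology (top_of_set {0..1::real}) T"

lemma continuous_map_snd_X: "continuous_map X T snd" and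
  continuous_map_fst_X: "continuous_map X euclideanreal fst"
  using continuous_map_snd continuous_map_fst[of "top_of_set {0..1::real}" T]
  by (auto simp: continuous_map_in_subtopology)

text \<open>For \<open>s\<close> and \<open>s'\<close> in \<open>S\<close> these are the pairs
  \<open>(t, g)\<close> with \<open>\<sigma> g s = s'\<close>, by \<open>\<sigma>_iff\<close>. The
  set is clopen, so the positions of the nonzero blocks are locally constant.\<close>

definition coset_nhd :: "'a \<Rightarrow> 'a \<Rightarrow> (real \<times> 'a) set" where
  "coset_nhd s' s = {p \<in> topspace X. inv s' \<otimes> (snd p \<otimes> s) \<in> H}"

lemma translate_cont: "s \<in> S \<Longrightarrow> s' \<in> S \<Longrightarrow> continuous_map X T (\<lambda>p. inv s' \<otimes> (snd p \<otimes> s))"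
  using S_carrier by (intro continuous_map_mult continuous_map_snd_X) (auto simp: topspace_eq)

lemma coset_nhd_clopen:
  assumes "s \<in> S" "s' \<in> S"
  shows "openin X (coset_nhd s' s)" "closedin X (coset_nhd s' s)"
  unfolding coset_nhd_def
  using openin_continuous_map_preimage[OF translate_cont[OF assms] H(2)]
    closedin_continuous_map_preimage[OF translate_cont[OF assms] open_subgroup_closed[OF H]]
  by auto

lemma \<psi>_translate_cont:
  assumes "s \<in> S" "s' \<in> S" "c \<in> C"
  shows "continuous_map (subtopology X (coset_nhd s' s)) euclidean (\<lambda>p. \<psi> c (inv s' \<otimes> (snd p \<otimes> s)))"
proof -
  have "continuous_map (subtopology X (coset_nhd s' s)) (subtopology T H) (\<lambda>p. inv s' \<otimes> (snd p \<otimes> s))"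
    unfolding continuous_map_in_subtopology
    using continuous_map_from_subtopology[OF translate_cont[OF assms(1,2)]] by (auto simp: coset_nhd_def)
  from continuous_map_compose[OF this \<psi>_cont[OF assms(3)]] show ?thesis by (simp add: o_def)
qed

lemma Re_Im_cont:
  assumes "s \<in> S" "s' \<in> S" "c \<in> C"
  shows "continuous_map (subtopology X (coset_nhd s' s)) euclideanreal (\<lambda>p. Re (\<psi> c (inv s' \<otimes> (snd p \<otimes> s))))"
    "continuous_map (subtopology X (coset_nhd s' s)) euclideanreal (\<lambda>p. Im (\<psi> c (inv s' \<otimes> (snd p \<otimes> s))))"
    "continuous_map (subtopology X (coset_nhd s' s)) euclideanreal fst"
proof -
  have "continuous_map euclidean euclideanreal Re" "continuous_map euclidean euclideanreal Im"
    by (auto intro!: continuous_intros)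
  from continuous_map_compose[OF \<psi>_translate_cont[OF assms] this(1)]
    continuous_map_compose[OF \<psi>_translate_cont[OF assms] this(2)]
  show "continuous_map (subtopology X (coset_nhd s' s)) euclideanreal (\<lambda>p. Re (\<psi> c (inv s' \<otimes> (snd p \<otimes> s))))"
    "continuous_map (subtopology X (coset_nhd s' s)) euclideanreal (\<lambda>p. Im (\<psi> c (inv s' \<otimes> (snd p \<otimes> s))))"
    by (simp_all add: o_def)
  show "continuous_map (subtopology X (coset_nhd s' s)) euclideanreal fst"
    by (rule continuous_map_from_subtopology[OF continuous_map_fst_X])
qed

text \<open>An entry is given by one continuous formula on the clopen set where its position is
  occupied, and is 0 elsewhere.\<close>

lemma W_cont:
  assumes "i \<in> I" "j \<in> I"
  shows "continuous_map X euclideanreal (\<lambda>(t, g). W t g i j)"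
proof -
  obtain a s' u c s v where ij: "i = ((a, s'), u)" "j = ((c, s), v)" "a \<in> C" "s' \<in> S" "u < 4" "c \<in> C" "s \<in> S" "v < 4"
    using assms by auto
  let ?z = "\<lambda>p. \<psi> c (inv s' \<otimes> (snd p \<otimes> s))"
  have q: "continuous_map (subtopology X (coset_nhd s' s)) euclideanreal
     (\<lambda>p. quat (fst p * Re (?z p)) (fst p * Im (?z p)) (1 - fst p) 0 u v)"
    using ij Re_Im_cont[OF ij(7,4,6)]
    by (intro continuous_map_quat continuous_map_real_mult continuous_map_diff) auto
  have "continuous_map X euclideanreal (\<lambda>p. if a = c then
      (if p \<in> coset_nhd s' s then quat (fst p * Re (?z p)) (fst p * Im (?z p)) (1 - fst p) 0 u v else 0) else 0)"
    using continuous_map_if_clopen[OF coset_nhd_clopen[OF ij(7,4)] q] by (cases "a = c") auto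
  then show ?thesis
  proof (rule continuous_map_eq)
    fix p assume p: "p \<in> topspace X"
    obtain t g where tg: "p = (t, g)" "g \<in> carrier K" using p by (auto simp: topspace_eq)
    show "(if a = c then
      (if p \<in> coset_nhd s' s then quat (fst p * Re (?z p)) (fst p * Im (?z p)) (1 - fst p) 0 u v else 0) else 0)
      = (case p of (t, g) \<Rightarrow> W t g i j)"
      using \<sigma>_iff[OF tg(2) ij(7,4)] p tg
      by (auto simp: ij W_def monomial_def \<pi>_def \<kappa>_def \<zeta>_def coset_nhd_def)
  qed
qed

lemma W'_cont:
  assumes "i \<in> I" "j \<in> I"
  shows "continuous_map X euclideanreal (\<lambda>(t, g). W' t g i j)"
proof -
  obtain a s' u c s v where ij: "j = ((a, s'), u)" "i = ((c, s), v)" "a \<in> C" "s' \<in> S" "u < 4" "c \<in> C" "s \<in> S" "v < 4"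
    using assms by auto
  let ?z = "\<lambda>p. \<psi> c (inv s' \<otimes> (snd p \<otimes> s))"
  let ?r = "\<lambda>p :: real \<times> 'a. 1 / ((fst p)\<^sup>2 + (1 - fst p)\<^sup>2)"
  let ?q = "\<lambda>p. quat (?r p * (fst p * Re (?z p))) (?r p * - (fst p * Im (?z p))) (?r p * - (1 - fst p)) (?r p * 0) v u"
  have nz: "(fst p)\<^sup>2 + (1 - fst p)\<^sup>2 \<noteq> 0" for p :: "real \<times> 'a"
    using denominator_pos[of "fst p"] by simp
  have "continuous_map (subtopology X (coset_nhd s' s)) euclideanreal ?r"
    using Re_Im_cont[OF ij(7,4,6)] nz
    by (intro continuous_map_real_divide continuous_map_add continuous_map_diff continuous_map_real_pow) auto
  then have q: "continuous_map (subtopology X (coset_nhd s' s)) euclideanreal ?q"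
    using ij Re_Im_cont[OF ij(7,4,6)]
    by (intro continuous_map_quat continuous_map_real_mult continuous_map_minus continuous_map_diff) auto
  have "continuous_map X euclideanreal (\<lambda>p. if a = c then (if p \<in> coset_nhd s' s then ?q p else 0) else 0)"
    using continuous_map_if_clopen[OF coset_nhd_clopen[OF ij(7,4)] q] by (cases "a = c") auto
  then show ?thesis
  proof (rule continuous_map_eq)
    fix p assume p: "p \<in> topspace X"
    obtain t g where tg: "p = (t, g)" "g \<in> carrier K" using p by (auto simp: topspace_eq)
    show "(if a = c then (if p \<in> coset_nhd s' s then ?q p else 0) else 0) = (case p of (t, g) \<Rightarrow> W' t g i j)"
      using \<sigma>_iff[OF tg(2) ij(7,4)] p tg
      by (auto simp: ij W'_def monomial_inv_def \<pi>_def \<kappa>'_def \<zeta>_def coset_nhd_def Let_def)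
  qed
qed

text \<open>Meant for the paths of \<open>null_homotopic_bij\<close>, which are chosen for each
  permutation separately and without any relation between the choices. They still depend
  continuously on \<open>g\<close>, because \<open>\<pi> g\<close> is locally constant.\<close>

lemma locally_constant_cont:
  fixes f :: "('c \<times> 'a \<Rightarrow> 'c \<times> 'a) \<Rightarrow> real \<Rightarrow> real"
  assumes f: "\<And>g. g \<in> carrier K \<Longrightarrow> continuous_on {0..1} (f (\<pi> g))"
  shows "continuous_map X euclideanreal (\<lambda>(t, g). f (\<pi> g) t)"
proof (rule pasting_lemma[where I = "carrier K" and T = "\<lambda>g. \<Inter>s\<in>S. coset_nhd (\<sigma> g s) s" and f = "\<lambda>g p. f (\<pi> g) (fst p)"])
  have key: "\<pi> h = \<pi> g" if "g \<in> carrier K" "p \<in> (\<Inter>s\<in>S. coset_nhd (\<sigma> g s) s)" "snd p = h" "h \<in> carrier K" for g h p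
  proof -
    have "\<sigma> h s = \<sigma> g s" for s
    proof (cases "s \<in> S")
      case True
      then show ?thesis using that \<sigma>_iff[OF that(4) True \<sigma>_mem(1)[OF that(1) True]] by (auto simp: coset_nhd_def)
    qed (simp add: \<sigma>_def)
    then show ?thesis by (auto simp: \<pi>_def)
  qed
  have ne: "S \<noteq> {}" using reps[OF one_closed] by blast
  show "openin X (\<Inter>s\<in>S. coset_nhd (\<sigma> g s) s)" if "g \<in> carrier K" for g
    using that S(1) ne coset_nhd_clopen(1) \<sigma>_mem(1) by (intro openin_INT2) auto
  show "continuous_map (subtopology X (\<Inter>s\<in>S. coset_nhd (\<sigma> g s) s)) euclideanreal (\<lambda>p. f (\<pi> g) (fst p))"
    if g: "g \<in> carrier K" for g
  proof (rule continuous_map_from_subtopology)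
    have "continuous_map (top_of_set {0..1}) euclideanreal (f (\<pi> g))" using f[OF g] by simp
    from continuous_map_compose[OF continuous_map_fst this] show "continuous_map X euclideanreal (\<lambda>p. f (\<pi> g) (fst p))"
      by (simp add: o_def)
  qed
  show "f (\<pi> g) (fst p) = f (\<pi> h) (fst p)"
    if "g \<in> carrier K" "h \<in> carrier K" "p \<in> topspace X \<inter> (\<Inter>s\<in>S. coset_nhd (\<sigma> g s) s) \<inter> (\<Inter>s\<in>S. coset_nhd (\<sigma> h s) s)" for g h p
  proof -
    have "snd p \<in> carrier K" using that(3) by (auto simp: topspace_eq)
    then have "\<pi> (snd p) = \<pi> g" "\<pi> (snd p) = \<pi> h" using key that by auto
    then show ?thesis by simp
  qed
  show "\<exists>g. g \<in> carrier K \<and> p \<in> (\<Inter>s\<in>S. coset_nhd (\<sigma> g s) s) \<and> (case p of (t, g) \<Rightarrow> f (\<pi> g) t) = f (\<pi> g) (fst p)"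
    if "p \<in> topspace X" for p
    using that \<sigma>_mem by (intro exI[of _ "snd p"]) (auto simp: topspace_eq coset_nhd_def)
qed

text \<open>\<open>W\<close> deforms the induced representation to constant blocks \<open>j\<close>,
  and \<open>\<gamma>\<close> joins the resulting matrix to the identity. Multiplying
  \<open>W t g\<close> by the inverse of \<open>\<gamma>\<close> at \<open>1 - t\<close> merges
  both: at \<open>t = 0\<close> the factors cancel, at \<open>t = 1\<close> the second factor is
  trivial.\<close>

lemma ex_null_homotopic_rep: "\<exists>A A'. null_homotopic_rep K T I A A'"
proof -
  \<comment> \<open>The paths are chosen as functions of the permutation, not of \<open>g\<close>,
    so that \<open>locally_constant_cont\<close> applies to them.\<close>
  have "\<forall>p. \<exists>\<gamma> \<gamma>'. bij_betw p J J \<longrightarrow> path_to_id I \<gamma> \<gamma>' (monomial p (\<lambda>_. quat 0 0 1 0))"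
    using null_homotopic_bij[OF J_finite(1)] by (auto simp: null_homotopic_def)
  then obtain \<gamma> \<gamma>' where "\<And>p. bij_betw p J J \<Longrightarrow> path_to_id I (\<gamma> p) (\<gamma>' p) (monomial p (\<lambda>_. quat 0 0 1 0))"
    by metis
  then have \<gamma>: "path_to_id I (\<gamma> (\<pi> g)) (\<gamma>' (\<pi> g)) (monomial (\<pi> g) (\<lambda>_. quat 0 0 1 0))" if "g \<in> carrier K" for g
    using \<pi>_bij that by blast
  define A where "A t g = mmul I (W t g) (\<gamma>' (\<pi> g) (1 - t))" for t g
  define A' where "A' t g = mmul I (\<gamma> (\<pi> g) (1 - t)) (W' t g)" for t g
  have shift: "continuous_on {0..1} (\<lambda>t. f (1 - t))" if "continuous_on {0..1} f" for f :: "real \<Rightarrow> real"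
    by (rule continuous_on_compose2[OF that]) (auto intro!: continuous_intros)
  have c1: "continuous_map X euclideanreal (\<lambda>(t, g). \<gamma> (\<pi> g) (1 - t) i j)" if "i \<in> I" "j \<in> I" for i j
    by (rule locally_constant_cont[of "\<lambda>p t. \<gamma> p (1 - t) i j"], rule shift)
       (use \<gamma> that in \<open>auto simp: path_to_id_def\<close>)
  have c2: "continuous_map X euclideanreal (\<lambda>(t, g). \<gamma>' (\<pi> g) (1 - t) i j)" if "i \<in> I" "j \<in> I" for i j
    by (rule locally_constant_cont[of "\<lambda>p t. \<gamma>' p (1 - t) i j"], rule shift)
       (use \<gamma> that in \<open>auto simp: path_to_id_def\<close>)
  have A1: "eq_on I (A 1 g) (W 1 g)" if g: "g \<in> carrier K" for g
  proof -
    \<comment> \<open>\<open>path_to_id\<close> fixes the starting point of \<open>\<gamma>\<close>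
      only; that of \<open>\<gamma>'\<close> follows from invertibility.\<close>
    have "eq_on I (\<gamma> (\<pi> g) 0) mid" "eq_on I (mmul I (\<gamma> (\<pi> g) 0) (\<gamma>' (\<pi> g) 0)) mid"
      using \<gamma>[OF g] by (auto simp: path_to_id_def inverse_on_def)
    moreover have "eq_on I (mmul I (\<gamma> (\<pi> g) 0) (\<gamma>' (\<pi> g) 0)) (mmul I mid (\<gamma>' (\<pi> g) 0))"
      using calculation(1) by (intro mmul_cong) auto
    moreover have "eq_on I (mmul I mid (\<gamma>' (\<pi> g) 0)) (\<gamma>' (\<pi> g) 0)" by (rule mmul_mid_left[OF J_finite(2)])
    ultimately have "eq_on I (\<gamma>' (\<pi> g) 0) mid" by (simp add: eq_on_def)
    then have "eq_on I (A 1 g) (mmul I (W 1 g) mid)" unfolding A_def by (intro mmul_cong) auto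
    then show ?thesis using mmul_mid_right[OF J_finite(2)] eq_on_trans by blast
  qed
  have "null_homotopic_rep K T I A A'"
    unfolding null_homotopic_rep_def
  proof (intro conjI ballI impI)
    fix i j assume ij: "i \<in> I" "j \<in> I"
    have "continuous_map X euclideanreal (\<lambda>p. \<Sum>k\<in>I. (case p of (t, g) \<Rightarrow> W t g i k) * (case p of (t, g) \<Rightarrow> \<gamma>' (\<pi> g) (1 - t) k j))"
      using ij by (intro continuous_map_sum continuous_map_real_mult W_cont c2 J_finite) auto
    then show "continuous_map X euclideanreal (\<lambda>(t, g). A t g i j)"
      by (simp add: A_def mmul_def case_prod_unfold)
    have "continuous_map X euclideanreal (\<lambda>p. \<Sum>k\<in>I. (case p of (t, g) \<Rightarrow> \<gamma> (\<pi> g) (1 - t) i k) * (case p of (t, g) \<Rightarrow> W' t g k j))"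
      using ij by (intro continuous_map_sum continuous_map_real_mult W'_cont c1 J_finite) auto
    then show "continuous_map X euclideanreal (\<lambda>(t, g). A' t g i j)"
      by (simp add: A'_def mmul_def case_prod_unfold)
  next
    fix t :: real and g assume "t \<in> {0..1}" "g \<in> carrier K"
    then show "inverse_on I (A t g) (A' t g)"
      unfolding A_def A'_def using \<gamma>[of g] W_inverse[of g t] J_finite
      by (intro inverse_on_mmul) (auto simp: path_to_id_def intro!: inverse_on_sym[of I "\<gamma> (\<pi> g) (1 - t)"])
  next
    fix g assume g: "g \<in> carrier K"
    have "eq_on I (\<gamma> (\<pi> g) 1) (monomial (\<pi> g) (\<lambda>_. quat 0 0 1 0))" "eq_on I (mmul I (\<gamma> (\<pi> g) 1) (\<gamma>' (\<pi> g) 1)) mid"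
      using \<gamma>[OF g] by (auto simp: path_to_id_def inverse_on_def)
    moreover have "eq_on I (A 0 g) (mmul I (\<gamma> (\<pi> g) 1) (\<gamma>' (\<pi> g) 1))"
      unfolding A_def using W_zero[of g] eq_on_sym[OF calculation(1)] eq_on_trans by (intro mmul_cong) auto
    ultimately show "eq_on I (A 0 g) mid" using eq_on_trans by blast
  next
    fix g h assume g: "g \<in> carrier K" and h: "h \<in> carrier K"
    have "eq_on I (mmul I (A 1 g) (A 1 h)) (mmul I (W 1 g) (W 1 h))"
      by (intro mmul_cong A1 g h)
    then have "eq_on I (mmul I (A 1 g) (A 1 h)) (W 1 (g \<otimes> h))" using W_mult[OF g h] eq_on_trans by blast
    then show "eq_on I (A 1 (g \<otimes> h)) (mmul I (A 1 g) (A 1 h))"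
      using A1[OF m_closed[OF g h]] eq_on_trans eq_on_sym by blast
    assume "eq_on I (A 1 g) (A 1 h)"
    then have "eq_on I (W 1 g) (W 1 h)" using A1[OF g] A1[OF h] by (simp add: eq_on_def)
    then show "g = h" by (rule W_inj[OF g h])
  qed (rule J_finite)
  then show ?thesis by blast
qed

end

lemma compact_lie_group_null_homotopic_rep:
  assumes "compact_lie_group K T" "essentially_abelian K T"
  obtains N :: nat and A A' where "null_homotopic_rep K T {..<N} A A'"
proof -
  obtain n Ex \<eta> where "group_exponential K T n Ex \<eta>"
    using compact_lie_group_exponential[OF assms] .
  then interpret group_exponential K T n Ex \<eta> .
  let ?H = "Ex ` \<V> n"
  obtain B :: "(nat \<Rightarrow> real) set" and \<psi> :: "(nat \<Rightarrow> real) \<Rightarrow> 'a \<Rightarrow> complex" where B: "finite B"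
    "\<And>b x y. b \<in> B \<Longrightarrow> x \<in> ?H \<Longrightarrow> y \<in> ?H \<Longrightarrow> \<psi> b (x \<otimes>\<^bsub>K\<^esub> y) = \<psi> b x * \<psi> b y"
    "\<And>b x. b \<in> B \<Longrightarrow> x \<in> ?H \<Longrightarrow> norm (\<psi> b x) = 1"
    "\<And>b. b \<in> B \<Longrightarrow> continuous_map (subtopology T ?H) euclidean (\<psi> b)"
    "\<And>x. x \<in> ?H \<Longrightarrow> (\<And>b. b \<in> B \<Longrightarrow> \<psi> b x = 1) \<Longrightarrow> x = \<one>\<^bsub>K\<^esub>"
    by (rule ex_separating_characters) blast
  obtain S where S: "finite S" "S \<subseteq> carrier K" "\<And>k. k \<in> carrier K \<Longrightarrow> \<exists>!s. s \<in> S \<and> inv\<^bsub>K\<^esub> s \<otimes>\<^bsub>K\<^esub> k \<in> ?H"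
    using ex_coset_representatives[OF range_subgroup range_open] by blast
  \<comment> \<open>The trivial character \<open>None\<close> is added because \<open>B\<close> is
    empty when \<open>K\<close> is finite; without it there would be no block left to record the
    permutation of the cosets.\<close>
  define \<phi> where "\<phi> c = (case c of None \<Rightarrow> (\<lambda>_. 1) | Some b \<Rightarrow> \<psi> b)" for c
  have \<phi>: "\<phi> None = (\<lambda>_. 1)" "\<phi> (Some b) = \<psi> b" for b by (auto simp: \<phi>_def)
  interpret induced_rep K T ?H S "insert None (Some ` B)" \<phi>
  proof (intro induced_rep.intro induced_rep_axioms.intro)
    fix x assume "x \<in> ?H" and 1: "\<And>c. c \<in> insert None (Some ` B) \<Longrightarrow> \<phi> c x = 1"
    then show "x = \<one>\<^bsub>K\<^esub>" using 1[of "Some _"] by (intro B(5)) (auto simp: \<phi>)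
  next
    show "subgroup ?H K" by (rule range_subgroup)
  next
    show "openin T ?H" by (rule range_open)
  next
    fix k assume "k \<in> carrier K"
    then show "\<exists>!s. s \<in> S \<and> inv\<^bsub>K\<^esub> s \<otimes>\<^bsub>K\<^esub> k \<in> ?H" by (rule S(3))
  next
    fix c x y assume "c \<in> insert None (Some ` B)" "x \<in> ?H" "y \<in> ?H"
    then show "\<phi> c (x \<otimes>\<^bsub>K\<^esub> y) = \<phi> c x * \<phi> c y" using B(2)[of _ x y] by (auto simp: \<phi>)
  next
    fix c x assume "c \<in> insert None (Some ` B)" "x \<in> ?H"
    then show "norm (\<phi> c x) = 1" using B(3)[of _ x] by (auto simp: \<phi>)
  next
    fix c assume "c \<in> insert None (Some ` B)"
    then show "continuous_map (subtopology T ?H) euclidean (\<phi> c)" using B(4) by (auto simp: \<phi>)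
  qed (use B(1) S(1,2) compact_top_group_axioms in auto)
  obtain A A' where A: "null_homotopic_rep K T ((insert None (Some ` B) \<times> S) \<times> {..<4::nat}) A A'"
    using ex_null_homotopic_rep by blast
  then have "finite ((insert None (Some ` B) \<times> S) \<times> {..<4::nat})" by (simp add: null_homotopic_rep_def)
  then obtain h where "bij_betw h {0..<card ((insert None (Some ` B) \<times> S) \<times> {..<4::nat})} ((insert None (Some ` B) \<times> S) \<times> {..<4::nat})"
    using ex_bij_betw_nat_finite by blast
  from null_homotopic_rep_reindex[OF A this] show thesis
    using that by (simp only: atLeast0LessThan)
qed

section \<open>Two-term homotopy representations\<close>

lemma continuous_map_mult_field:
  fixes f g :: "'x \<Rightarrow> 'k::real_normed_field"
  shows "continuous_map X euclidean f \<Longrightarrow> continuous_map X euclidean g \<Longrightarrow>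
    continuous_map X euclidean (\<lambda>x. f x * g x)"
  by (simp add: continuous_map_atin tendsto_mult)

lemma continuous_map_fun_iff:
  fixes f :: "'x \<Rightarrow> 'i \<Rightarrow> 'k::topological_space"
  shows "continuous_map X euclidean f \<longleftrightarrow> (\<forall>i. continuous_map X euclidean (\<lambda>x. f x i))"
  unfolding euclidean_product_topology[symmetric] continuous_map_componentwise_UNIV ..

lemma basis_vect_coord_space: "i < r \<Longrightarrow> basis_vect i \<in> coord_space r"
  by (auto simp: basis_vect_def coord_space_def)

text \<open>Entries from \<open>q\<close> on are set to 0, so the value lies in
  \<open>coord_space q\<close>, and rank 0 on either side gives the zero map: one formula serves all
  degrees of a complex.\<close>

definition mapply :: "nat \<Rightarrow> nat \<Rightarrow> (nat \<Rightarrow> nat \<Rightarrow> 'k) \<Rightarrow> 'k vect \<Rightarrow> ('k::real_normed_field) vect" where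
  "mapply q p A v = (\<lambda>i. if i < q then \<Sum>j<p. A i j * v j else 0)"

lemma mapply_0_left [simp]: "mapply 0 p A v = 0"
  by (auto simp: mapply_def)

lemma mapply_0_right [simp]: "mapply q 0 A v = 0"
  by (auto simp: mapply_def)

lemma mapply_zero [simp]: "mapply q p A 0 = 0"
  by (auto simp: mapply_def)

lemma mapply_zero_matrix [simp]: "mapply q p (\<lambda>_ _. 0) v = 0"
  by (auto simp: mapply_def)

lemma mapply_coord_space: "mapply q p A v \<in> coord_space q"
  by (auto simp: mapply_def coord_space_def)

lemma mapply_add: "mapply q p A (v + w) = mapply q p A v + mapply q p A w"
  by (auto simp: mapply_def fun_eq_iff distrib_left sum.distrib)

lemma mapply_diff: "mapply q p A (v - w) = mapply q p A v - mapply q p A w"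
  by (auto simp: mapply_def fun_eq_iff right_diff_distrib sum_subtractf)

lemma mapply_vscale: "mapply q p A (vscale c v) = vscale c (mapply q p A v)"
  by (auto simp: mapply_def vscale_def fun_eq_iff sum_distrib_left intro!: sum.cong)

lemma mapply_matrix_diff: "mapply q p (\<lambda>i j. A i j - B i j) v = mapply q p A v - mapply q p B v"
  by (auto simp: mapply_def fun_eq_iff left_diff_distrib sum_subtractf)

lemma mapply_matrix_scale: "mapply q p (\<lambda>i j. c * A i j) v = vscale c (mapply q p A v)"
  by (auto simp: mapply_def vscale_def fun_eq_iff sum_distrib_left intro!: sum.cong)

lemma mapply_mid: "v \<in> coord_space N \<Longrightarrow> mapply N N mid v = v"
  by (auto simp: mapply_def mid_def coord_space_def fun_eq_iff if_distrib[of "\<lambda>x. x * _"] cong: if_cong)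

lemma mapply_cong: "eq_on {..<N} A B \<Longrightarrow> mapply N N A v = mapply N N B v"
  by (auto simp: mapply_def eq_on_def intro!: sum.cong)

lemma mapply_mapply: "mapply N N A (mapply N N B v) = mapply N N (mmul {..<N} A B) v"
proof
  fix i
  show "mapply N N A (mapply N N B v) i = mapply N N (mmul {..<N} A B) v i"
  proof (cases "i < N")
    case True
    then have "mapply N N A (mapply N N B v) i = (\<Sum>j<N. \<Sum>k<N. A i j * B j k * v k)"
      by (simp add: mapply_def sum_distrib_left mult.assoc)
    also have "\<dots> = (\<Sum>k<N. \<Sum>j<N. A i j * B j k * v k)" by (rule sum.swap)
    also have "\<dots> = mapply N N (mmul {..<N} A B) v i"
      using True by (simp add: mapply_def mmul_def sum_distrib_right)
    finally show ?thesis .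
  qed (simp add: mapply_def)
qed

lemma mapply_basis_vect: "i < N \<Longrightarrow> j < N \<Longrightarrow> mapply N N A (basis_vect j) i = A i j"
  by (simp add: mapply_def basis_vect_def if_distrib[of "\<lambda>x. _ * x"] cong: if_cong)

lemma vscale_simps [simp]:
  fixes v :: "('k::real_normed_field) vect"
  shows "vscale a (0 :: 'k vect) = 0" "vscale 1 v = v" "vscale (-1) v = - v"
  by (auto simp: vscale_def)

section \<open>Trivial bundles and their matrix sections\<close>

definition trivial_bundle :: "'b topology \<Rightarrow> nat \<Rightarrow> ('b, 'k::real_normed_field) vbundle" where
  "trivial_bundle X r = \<lparr>fib = (\<lambda>_. coord_space r), total = prod_topology X (top_of_set (coord_space r))\<rparr>"

lemma fib_trivial_bundle [simp]: "fib (trivial_bundle X r) x = coord_space r"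
  by (simp add: trivial_bundle_def)

lemma coord_space_0: "coord_space 0 = {0}"
  by (auto simp: coord_space_def fun_eq_iff)

lemma zero_coord_space [simp]: "0 \<in> coord_space r"
  by (simp add: coord_space_def)

lemma vector_bundle_trivial: "vector_bundle X (trivial_bundle X r :: ('b, 'k::real_normed_field) vbundle)"
proof -
  let ?E = "trivial_bundle X r :: ('b, 'k) vbundle"
  have "subtopology (total ?E) (topspace X \<times> UNIV) = total ?E"
    by (rule subtopology_superset) (auto simp: trivial_bundle_def)
  then have "local_trivialization X ?E (topspace X) r (\<lambda>_ v. v)"
    unfolding local_trivialization_def
    by (auto simp: linear_from_to_def case_prod_unfold trivial_bundle_def homeomorphic_map_id[unfolded id_def])
  then show ?thesis
    unfolding vector_bundle_def
    by (auto simp: linear_subspace_def coord_space_def vscale_def trivial_bundle_def continuous_map_fst)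
qed

text \<open>\<open>hom_section\<close> tests all local trivializations, also those unrelated to the
  product structure. The frame which \<open>\<phi>\<close> induces is continuous, being the second
  component of the inverse homeomorphism along \<open>(x, basis_vect i)\<close>.\<close>

lemma local_trivialization_basis_cont:
  fixes \<phi> :: "'b \<Rightarrow> 'k vect \<Rightarrow> ('k::real_normed_field) vect"
  assumes triv: "local_trivialization X (trivial_bundle X p) U r \<phi>" and i: "i < r"
  defines "w \<equiv> \<lambda>x. inv_into (coord_space p) (\<phi> x) (basis_vect i)"
  shows "continuous_map (subtopology X U) euclidean (\<lambda>x. w x j)"
proof -
  let ?E = "subtopology (total (trivial_bundle X p)) (U \<times> (UNIV :: 'k vect set))"
  let ?F = "prod_topology (subtopology X U) (top_of_set (coord_space r :: 'k vect set))"
  have U: "U \<subseteq> topspace X" using triv by (auto simp: local_trivialization_def openin_subset)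
  have topE: "topspace ?E = U \<times> coord_space p"
    using U by (auto simp: trivial_bundle_def)
  have hom: "homeomorphic_map ?E ?F (\<lambda>(x, v). (x, \<phi> x v))"
    using triv by (simp add: local_trivialization_def)
  then obtain g where g: "homeomorphic_maps ?E ?F (\<lambda>(x, v). (x, \<phi> x v)) g"
    using homeomorphic_map_maps by blast
  have b: "continuous_map (subtopology X U) ?F (\<lambda>x. (x, basis_vect i))"
    using i by (intro continuous_map_pairedI) (auto simp: basis_vect_coord_space intro: continuous_map_id[unfolded id_def])
  have inj: "inj_on (\<phi> x) (coord_space p)" if "x \<in> U" for x
    using homeomorphic_imp_injective_map[OF hom] that unfolding topE by (auto simp: inj_on_def)
  have gw: "g (x, basis_vect i) = (x, w x)" if x: "x \<in> U" for x
  proof -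
    have "(x, basis_vect i) \<in> topspace ?F" using x U i by (simp add: basis_vect_coord_space subset_iff)
    moreover have "continuous_map ?F ?E g" "\<And>y. y \<in> topspace ?F \<Longrightarrow> (\<lambda>(x, v). (x, \<phi> x v)) (g y) = y"
      using g unfolding homeomorphic_maps_def by blast+
    ultimately have "g (x, basis_vect i) \<in> topspace ?E" "(\<lambda>(x, v). (x, \<phi> x v)) (g (x, basis_vect i)) = (x, basis_vect i)"
      using continuous_map_image_subset_topspace[of ?F ?E g] by blast+
    then obtain v where v: "g (x, basis_vect i) = (x, v)" "v \<in> coord_space p" "\<phi> x v = basis_vect i"
      unfolding topE by (cases "g (x, basis_vect i)") auto
    then have "w x = v" unfolding w_def using inv_into_f_f[OF inj[OF x] v(2)] by simp
    with v show ?thesis by simp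
  qed
  have "continuous_map ?F ?E g" using g by (simp add: homeomorphic_maps_def)
  then have "continuous_map ?F (prod_topology X (top_of_set (coord_space p))) g"
    by (simp add: continuous_map_in_subtopology trivial_bundle_def)
  from continuous_map_compose[OF continuous_map_compose[OF b this] continuous_map_snd]
  have "continuous_map (subtopology X U) (top_of_set (coord_space p)) (\<lambda>x. snd (g (x, basis_vect i)))"
    by (simp add: o_def)
  then have "continuous_map (subtopology X U) euclidean (\<lambda>x. snd (g (x, basis_vect i)))"
    by (simp add: continuous_map_in_subtopology)
  then have "continuous_map (subtopology X U) euclidean w"
    by (rule continuous_map_eq) (simp add: gw)
  then show ?thesis by (simp add: continuous_map_fun_iff)
qed

text \<open>In arbitrary trivializations an entry is composed of three continuous pieces: the
  induced frame of the source, the matrix \<open>M\<close> in standard coordinates, and the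
  trivialization of the target.\<close>

lemma hom_section_mapply:
  fixes M :: "'z \<Rightarrow> nat \<Rightarrow> nat \<Rightarrow> 'k::real_normed_field" and X :: "'b topology"
  assumes a: "continuous_map Z X a" and b: "continuous_map Z X b"
    and M: "\<And>i j. i < q \<Longrightarrow> j < p \<Longrightarrow> continuous_map Z euclidean (\<lambda>z. M z i j)"
  shows "hom_section X Z a b (trivial_bundle X p) (trivial_bundle X q) (\<lambda>z. mapply q p (M z))"
  unfolding hom_section_def fib_trivial_bundle
proof (intro conjI ballI allI impI)
  fix z show "linear_from_to (coord_space p) (coord_space q) (mapply q p (M z))"
    by (auto simp: linear_from_to_def mapply_coord_space mapply_add mapply_vscale)
next
  fix U r V s i j and \<phi> \<psi> :: "'b \<Rightarrow> 'k vect \<Rightarrow> 'k vect"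
  assume triv: "local_trivialization X (trivial_bundle X p) U r \<phi>" "local_trivialization X (trivial_bundle X q) V s \<psi>"
    and i: "i < r" "j < s"
  let ?Z = "subtopology Z {z. a z \<in> U \<and> b z \<in> V}"
  define w where "w x = inv_into (coord_space p) (\<phi> x) (basis_vect i)" for x
  have V: "V \<subseteq> topspace X" using triv by (auto simp: local_trivialization_def openin_subset)
  have aU: "continuous_map ?Z (subtopology X U) a" and bV: "continuous_map ?Z (subtopology X V) b"
    using a b by (auto simp: continuous_map_in_subtopology continuous_map_from_subtopology)
  have w: "continuous_map ?Z euclidean (\<lambda>z. w (a z) j)" for j
    using continuous_map_compose[OF aU local_trivialization_basis_cont[OF triv(1) i(1), of j]]
    by (simp add: o_def w_def)
  have "continuous_map ?Z euclidean (\<lambda>z. mapply q p (M z) (w (a z)) k)" for k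
  proof (cases "k < q")
    case True
    have "continuous_map ?Z euclidean (\<lambda>z. \<Sum>j<p. M z k j * w (a z) j)"
      using True M by (intro continuous_map_sum continuous_map_mult_field w) (auto intro: continuous_map_from_subtopology)
    then show ?thesis using True by (simp add: mapply_def)
  qed (simp add: mapply_def)
  then have "continuous_map ?Z (top_of_set (coord_space q)) (\<lambda>z. mapply q p (M z) (w (a z)))"
    by (auto simp: continuous_map_in_subtopology continuous_map_fun_iff mapply_coord_space)
  with bV have "continuous_map ?Z (prod_topology (subtopology X V) (top_of_set (coord_space q)))
      (\<lambda>z. (b z, mapply q p (M z) (w (a z))))"
    by (intro continuous_map_pairedI)
  moreover have "prod_topology (subtopology X V) (top_of_set (coord_space q :: 'k vect set)) = subtopology (total (trivial_bundle X q)) (V \<times> UNIV)"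
    by (simp add: trivial_bundle_def subtopology_Times)
  ultimately have "continuous_map ?Z (subtopology (total (trivial_bundle X q)) (V \<times> UNIV)) (\<lambda>z. (b z, mapply q p (M z) (w (a z))))"
    by simp
  moreover have "continuous_map (subtopology (total (trivial_bundle X q)) (V \<times> UNIV))
       (prod_topology (subtopology X V) (top_of_set (coord_space s))) (\<lambda>(x, v). (x, \<psi> x v))"
    using triv(2) by (simp add: local_trivialization_def homeomorphic_imp_continuous_map)
  ultimately have "continuous_map ?Z (prod_topology (subtopology X V) (top_of_set (coord_space s)))
      ((\<lambda>(x, v). (x, \<psi> x v)) \<circ> (\<lambda>z. (b z, mapply q p (M z) (w (a z)))))"
    by (rule continuous_map_compose)
  from continuous_map_compose[OF this continuous_map_snd]
  have "continuous_map ?Z (top_of_set (coord_space s)) (\<lambda>z. \<psi> (b z) (mapply q p (M z) (w (a z))))"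
    by (simp add: o_def)
  then have "continuous_map ?Z euclidean (\<lambda>z. \<psi> (b z) (mapply q p (M z) (w (a z))))"
    by (simp add: continuous_map_in_subtopology)
  then show "continuous_map ?Z euclidean (\<lambda>z. \<psi> (b z) (mapply q p (M z) (inv_into (coord_space p) (\<phi> (a z)) (basis_vect i))) j)"
    by (simp add: continuous_map_fun_iff w_def)
qed

text \<open>Where \<open>c = 1\<close>, the two-term complex \<open>c : k\<^sup>N \<rightarrow> k\<^sup>N\<close> is acyclic, and the
  homotopy \<open>R\<^sub>2\<close> is the defect of multiplicativity of \<open>A\<close>.\<close>

locale acyclic_extension = topological_groupoid G
  for G :: "('g, 'b) groupoid" +
  fixes N :: nat and A B :: "'g \<Rightarrow> nat \<Rightarrow> nat \<Rightarrow> 'k::real_normed_field" and c :: "'b \<Rightarrow> real" and x0 :: 'b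
  assumes src_tgt: "g \<in> topspace (arrows G) \<Longrightarrow> src G g = tgt G g"
    and A_cont: "i < N \<Longrightarrow> j < N \<Longrightarrow> continuous_map (arrows G) euclidean (\<lambda>g. A g i j)"
    and B_cont: "i < N \<Longrightarrow> j < N \<Longrightarrow> continuous_map (arrows G) euclidean (\<lambda>g. B g i j)"
    and A_inverse: "g \<in> topspace (arrows G) \<Longrightarrow> inverse_on {..<N} (A g) (B g)"
    and c_cont: "continuous_map (objects G) euclideanreal c"
    and A_mult: "g \<in> topspace (arrows G) \<Longrightarrow> h \<in> topspace (arrows G) \<Longrightarrow> src G g = tgt G h \<Longrightarrow>
        c (src G g) \<noteq> 1 \<Longrightarrow> eq_on {..<N} (A (gmult G g h)) (mmul {..<N} (A g) (A h))"
    and A_unit: "x \<in> topspace (objects G) \<Longrightarrow> c x \<noteq> 1 \<Longrightarrow> eq_on {..<N} (A (unit G x)) mid"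
    and x0: "x0 \<in> topspace (objects G)" "c x0 = 0"
    and A_inj: "g \<in> carrier (isotropy_group G x0) \<Longrightarrow> h \<in> carrier (isotropy_group G x0) \<Longrightarrow>
        eq_on {..<N} (A g) (A h) \<Longrightarrow> g = h"
begin

definition rk :: "int \<Rightarrow> nat" where
  "rk n = (if n = 0 \<or> n = 1 then N else 0)"

definition E :: "('b, 'k) graded_bundle" where
  "E n = trivial_bundle (objects G) (rk n)"

definition D :: "'g \<Rightarrow> 'g \<Rightarrow> nat \<Rightarrow> nat \<Rightarrow> 'k" where
  "D g h = (\<lambda>i j. mmul {..<N} (A g) (A h) i j - A (gmult G g h) i j)"

definition RM :: "nat \<Rightarrow> ('g, 'b) nerve_point \<Rightarrow> nat \<Rightarrow> nat \<Rightarrow> 'k" where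
  "RM k p = (if k = 0 then \<lambda>i j. of_real (c (fst p)) * mid i j
     else if k = 1 then A (snd p 1) else if k = 2 then D (snd p 1) (snd p 2) else (\<lambda>_ _. 0))"

definition R :: "('g, 'b, 'k) rep_data" where
  "R k p n = mapply (rk (n + 1 - int k)) (rk n) (RM k p)"

lemma rk_simps [simp]: "rk 0 = N" "rk 1 = N" "n \<noteq> 0 \<Longrightarrow> n \<noteq> 1 \<Longrightarrow> rk n = 0"
  by (auto simp: rk_def)

lemma fib_E [simp]: "fib (E n) x = coord_space (rk n)"
  by (simp add: E_def)

lemma graded: "graded_vector_bundle (objects G) E"
  unfolding graded_vector_bundle_def fib_E
  by (auto simp: E_def vector_bundle_trivial coord_space_0 intro!: exI[of _ 1])

lemma nerve_proj:
  shows "continuous_map (nerve G k) (objects G) fst"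
    and "i \<in> {1..k} \<Longrightarrow> continuous_map (nerve G k) (arrows G) (\<lambda>p. snd p i)"
proof -
  show "continuous_map (nerve G k) (objects G) fst"
    unfolding nerve_def by (intro continuous_map_from_subtopology continuous_map_fst)
  assume i: "i \<in> {1..k}"
  show "continuous_map (nerve G k) (arrows G) (\<lambda>p. snd p i)"
    unfolding nerve_def
    using continuous_map_compose[OF continuous_map_snd continuous_map_product_projection[OF i, of "\<lambda>_. arrows G"]]
    by (intro continuous_map_from_subtopology) (simp add: o_def)
qed

lemma nerve_mem:
  assumes "p \<in> topspace (nerve G k)"
  shows "fst p \<in> topspace (objects G)"
    and "i \<in> {1..k} \<Longrightarrow> snd p i \<in> topspace (arrows G)"
    and "1 \<le> i \<Longrightarrow> i < k \<Longrightarrow> src G (snd p i) = tgt G (snd p (i + 1))"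
    and "k \<ge> 1 \<Longrightarrow> src G (snd p k) = fst p"
  using assms by (auto simp: nerve_def PiE_iff)

text \<open>In a bundle of groups all arrows of a chain lie over one base point. The encoding of the
  nerve fixes the source of the last arrow, so the induction runs downwards.\<close>

lemma nerve_src:
  assumes p: "p \<in> topspace (nerve G k)" and i: "i \<in> {1..k}"
  shows "src G (snd p i) = fst p" "tgt G (snd p i) = fst p"
proof -
  have "i \<le> k" using i by simp
  then show s: "src G (snd p i) = fst p"
    using i
  proof (induction i rule: inc_induct)
    case base
    then show ?case using nerve_mem(4)[OF p] by simp
  next
    case (step j)
    then show ?case using nerve_mem(2)[OF p] nerve_mem(3)[OF p, of j] src_tgt[of "snd p (j + 1)"] by simp
  qed
  then show "tgt G (snd p i) = fst p" using src_tgt nerve_mem(2)[OF p i] by simp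
qed

lemma ntgt_cont: "continuous_map (nerve G k) (objects G) (ntgt G k)"
proof (rule continuous_map_eq[OF nerve_proj(1)])
  fix p assume "p \<in> topspace (nerve G k)"
  then show "fst p = ntgt G k p" using nerve_src(2)[of p k 1] by (auto simp: ntgt_def)
qed

lemma D_cont:
  assumes "i < N" "j < N"
  shows "continuous_map (nerve G 2) euclidean (\<lambda>p. D (snd p 1) (snd p 2) i j)"
proof -
  have A: "continuous_map (nerve G 2) euclidean (\<lambda>p. A (snd p k) i j)" if "k \<in> {1..2}" "i < N" "j < N" for k i j
    using continuous_map_compose[OF nerve_proj(2)[OF that(1)] A_cont[OF that(2,3)]] by (simp add: o_def)
  have "continuous_map (nerve G 2) (subtopology (prod_topology (arrows G) (arrows G)) {(g, h). src G g = tgt G h})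
      (\<lambda>p. (snd p 1, snd p 2))"
    unfolding continuous_map_in_subtopology
    using nerve_proj(2)[of 1 2] nerve_proj(2)[of 2 2] nerve_mem(3)[of _ 2 1]
    by (auto intro!: continuous_map_pairedI simp: numeral_2_eq_2)
  from continuous_map_compose[OF continuous_map_compose[OF this gmult_cont] A_cont[OF assms]]
  have "continuous_map (nerve G 2) euclidean (\<lambda>p. A (gmult G (snd p 1) (snd p 2)) i j)"
    by (simp add: o_def)
  then show ?thesis
    unfolding D_def mmul_def using assms
    by (intro continuous_map_diff continuous_map_sum continuous_map_mult_field A) auto
qed

lemma RM_cont:
  assumes "i < N" "j < N"
  shows "continuous_map (nerve G k) euclidean (\<lambda>p. RM k p i j)"
proof -
  consider "k = 0" | "k = 1" | "k = 2" | "k > 2" by linarith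
  then show ?thesis
  proof cases
    case 1
    have "continuous_map (nerve G k) euclidean (\<lambda>p. of_real (c (fst p)) :: 'k)"
    proof -
      have "continuous_map euclideanreal euclidean (of_real :: real \<Rightarrow> 'k)"
        by (auto intro!: continuous_intros)
      from continuous_map_compose[OF continuous_map_compose[OF nerve_proj(1) c_cont] this]
      show ?thesis by (simp add: o_def)
    qed
    then have "continuous_map (nerve G k) euclidean (\<lambda>p. of_real (c (fst p)) * mid i j :: 'k)"
      by (intro continuous_map_mult_field) auto
    then show ?thesis using 1 by (simp add: RM_def)
  next
    case 2
    then show ?thesis
      using continuous_map_compose[OF nerve_proj(2)[of 1 k] A_cont[OF assms]] by (simp add: RM_def o_def)
  next
    case 3
    then show ?thesis using D_cont[OF assms] by (simp add: RM_def)
  qed (simp add: RM_def)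
qed

lemma rk_le: "i < rk n \<Longrightarrow> i < N"
  by (auto simp: rk_def split: if_splits)

lemma R_section: "hom_section (objects G) (nerve G k) nsrc (ntgt G k) (E n) (E (n + 1 - int k)) (\<lambda>p. R k p n)"
  unfolding E_def R_def
  by (intro hom_section_mapply ntgt_cont RM_cont) (auto simp: nsrc_def[abs_def] nerve_proj(1) rk_le)

abbreviation act :: "'g \<Rightarrow> 'k vect \<Rightarrow> 'k vect" where
  "act g \<equiv> mapply N N (A g)"

lemma act_D: "mapply N N (D g h) v = act g (act h v) - act (gmult G g h) v"
  by (simp add: D_def mapply_matrix_diff mapply_mapply)

text \<open>Either \<open>c\<close> is 1, or \<open>A\<close> is multiplicative and the defect is 0.
  Since the differential is multiplication by \<open>c\<close>, composing it with the defect on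
  either side gives back the defect, as the relations for two arrows require.\<close>

lemma c_D:
  assumes "g \<in> topspace (arrows G)" "h \<in> topspace (arrows G)" "src G g = tgt G h"
  shows "vscale (of_real (c (src G g))) (act g (act h v) - act (gmult G g h) v) = act g (act h v) - act (gmult G g h) v"
proof (cases "c (src G g) = 1")
  case False
  then have "act (gmult G g h) v = act g (act h v)"
    using mapply_cong[OF A_mult[OF assms False]] by (simp add: mapply_mapply)
  then show ?thesis by (simp add: vscale_def zero_fun_def)
qed simp

lemma R_0: "v \<in> coord_space N \<Longrightarrow> R 0 p 0 v = vscale (of_real (c (fst p))) v"
  by (simp add: R_def RM_def mapply_matrix_scale mapply_mid)

lemma R_1: "n = 0 \<or> n = 1 \<Longrightarrow> R 1 p n v = act (snd p 1) v"
  by (auto simp: R_def RM_def)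

lemma R_2: "R 2 p 1 v = act (snd p 1) (act (snd p 2) v) - act (gmult G (snd p 1) (snd p 2)) v"
  by (simp add: R_def RM_def act_D)

lemma R_source_0: "n \<noteq> 0 \<Longrightarrow> n \<noteq> 1 \<Longrightarrow> R k p n v = 0"
  by (simp add: R_def)

lemma R_target_0: "n + 1 - int k \<noteq> 0 \<Longrightarrow> n + 1 - int k \<noteq> 1 \<Longrightarrow> R k p n v = 0"
  by (simp add: R_def)

lemma R_zero [simp]: "R k p n 0 = 0"
  by (simp add: R_def)

lemma front_face_simps:
  assumes p: "p \<in> topspace (nerve G k)" and j: "j \<le> k"
  shows "fst (front_face G k j p) = fst p" "i \<in> {1..j} \<Longrightarrow> snd (front_face G k j p) i = snd p i"
    "fst (back_face k j p) = fst p" "i \<in> {1..k - j} \<Longrightarrow> snd (back_face k j p) i = snd p (j + i)"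
proof -
  have "tgt G (snd p (j + 1)) = fst p" if "j < k"
    using nerve_src(2)[OF p, of "j + 1"] that by simp
  then show "fst (front_face G k j p) = fst p"
    using j by (auto simp: front_face_def ntgt_def back_face_def)
qed (auto simp: front_face_def back_face_def)

text \<open>Both sides map degree \<open>n\<close> to degree \<open>m\<close>, and only the degrees
  0 and 1 carry anything. This leaves four cases: \<open>R 1\<close> commutes with the differential
  (\<open>k = 1\<close>), \<open>R 2\<close> bounds the defect in each of the two degrees
  (\<open>k = 2\<close>), and the compatibility of \<open>R 1\<close> with \<open>R 2\<close>
  (\<open>k = 3\<close>).\<close>

lemma R_relation:
  assumes p: "p \<in> topspace (nerve G k)" and v: "v \<in> fib (E n) (nsrc p)"
  shows "(\<Sum>j\<in>{1..<k}. vscale ((-1) ^ j) (R (k - 1) (contract G k j p) n v)) =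
        (\<Sum>j\<le>k. vscale ((-1) ^ j)
           (R j (front_face G k j p) (n + 1 - int (k - j)) (R (k - j) (back_face k j p) n v)))"
proof -
  define m where "m = n + 2 - int k"
  define F where "F j = R j (front_face G k j p) (n + 1 - int (k - j)) (R (k - j) (back_face k j p) n v)" for j
  define P where "P j = R (k - 1) (contract G k j p) n v" for j
  have sN: "snd p i \<in> topspace (arrows G)" "src G (snd p i) = fst p" "tgt G (snd p i) = fst p" if "i \<in> {1..k}" for i
    using nerve_mem(2)[OF p that] nerve_src[OF p that] by auto
  note face = front_face_simps[OF p]
  have "(\<Sum>j\<in>{1..<k}. vscale ((-1) ^ j) (P j)) = (\<Sum>j\<le>k. vscale ((-1) ^ j) (F j))"
  proof -
    consider "n \<noteq> 0 \<and> n \<noteq> 1 \<or> m \<noteq> 0 \<and> m \<noteq> 1" | "n = 0" "k = 1" | "n = 0" "k = 2" | "n = 1" "k = 2" | "n = 1" "k = 3"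
      unfolding m_def by linarith
    then show ?thesis
    proof cases
      case 1
      have l: "P j = 0" if "j \<in> {1..<k}" for j
      proof (cases "n \<noteq> 0 \<and> n \<noteq> 1")
        case True
        then show ?thesis by (simp add: R_source_0 P_def)
      next
        case False
        then show ?thesis using 1 that unfolding P_def by (intro R_target_0) (auto simp: m_def)
      qed
      have r: "F j = 0" if "j \<le> k" for j
      proof (cases "n \<noteq> 0 \<and> n \<noteq> 1")
        case True
        then show ?thesis by (simp add: R_source_0 F_def)
      next
        case False
        then show ?thesis using 1 that unfolding F_def by (intro R_target_0) (auto simp: m_def)
      qed
      show ?thesis using l r by simp
    next
      case 2
      have vN: "v \<in> coord_space N" using v 2 by simp
      have s: "{..k} = {0, 1}" "{1..<k} = {}" using 2 by auto
      have "F 0 = vscale (of_real (c (fst p))) (act (snd p 1) v)"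
        unfolding F_def using 2 face[of 0] R_1[of 0 "back_face k 0 p" v]
        by (simp add: R_0 mapply_coord_space)
      moreover have "F 1 = act (snd p 1) (vscale (of_real (c (fst p))) v)"
        unfolding F_def using 2 face[of 1] R_1[of 1 "front_face G k 1 p" "vscale (of_real (c (fst p))) v"] vN
        by (simp add: R_0)
      ultimately show ?thesis unfolding s by (simp add: mapply_vscale)
    next
      case 3
      have vN: "v \<in> coord_space N" using v 3 by simp
      have s: "{..k} = {0, 1, 2}" "{1..<k} = {1}" using 3 by auto
      have P1: "P 1 = act (gmult G (snd p 1) (snd p 2)) v"
        unfolding P_def using 3 R_1[of 0 "contract G k 1 p" v] by (simp add: contract_def numeral_2_eq_2)
      have "R 2 (back_face k 0 p) 0 v = 0" by (rule R_target_0) auto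
      then have F0: "F 0 = 0" unfolding F_def using 3 by simp
      have F1: "F 1 = act (snd p 1) (act (snd p 2) v)"
        unfolding F_def using 3 face[of 1] R_1[of 0 "front_face G k 1 p"] R_1[of 0 "back_face k 1 p" v]
        by (simp add: numeral_2_eq_2)
      have "F 2 = vscale (of_real (c (fst p))) (act (snd p 1) (act (snd p 2) v) - act (gmult G (snd p 1) (snd p 2)) v)"
        unfolding F_def using 3 face[of 2] vN by (simp add: R_0 R_2 mapply_vscale) (simp add: vscale_def fun_eq_iff algebra_simps)
      also have "\<dots> = act (snd p 1) (act (snd p 2) v) - act (gmult G (snd p 1) (snd p 2)) v"
        using c_D[of "snd p 1" "snd p 2" v] sN[of 1] sN[of 2] 3 by simp
      finally show ?thesis unfolding s by (simp add: P1[unfolded One_nat_def] F0 F1[unfolded One_nat_def])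
    next
      case 4
      have vN: "v \<in> coord_space N" using v 4 by simp
      have s: "{..k} = {0, 1, 2}" "{1..<k} = {1}" using 4 by auto
      have P1: "P 1 = act (gmult G (snd p 1) (snd p 2)) v"
        unfolding P_def using 4 R_1[of 1 "contract G k 1 p" v] by (simp add: contract_def numeral_2_eq_2)
      have F1: "F 1 = act (snd p 1) (act (snd p 2) v)"
        unfolding F_def using 4 face[of 1] R_1[of 1 "front_face G k 1 p"] R_1[of 1 "back_face k 1 p" v]
        by (simp add: numeral_2_eq_2)
      have F2: "F 2 = 0" unfolding F_def using 4 by (simp add: R_source_0)
      have "R 2 (back_face k 0 p) 1 v \<in> coord_space N" by (simp add: R_def mapply_coord_space)
      then have "F 0 = vscale (of_real (c (fst p))) (act (snd p 1) (act (snd p 2) v) - act (gmult G (snd p 1) (snd p 2)) v)"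
        unfolding F_def using 4 face[of 0] by (simp add: R_0 R_2)
      also have "\<dots> = act (snd p 1) (act (snd p 2) v) - act (gmult G (snd p 1) (snd p 2)) v"
        using c_D[of "snd p 1" "snd p 2" v] sN[of 1] sN[of 2] 4 by simp
      finally show ?thesis unfolding s by (simp add: P1[unfolded One_nat_def] F2 F1[unfolded One_nat_def])
    next
      case 5
      have s: "{..k} = {0, 1, 2, 3}" "{1..<k} = {1, 2}" using 5 by auto
      have P1: "P 1 = act (gmult G (snd p 1) (snd p 2)) (act (snd p 3) v) - act (gmult G (gmult G (snd p 1) (snd p 2)) (snd p 3)) v"
        unfolding P_def using 5 by (simp add: R_2 contract_def flip: numeral_2_eq_2)
      have P2: "P 2 = act (snd p 1) (act (gmult G (snd p 2) (snd p 3)) v) - act (gmult G (snd p 1) (gmult G (snd p 2) (snd p 3))) v"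
        unfolding P_def using 5 by (simp add: R_2 contract_def)
      have "R 3 (back_face k 0 p) 1 v = 0" by (rule R_target_0) auto
      then have F0: "F 0 = 0" unfolding F_def using 5 by simp
      have F1: "F 1 = act (snd p 1) (act (snd p 2) (act (snd p 3) v) - act (gmult G (snd p 2) (snd p 3)) v)"
        unfolding F_def using 5 face[of 1] R_1[of 0 "front_face G k 1 p"] by (simp add: R_2 flip: numeral_2_eq_2)
      have F2: "F 2 = act (snd p 1) (act (snd p 2) (act (snd p 3) v)) - act (gmult G (snd p 1) (snd p 2)) (act (snd p 3) v)"
        unfolding F_def using 5 face[of 2] R_1[of 1 "back_face k 2 p" v] by (simp add: R_2)
      have F3: "F 3 = 0" unfolding F_def using 5 by (simp add: R_source_0)
      \<comment> \<open>There is no operator \<open>R 3\<close> to correct the remaining terms: the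
        threefold products have to cancel, which is associativity.\<close>
      have "gmult G (gmult G (snd p 1) (snd p 2)) (snd p 3) = gmult G (snd p 1) (gmult G (snd p 2) (snd p 3))"
        using sN[of 1] sN[of 2] sN[of 3] 5 by (intro gmult_assoc) auto
      then show ?thesis unfolding s by (simp add: P1[unfolded One_nat_def] P2 F0 F1[unfolded One_nat_def] F2 F3 mapply_diff)
    qed
  qed
  then show ?thesis by (simp only: F_def P_def)
qed

lemma differential_eq: "R 0 (object_point x) n v = (if n = 0 then mapply N N (\<lambda>i j. of_real (c x) * mid i j) v else 0)"
  by (cases "n = 0"; cases "n = 1") (simp_all add: R_def RM_def object_point_def)

lemma R_arrow: "R 1 (arrow_point G g) n = mapply (rk n) (rk n) (A g)"
  by (auto simp: R_def RM_def arrow_point_def)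

text \<open>The homotopy from degree 1 to degree 0 is \<open>A\<close> at the unit minus the
  identity. As with \<open>c_D\<close>, this difference vanishes wherever \<open>c\<close> is not 1,
  so multiplication by \<open>c\<close> does not change it.\<close>

lemma unital: "unital_up_to_homotopy G E R"
  unfolding unital_up_to_homotopy_def
proof (intro exI conjI allI ballI)
  let ?Y = "\<lambda>x n. mapply (rk (n - 1)) (rk n) (\<lambda>i j. A (unit G x) i j - mid i j)"
  fix n
  have "continuous_map (objects G) euclidean (\<lambda>x. A (unit G x) i j - mid i j)" if "i < N" "j < N" for i j
    using continuous_map_compose[OF unit_cont A_cont[OF that]]
    by (intro continuous_map_diff) (auto simp: o_def)
  then show "hom_section (objects G) (objects G) id id (E n) (E (n - 1)) (\<lambda>x. ?Y x n)"
    unfolding E_def by (intro hom_section_mapply) (auto simp: rk_le)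
  fix x v assume x: "x \<in> topspace (objects G)" and v: "v \<in> fib (E n) x"
  have Y: "mapply N N (\<lambda>i j. A (unit G x) i j - mid i j) w = act (unit G x) w - w" if "w \<in> coord_space N" for w
    using that by (simp add: mapply_matrix_diff mapply_mid)
  have c: "vscale (of_real (c x)) (act (unit G x) w - w) = act (unit G x) w - w" if "w \<in> coord_space N" for w
  proof (cases "c x = 1")
    case False
    then have "act (unit G x) w = w"
      using mapply_cong[OF A_unit[OF x False], of w] that by (simp add: mapply_mid)
    then show ?thesis by simp
  qed simp
  consider "n = 0" | "n = 1" | "n \<noteq> 0 \<and> n \<noteq> 1" by blast
  then show "R 1 (arrow_point G (unit G x)) n v - v =
      R 0 (object_point x) (n - 1) (?Y x n v) + ?Y x (n + 1) (R 0 (object_point x) n v)"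
  proof cases
    case 1
    then have vN: "v \<in> coord_space N" using v by simp
    have vc: "vscale (of_real (c x)) v \<in> coord_space N" using vN by (simp add: coord_space_def vscale_def)
    have "act (unit G x) (vscale (of_real (c x)) v) - vscale (of_real (c x)) v = act (unit G x) v - v"
      using c[OF vN] by (simp add: mapply_vscale) (simp add: vscale_def fun_eq_iff algebra_simps)
    then show ?thesis
      using 1 vN vc by (simp add: R_arrow[unfolded One_nat_def] differential_eq mapply_matrix_scale mapply_mid Y)
  next
    case 2
    then have vN: "v \<in> coord_space N" using v by simp
    have vc: "act (unit G x) v - v \<in> coord_space N"
      using vN mapply_coord_space[of N N "A (unit G x)" v] by (simp add: coord_space_def)
    show ?thesis
      using 2 vN vc c[OF vN] by (simp add: R_arrow[unfolded One_nat_def] differential_eq mapply_matrix_scale mapply_mid Y)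
  next
    case 3
    then have "v = 0" using v by (simp add: coord_space_0)
    then show ?thesis by (simp add: R_arrow[unfolded One_nat_def] differential_eq)
  qed
qed

lemma homotopy_rep: "homotopy_representation G E R"
  unfolding homotopy_representation_def
  using graded R_section R_relation unital by blast

lemma strongly_inv: "strongly_invertible G E R"
  unfolding strongly_invertible_def
proof (intro allI exI conjI ballI)
  fix n
  show "hom_section (objects G) (arrows G) (tgt G) (src G) (E n) (E n) (\<lambda>g. mapply (rk n) (rk n) (B g))"
    unfolding E_def by (intro hom_section_mapply tgt_cont src_cont B_cont) (auto simp: rk_le)
  fix g assume g: "g \<in> topspace (arrows G)"
  have "mapply (rk n) (rk n) (B g) (mapply (rk n) (rk n) (A g) v) = v \<and>
    mapply (rk n) (rk n) (A g) (mapply (rk n) (rk n) (B g) v) = v" if v: "v \<in> coord_space (rk n)" for v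
  proof (cases "n = 0 \<or> n = 1")
    case True
    then have "v \<in> coord_space N" using v by auto
    then show ?thesis
      using True A_inverse[OF g] mapply_cong[of N "mmul {..<N} (A g) (B g)" mid v]
        mapply_cong[of N "mmul {..<N} (B g) (A g)" mid v]
      by (auto simp: inverse_on_def mapply_mapply mapply_mid)
  next
    case False
    then show ?thesis using v by (simp add: coord_space_0)
  qed
  then show "\<And>v. v \<in> fib (E n) (src G g) \<Longrightarrow> mapply (rk n) (rk n) (B g) (R 1 (arrow_point G g) n v) = v"
    "\<And>w. w \<in> fib (E n) (tgt G g) \<Longrightarrow> R 1 (arrow_point G g) n (mapply (rk n) (rk n) (B g) w) = w"
    by (auto simp: R_arrow[unfolded One_nat_def])
qed

text \<open>The differential vanishes at \<open>x0\<close>, so cohomology classes are singletons,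
  cohomology is the fibre, and the isotropy representation is \<open>A\<close> itself.\<close>

lemma faithful: "faithful_isotropy_representation G E R x0"
  unfolding faithful_isotropy_representation_def
proof (rule inj_onI)
  fix g h assume g: "g \<in> carrier (isotropy_group G x0)" and h: "h \<in> carrier (isotropy_group G x0)"
    and eq: "isotropy_representation G E R x0 g = isotropy_representation G E R x0 h"
  have d: "R 0 (object_point x0) n v = 0" for n v
    by (simp add: differential_eq x0)
  have cob: "coboundaries E R x0 n = {0}" for n
  proof -
    have "R 0 (object_point x0) (n - 1) = (\<lambda>_. 0)" using d by (rule ext)
    moreover have "coord_space (rk (n - 1)) \<noteq> ({} :: 'k vect set)" using zero_coord_space by blast
    ultimately show ?thesis by (simp add: coboundaries_def image_constant_conv)
  qed
  have cls: "cohomology_class E R x0 n v = {v}" for n v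
    by (simp add: cohomology_class_def cob)
  have coh: "cohomology E R x0 n = (\<lambda>v. {v}) ` coord_space (rk n)" for n
    by (simp add: cohomology_def cocycles_def d cls)
  have act: "act g v = act h v" if v: "v \<in> coord_space N" for v
  proof -
    \<comment> \<open>Degree 0 alone detects \<open>A\<close>; the other components have to be the
      zero class \<open>{0}\<close> for \<open>z\<close> to belong to the total cohomology.\<close>
    define z where "z i = (if i = 0 then {v} else {0})" for i :: int
    have z: "z \<in> total_cohomology E R x0"
      using v by (auto simp: total_cohomology_def z_def coh)
    have "isotropy_representation G E R x0 g z 0 = isotropy_representation G E R x0 h z 0"
      using eq by simp
    then have "cohomology_map G E R g 0 (z 0) = cohomology_map G E R h 0 (z 0)"
      using z by (simp add: isotropy_representation_def)
    then show ?thesis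
      using g h by (simp add: cohomology_map_def z_def isotropy_group_def cls R_arrow[unfolded One_nat_def])
  qed
  have "eq_on {..<N} (A g) (A h)"
    unfolding eq_on_def
  proof (intro ballI)
    fix i j assume "i \<in> {..<N}" "j \<in> {..<N}"
    then show "A g i j = A h i j"
      using act[OF basis_vect_coord_space[of j N]] mapply_basis_vect[of i N j] by (metis lessThan_iff)
  qed
  then show "g = h" by (rule A_inj[OF g h])
qed

end

section \<open>Extension from a neighbourhood\<close>

lemma eq_on_of_real:
  "eq_on I M M' \<Longrightarrow> eq_on I (\<lambda>i j. of_real (M i j) :: 'k::real_normed_field) (\<lambda>i j. of_real (M' i j))"
  by (simp add: eq_on_def)

lemma mmul_of_real:
  "mmul I (\<lambda>i j. of_real (M i j) :: 'k::real_normed_field) (\<lambda>i j. of_real (M' i j)) = (\<lambda>i j. of_real (mmul I M M' i j))"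
  by (simp add: mmul_def fun_eq_iff)

lemma mid_of_real: "(\<lambda>i j. of_real (mid i j)) = (mid :: 'i \<Rightarrow> 'i \<Rightarrow> 'k::real_normed_field)"
  by (auto simp: mid_def fun_eq_iff)

lemma inverse_on_of_real:
  "inverse_on I M M' \<Longrightarrow> inverse_on I (\<lambda>i j. of_real (M i j) :: 'k::real_normed_field) (\<lambda>i j. of_real (M' i j))"
  unfolding inverse_on_def mmul_of_real using eq_on_of_real[of I _ mid, where 'k = 'k] by (auto simp: mid_of_real)

lemma inverse_on_mid_mid: "finite I \<Longrightarrow> inverse_on I mid mid"
  using mmul_mid_left by (auto simp: inverse_on_def)

lemma continuous_map_of_real:
  "continuous_map X euclideanreal f \<Longrightarrow> continuous_map X euclidean (\<lambda>x. of_real (f x) :: 'k::real_normed_field)"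
  using continuous_map_compose[of X euclideanreal f euclidean "of_real :: real \<Rightarrow> 'k"]
  by (auto simp: o_def intro!: continuous_intros)

lemma eq_on_idempotent_mid:
  assumes I: "finite I" and inv: "inverse_on I M M'" and idem: "eq_on I M (mmul I M M)"
  shows "eq_on I M mid"
proof -
  have "eq_on I (mmul I M' M) (mmul I M' (mmul I M M))" by (intro mmul_cong eq_on_refl idem)
  then have "eq_on I mid (mmul I (mmul I M' M) M)"
    using inv unfolding mmul_assoc inverse_on_def by (meson eq_on_sym eq_on_trans)
  moreover have "eq_on I (mmul I (mmul I M' M) M) (mmul I mid M)"
    using inv by (intro mmul_cong) (auto simp: inverse_on_def)
  moreover have "eq_on I (mmul I mid M) M" by (rule mmul_mid_left[OF I])
  ultimately show ?thesis by (meson eq_on_sym eq_on_trans)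
qed

text \<open>Commutativity is given for the isotropy groups but needed for the model group. The
  continuous map \<open>g\<close>, a section of the isomorphism, sends connected sets through the
  identity to such sets.\<close>

lemma essentially_abelian_transport:
  assumes f: "f \<in> iso G K" "group G" "group K" and g: "continuous_map S T g"
    and S: "topspace S = carrier K" and gf: "\<And>k. k \<in> carrier K \<Longrightarrow> g k \<in> carrier G \<and> f (g k) = k"
    and ab: "essentially_abelian G T"
  shows "essentially_abelian K S"
  unfolding essentially_abelian_def
proof (intro ballI)
  fix a b assume ab': "a \<in> connected_component_of_set S \<one>\<^bsub>K\<^esub>" "b \<in> connected_component_of_set S \<one>\<^bsub>K\<^esub>"
  have "f \<in> hom G K" "inj_on f (carrier G)" using f(1) by (auto simp: iso_def bij_betw_def)
  have one: "g \<one>\<^bsub>K\<^esub> = \<one>\<^bsub>G\<^esub>"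
  proof (rule inj_onD[OF \<open>inj_on f (carrier G)\<close>])
    show "f (g \<one>\<^bsub>K\<^esub>) = f \<one>\<^bsub>G\<^esub>"
      using gf[of "\<one>\<^bsub>K\<^esub>"] hom_one[OF \<open>f \<in> hom G K\<close> f(2,3)] f(3) by (simp add: group.is_monoid)
  qed (use gf[of "\<one>\<^bsub>K\<^esub>"] f in \<open>auto simp: group.is_monoid\<close>)
  have comp: "g x \<in> connected_component_of_set T \<one>\<^bsub>G\<^esub>" if x: "x \<in> connected_component_of_set S \<one>\<^bsub>K\<^esub>" for x
  proof -
    obtain C where C: "connectedin S C" "\<one>\<^bsub>K\<^esub> \<in> C" "x \<in> C" using x by (auto simp: connected_component_of_def)
    then have "connectedin T (g ` C)" by (intro connectedin_continuous_map_image[OF g])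
    then show ?thesis using C one by (force simp: connected_component_of_def)
  qed
  have car: "a \<in> carrier K" "b \<in> carrier K"
    using ab' connected_component_of_subset_topspace[of S "\<one>\<^bsub>K\<^esub>"] S by auto
  have "g a \<otimes>\<^bsub>G\<^esub> g b = g b \<otimes>\<^bsub>G\<^esub> g a"
    using ab comp ab' unfolding essentially_abelian_def by blast
  then have "f (g a) \<otimes>\<^bsub>K\<^esub> f (g b) = f (g b) \<otimes>\<^bsub>K\<^esub> f (g a)"
    using \<open>f \<in> hom G K\<close> gf car by (metis hom_mult)
  then show "a \<otimes>\<^bsub>K\<^esub> b = b \<otimes>\<^bsub>K\<^esub> a" using gf car by simp
qed

lemma isotropy_group_is_group:
  assumes "topological_groupoid G" "x \<in> topspace (objects G)"
  shows "group (isotropy_group G x)"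
proof -
  interpret topological_groupoid G by fact
  have ar: "gmult G g h \<in> topspace (arrows G)"
    if "g \<in> topspace (arrows G)" "h \<in> topspace (arrows G)" "src G g = tgt G h" for g h
    using continuous_map_image_subset_topspace[OF gmult_cont] that by force
  have un: "unit G x \<in> topspace (arrows G)"
    using continuous_map_image_subset_topspace[OF unit_cont] assms(2) by blast
  have gi: "ginv G g \<in> topspace (arrows G)" if "g \<in> topspace (arrows G)" for g
    using continuous_map_image_subset_topspace[OF ginv_cont] that by blast
  have ul: "gmult G (unit G x) g = g" if "g \<in> topspace (arrows G)" "tgt G g = x" for g
    using unit_left[of g] that by simp
  show ?thesis
  proof (rule groupI)
    fix g assume g: "g \<in> carrier (isotropy_group G x)"
    then have "ginv G g \<in> carrier (isotropy_group G x)" "ginv G g \<otimes>\<^bsub>isotropy_group G x\<^esub> g = \<one>\<^bsub>isotropy_group G x\<^esub>"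
      using gi by (auto simp: isotropy_group_def src_ginv tgt_ginv ginv_left)
    then show "\<exists>y\<in>carrier (isotropy_group G x). y \<otimes>\<^bsub>isotropy_group G x\<^esub> g = \<one>\<^bsub>isotropy_group G x\<^esub>" by blast
  qed (use ar un assms(2) ul in
      \<open>auto simp: isotropy_group_def src_gmult tgt_gmult src_unit tgt_unit gmult_assoc\<close>)
qed

lemma ex_bump_function:
  assumes X: "locally_compact_space X" "Hausdorff_space X" and U: "openin X U" "x \<in> U"
  obtains f where "continuous_map X euclideanreal f" "f x = 1" "\<And>y. y \<in> topspace X - U \<Longrightarrow> f y = 0"
    "\<And>y. y \<in> topspace X \<Longrightarrow> 0 \<le> f y \<and> f y \<le> 1"
proof -
  have "regular_space X" using X locally_compact_Hausdorff_imp_regular_space by blast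
  then have "completely_regular_space X" using X(1) locally_compact_regular_imp_completely_regular_space by blast
  moreover have "closedin X (topspace X - U)" "x \<in> topspace X - (topspace X - U)"
    using U openin_subset by (auto simp: closedin_diff)
  ultimately obtain g where g: "continuous_map X (top_of_set {0..1::real}) g" "g x = 0" "g ` (topspace X - U) \<subseteq> {1}"
    unfolding completely_regular_space_def by meson
  have gr: "continuous_map X euclideanreal g" "\<And>y. y \<in> topspace X \<Longrightarrow> g y \<in> {0..1}"
    using g(1) by (auto simp: continuous_map_in_subtopology)
  show thesis
  proof (rule that[of "\<lambda>y. 1 - g y"])
    show "continuous_map X euclideanreal (\<lambda>y. 1 - g y)" by (intro continuous_map_diff gr(1)) auto
  qed (use g gr(2) in auto)
qed

text \<open>With a bump function \<open>f\<close> at \<open>x0\<close>, the homotopy parameter \<open>\<tau>\<close> is \<open>1\<close> where \<open>f \<ge> 1/2\<close> and \<open>0\<close> where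
  \<open>f \<le> 1/4\<close>, while \<open>c\<close> is \<open>1\<close> where \<open>f \<le> 1/2\<close> and \<open>0\<close> at \<open>x0\<close>.\<close>

lemma ex_acyclic_extension:
  assumes G: "compact_lie_group_bundle G"
    and ab: "\<forall>x\<in>topspace (objects G). essentially_abelian (isotropy_group G x) (isotropy_topology G x)"
    and x0: "x0 \<in> topspace (objects G)"
  shows "\<exists>N (A :: 'g \<Rightarrow> nat \<Rightarrow> nat \<Rightarrow> 'k::real_normed_field) B c. acyclic_extension (G :: ('g, 'b) groupoid) N A B c x0"
proof -
  interpret locally_compact_groupoid G
    using G by (simp add: compact_lie_group_bundle_def)
  have haus: "Hausdorff_space (objects G)" and st: "\<And>g. g \<in> topspace (arrows G) \<Longrightarrow> src G g = tgt G g"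
    using G by (auto simp: compact_lie_group_bundle_def)
  have tg: "topological_groupoid G" by (rule topological_groupoid_axioms)
  obtain U and K :: "'g monoid" and T \<Phi> where U: "openin (objects G) U" "x0 \<in> U" and K: "compact_lie_group K T"
    and hom: "homeomorphic_map (subtopology (arrows G) {g. src G g \<in> U}) (prod_topology T (subtopology (objects G) U)) \<Phi>"
    and snd\<Phi>: "\<And>g. g \<in> topspace (arrows G) \<Longrightarrow> src G g \<in> U \<Longrightarrow> snd (\<Phi> g) = src G g"
    and iso: "\<And>y. y \<in> U \<Longrightarrow> (\<lambda>g. fst (\<Phi> g)) \<in> iso (isotropy_group G y) K"
    using G x0 unfolding compact_lie_group_bundle_def by metis
  interpret K: compact_top_group K T by (rule compact_lie_group_imp_compact_top_group[OF K])
  have UX: "U \<subseteq> topspace (objects G)" using U openin_subset by blast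
  let ?GU = "subtopology (arrows G) {g. src G g \<in> U}"
  let ?P = "prod_topology T (subtopology (objects G) U)"
  obtain \<Psi> where \<Psi>: "homeomorphic_maps ?GU ?P \<Phi> \<Psi>" using hom homeomorphic_map_maps by blast
  define h where "h g = fst (\<Phi> g)" for g
  have h_cont: "continuous_map ?GU T h"
    using continuous_map_compose[OF homeomorphic_imp_continuous_map[OF hom] continuous_map_fst]
    by (simp add: o_def h_def[abs_def])
  have iso_h: "h \<in> iso (isotropy_group G y) K" if "y \<in> U" for y
    using iso[OF that] by (simp add: h_def[abs_def])
  have iso_mem: "g \<in> carrier (isotropy_group G (src G g))" if "g \<in> topspace (arrows G)" for g
    using that st by (simp add: isotropy_group_def)
  have h_car: "h g \<in> carrier K" if "g \<in> topspace (arrows G)" "src G g \<in> U" for g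
    using iso_h[OF that(2)] iso_mem[OF that(1)] by (auto simp: iso_def hom_def)
  \<comment> \<open>The slice of the trivialization over \<open>x0\<close> provides the continuous
    section of \<open>h\<close>.\<close>
  have abK: "essentially_abelian K T"
  proof (rule essentially_abelian_transport[where G = "isotropy_group G x0" and f = h and g = "\<lambda>k. \<Psi> (k, x0)" and T = "isotropy_topology G x0"])
    have mem: "(k, x0) \<in> topspace ?P" if "k \<in> carrier K" for k
      using that U x0 by (simp add: K.topspace_eq)
    have \<Psi>m: "\<Psi> (k, x0) \<in> topspace ?GU" "\<Phi> (\<Psi> (k, x0)) = (k, x0)" if "k \<in> carrier K" for k
    proof -
      have "continuous_map ?P ?GU \<Psi>" "\<And>y. y \<in> topspace ?P \<Longrightarrow> \<Phi> (\<Psi> y) = y"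
        using \<Psi> unfolding homeomorphic_maps_def by blast+
      then show "\<Psi> (k, x0) \<in> topspace ?GU" "\<Phi> (\<Psi> (k, x0)) = (k, x0)"
        using continuous_map_image_subset_topspace[of ?P ?GU \<Psi>] mem[OF that] by blast+
    qed
    have \<Psi>c: "\<Psi> (k, x0) \<in> carrier (isotropy_group G x0) \<and> h (\<Psi> (k, x0)) = k" if "k \<in> carrier K" for k
    proof -
      have "src G (\<Psi> (k, x0)) = x0"
        using snd\<Phi>[of "\<Psi> (k, x0)"] \<Psi>m[OF that] by simp
      then show ?thesis using \<Psi>m[OF that] st by (auto simp: isotropy_group_def h_def)
    qed
    then show "\<And>k. k \<in> carrier K \<Longrightarrow> \<Psi> (k, x0) \<in> carrier (isotropy_group G x0) \<and> h (\<Psi> (k, x0)) = k" .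
    have "continuous_map T ?P (\<lambda>k. (k, x0))"
      using U x0 by (intro continuous_map_pairedI) (auto intro: continuous_map_id[unfolded id_def])
    moreover have "continuous_map ?P ?GU \<Psi>" using \<Psi> by (simp add: homeomorphic_maps_def)
    ultimately have "continuous_map T ?GU (\<lambda>k. \<Psi> (k, x0))"
      using continuous_map_compose[of T ?P "\<lambda>k. (k, x0)" ?GU \<Psi>] by (simp add: o_def)
    then show "continuous_map T (isotropy_topology G x0) (\<lambda>k. \<Psi> (k, x0))"
      using \<Psi>c by (auto simp: isotropy_topology_def continuous_map_in_subtopology K.topspace_eq)
  qed (use iso_h U(2) isotropy_group_is_group[OF tg x0] K.topspace_eq ab x0 K.group_axioms in auto)
  obtain N and M M' :: "real \<Rightarrow> 'g \<Rightarrow> nat \<Rightarrow> nat \<Rightarrow> real" where M: "null_homotopic_rep K T {..<N} M M'"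
    using compact_lie_group_null_homotopic_rep[OF K abK] .
  then have M_inverse: "\<And>t k. t \<in> {0..1} \<Longrightarrow> k \<in> carrier K \<Longrightarrow> inverse_on {..<N} (M t k) (M' t k)"
    and M_zero: "\<And>k. k \<in> carrier K \<Longrightarrow> eq_on {..<N} (M 0 k) mid"
    and M_mult: "\<And>k l. k \<in> carrier K \<Longrightarrow> l \<in> carrier K \<Longrightarrow> eq_on {..<N} (M 1 (k \<otimes>\<^bsub>K\<^esub> l)) (mmul {..<N} (M 1 k) (M 1 l))"
    and M_inj: "\<And>k l. k \<in> carrier K \<Longrightarrow> l \<in> carrier K \<Longrightarrow> eq_on {..<N} (M 1 k) (M 1 l) \<Longrightarrow> k = l"
    by (simp_all add: null_homotopic_rep_def)
  obtain f where f: "continuous_map (objects G) euclideanreal f" "f x0 = 1"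
      "\<And>y. y \<in> topspace (objects G) - U \<Longrightarrow> f y = 0" "\<And>y. y \<in> topspace (objects G) \<Longrightarrow> 0 \<le> f y \<and> f y \<le> 1"
    using ex_bump_function[OF objects_locally_compact haus U] by blast
  define \<tau> where "\<tau> x = max 0 (min 1 (4 * f x - 1))" for x
  define c where "c x = min 1 (2 - 2 * f x)" for x
  have \<tau>01: "\<tau> x \<in> {0..1}" for x by (simp add: \<tau>_def)
  have \<tau>_cont: "continuous_map (objects G) euclideanreal \<tau>"
    unfolding \<tau>_def by (intro continuous_map_real_max continuous_map_real_min continuous_map_diff continuous_map_real_mult_left f(1)) auto
  have c_cont: "continuous_map (objects G) euclideanreal c"
    unfolding c_def by (intro continuous_map_real_min continuous_map_diff continuous_map_real_mult_left f(1)) auto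
  \<comment> \<open>\<open>c x \<noteq> 1\<close> forces \<open>f x > 1/2\<close>, hence
    \<open>4 * f x - 1 > 1\<close>; and \<open>f\<close> vanishes outside \<open>U\<close>.\<close>
  have c1: "\<tau> x = 1 \<and> x \<in> U" if "x \<in> topspace (objects G)" "c x \<noteq> 1" for x
    using that f(3)[of x] by (force simp: c_def \<tau>_def)
  \<comment> \<open>Stated for a general family \<open>L\<close>, so that one continuity argument
    serves \<open>M\<close> and \<open>M'\<close>. The matrices are real; \<open>of_real\<close>
    carries them to the scalars.\<close>
  define ext where "ext L g = (\<lambda>i j. of_real (if src G g \<in> U then L (\<tau> (src G g)) (h g) i j else mid i j) :: 'k)"
    for L :: "real \<Rightarrow> 'g \<Rightarrow> nat \<Rightarrow> nat \<Rightarrow> real" and g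
  have src_mem: "src G g \<in> topspace (objects G)" if "g \<in> topspace (arrows G)" for g
    using continuous_map_image_subset_topspace[OF src_cont] that by blast
  have ext_cont: "continuous_map (arrows G) euclidean (\<lambda>g. ext L g i j)"
    if L: "continuous_map (prod_topology (top_of_set {0..1}) T) euclideanreal (\<lambda>(t, g). L t g i j)"
      and L0: "\<And>g. g \<in> carrier K \<Longrightarrow> L 0 g i j = mid i j" for L i j
  proof -
    \<comment> \<open>The two open sets cover because \<open>f\<close> vanishes outside
      \<open>U\<close>. On their overlap \<open>\<tau>\<close> is 0, and \<open>L 0\<close> has the
      entries of the identity there.\<close>
    let ?O = "\<lambda>b. if b then {g \<in> topspace (arrows G). src G g \<in> U} else {g \<in> topspace (arrows G). f (src G g) \<in> {..<1/4}}"
    let ?L = "\<lambda>b g. if b then L (\<tau> (src G g)) (h g) i j else mid i j"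
    have "continuous_map (arrows G) euclideanreal (\<lambda>g. ?L (src G g \<in> U) g)"
    proof (rule pasting_lemma[where I = UNIV and T = ?O and f = ?L])
      show "openin (arrows G) (?O b)" for b
        using openin_continuous_map_preimage[OF src_cont U(1)]
          openin_continuous_map_preimage[OF continuous_map_compose[OF src_cont f(1)], of "{..<1/4}"]
        by (cases b) (auto simp: o_def)
      have c: "continuous_map ?GU euclideanreal (?L True)"
      proof -
        have "continuous_map (arrows G) (top_of_set {0..1}) (\<lambda>g. \<tau> (src G g))"
          using continuous_map_compose[OF src_cont \<tau>_cont] \<tau>01 by (auto simp: continuous_map_in_subtopology o_def)
        then have "continuous_map ?GU (prod_topology (top_of_set {0..1}) T) (\<lambda>g. (\<tau> (src G g), h g))"
          by (intro continuous_map_pairedI continuous_map_from_subtopology[of "arrows G"] h_cont)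
        from continuous_map_compose[OF this L] show ?thesis by (simp add: o_def)
      qed
      have "{g \<in> topspace (arrows G). src G g \<in> U} = topspace (arrows G) \<inter> {g. src G g \<in> U}"
        by blast
      then have "?GU = subtopology (arrows G) (?O True)"
        by (simp only: subtopology_restrict if_True)
      then show "continuous_map (subtopology (arrows G) (?O b)) euclideanreal (?L b)" for b
        using c by (cases b) auto
      have "?L True g = mid i j" if "g \<in> topspace (arrows G)" "src G g \<in> U" "f (src G g) < 1/4" for g
      proof -
        have "\<tau> (src G g) = 0" using that(3) by (simp add: \<tau>_def)
        then show ?thesis using L0[OF h_car[OF that(1,2)]] by simp
      qed
      then show "?L b g = ?L b' g" if "g \<in> topspace (arrows G) \<inter> ?O b \<inter> ?O b'" for b b' g
        using that by (cases b; cases b') auto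
      show "\<exists>b. b \<in> UNIV \<and> g \<in> ?O b \<and> ?L (src G g \<in> U) g = ?L b g" if "g \<in> topspace (arrows G)" for g
        using that f(3)[of "src G g"] src_mem[OF that] by (intro exI[of _ "src G g \<in> U"]) auto
    qed
    then show ?thesis unfolding ext_def by (rule continuous_map_of_real)
  qed
  have ext_inverse: "inverse_on {..<N} (ext M g) (ext M' g)" if g: "g \<in> topspace (arrows G)" for g
  proof (cases "src G g \<in> U")
    case True
    then have "inverse_on {..<N} (M (\<tau> (src G g)) (h g)) (M' (\<tau> (src G g)) (h g))"
      using h_car[OF g True] \<tau>01 by (intro M_inverse)
    then show ?thesis using True inverse_on_of_real by (simp add: ext_def)
  next
    case False
    then show ?thesis by (simp add: ext_def mid_of_real inverse_on_mid_mid)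
  qed
  \<comment> \<open>The inverse path has to start at the identity as well, since \<open>M'\<close>
    is also extended by the identity.\<close>
  have M0: "M 0 k i j = mid i j" "M' 0 k i j = mid i j" if "k \<in> carrier K" "i < N" "j < N" for k i j
  proof -
    have 1: "eq_on {..<N} (M 0 k) mid" and inv: "inverse_on {..<N} (M 0 k) (M' 0 k)"
      using that by (auto intro: M_zero M_inverse)
    have "eq_on {..<N} (mmul {..<N} (M 0 k) (M' 0 k)) (mmul {..<N} mid (M' 0 k))"
      by (intro mmul_cong 1 eq_on_refl)
    moreover have "eq_on {..<N} (mmul {..<N} mid (M' 0 k)) (M' 0 k)" by (rule mmul_mid_left) simp
    ultimately have 2: "eq_on {..<N} (M' 0 k) mid" using inv unfolding inverse_on_def by (meson eq_on_sym eq_on_trans)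
    show "M 0 k i j = mid i j" "M' 0 k i j = mid i j" using 1 2 that by (auto simp: eq_on_def)
  qed
  have ext1: "ext M g = (\<lambda>i j. of_real (M 1 (h g) i j))" if "g \<in> topspace (arrows G)" "c (src G g) \<noteq> 1" for g
    using c1[OF src_mem[OF that(1)] that(2)] by (simp add: ext_def)
  have ext_mult: "eq_on {..<N} (ext M (gmult G g k)) (mmul {..<N} (ext M g) (ext M k))"
    if gk: "g \<in> topspace (arrows G)" "k \<in> topspace (arrows G)" "src G g = tgt G k" "c (src G g) \<noteq> 1" for g k
  proof -
    have k: "src G k = src G g" "src G (gmult G g k) = src G g" using st[OF gk(2)] gk src_gmult by auto
    have mem: "gmult G g k \<in> topspace (arrows G)"
      using continuous_map_image_subset_topspace[OF gmult_cont] gk by force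
    have sU: "src G g \<in> U" using c1[OF src_mem[OF gk(1)] gk(4)] by simp
    have "h (gmult G g k) = h g \<otimes>\<^bsub>K\<^esub> h k"
    proof -
      have "h \<in> hom (isotropy_group G (src G g)) K" using iso_h[OF sU] by (simp add: iso_def)
      from hom_mult[OF this, of g k] show ?thesis
        using iso_mem[OF gk(1)] iso_mem[OF gk(2)] k by (simp add: isotropy_group_def)
    qed
    moreover have "eq_on {..<N} (M 1 (h g \<otimes>\<^bsub>K\<^esub> h k)) (mmul {..<N} (M 1 (h g)) (M 1 (h k)))"
      using h_car gk sU k by (intro M_mult) auto
    ultimately show ?thesis
      using eq_on_of_real[where 'k = 'k] ext1[OF gk(1,4)] ext1[OF gk(2)] ext1[OF mem] k gk(4) by (simp add: mmul_of_real)
  qed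
  have "acyclic_extension G N (ext M) (ext M') c x0"
  proof (intro acyclic_extension.intro tg acyclic_extension_axioms.intro)
    show "c x0 = 0" using f(2) by (simp add: c_def)
    show "\<And>i j. i < N \<Longrightarrow> j < N \<Longrightarrow> continuous_map (arrows G) euclidean (\<lambda>g. ext M g i j)"
      using M M0 by (intro ext_cont) (auto simp: null_homotopic_rep_def)
    show "\<And>i j. i < N \<Longrightarrow> j < N \<Longrightarrow> continuous_map (arrows G) euclidean (\<lambda>g. ext M' g i j)"
      using M M0 by (intro ext_cont) (auto simp: null_homotopic_rep_def)
  next
    fix x assume x: "x \<in> topspace (objects G)" "c x \<noteq> 1"
    have u: "unit G x \<in> topspace (arrows G)" "src G (unit G x) = x" "tgt G (unit G x) = x"
      using continuous_map_image_subset_topspace[OF unit_cont] x src_unit tgt_unit by auto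
    \<comment> \<open>A unit is idempotent, and an invertible idempotent matrix is the identity;
      multiplicativity thus yields the condition at units.\<close>
    have "gmult G (unit G x) (unit G x) = unit G x" using unit_left[OF u(1)] u by simp
    then have "eq_on {..<N} (ext M (unit G x)) (mmul {..<N} (ext M (unit G x)) (ext M (unit G x)))"
      using ext_mult[of "unit G x" "unit G x"] u x by simp
    then show "eq_on {..<N} (ext M (unit G x)) mid"
      by (intro eq_on_idempotent_mid[OF _ ext_inverse[OF u(1)]]) auto
  next
    fix g k assume gk: "g \<in> carrier (isotropy_group G x0)" "k \<in> carrier (isotropy_group G x0)"
      and eq: "eq_on {..<N} (ext M g) (ext M k)"
    have s: "src G g = x0" "src G k = x0" "g \<in> topspace (arrows G)" "k \<in> topspace (arrows G)"
      using gk by (auto simp: isotropy_group_def)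
    have "c x0 \<noteq> 1" using f(2) by (simp add: c_def)
    then have "eq_on {..<N} (M 1 (h g)) (M 1 (h k))"
      using eq ext1[of g] ext1[of k] s by (simp add: eq_on_def)
    then have "h g = h k"
      using h_car[of g] h_car[of k] s U(2) by (intro M_inj) auto
    moreover have "inj_on h (carrier (isotropy_group G x0))"
      using iso_h[OF U(2)] by (simp add: iso_def bij_betw_def)
    ultimately show "g = k" using gk by (auto dest: inj_onD)
  qed (use st c_cont ext_inverse ext_mult x0 in auto)
  then show ?thesis by blast
qed

theorem corollary5:
  fixes G :: "('g, 'b) groupoid" and x0 :: 'b
  assumes "compact_lie_group_bundle G"
    and "\<forall>x\<in>topspace (objects G). essentially_abelian (isotropy_group G x) (isotropy_topology G x)"
    and "x0 \<in> topspace (objects G)"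
  shows "(\<exists>(E :: ('b, real) graded_bundle) R.
            homotopy_representation G E R \<and> strongly_invertible G E R \<and>
            faithful_isotropy_representation G E R x0) \<and>
         (\<exists>(E :: ('b, complex) graded_bundle) R.
            homotopy_representation G E R \<and> strongly_invertible G E R \<and>
            faithful_isotropy_representation G E R x0)"
proof
  obtain N and A B :: "'g \<Rightarrow> nat \<Rightarrow> nat \<Rightarrow> real" and c where "acyclic_extension G N A B c x0"
    using ex_acyclic_extension[OF assms, where 'k = real] by blast
  then interpret r: acyclic_extension G N A B c x0 .
  show "\<exists>(E :: ('b, real) graded_bundle) R. homotopy_representation G E R \<and> strongly_invertible G E R \<and>
      faithful_isotropy_representation G E R x0"
    using r.homotopy_rep r.strongly_inv r.faithful by blast
next
  obtain N and A B :: "'g \<Rightarrow> nat \<Rightarrow> nat \<Rightarrow> complex" and c where "acyclic_extension G N A B c x0"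
    using ex_acyclic_extension[OF assms, where 'k = complex] by blast
  then interpret r: acyclic_extension G N A B c x0 .
  show "\<exists>(E :: ('b, complex) graded_bundle) R. homotopy_representation G E R \<and> strongly_invertible G E R \<and>
      faithful_isotropy_representation G E R x0"
    using r.homotopy_rep r.strongly_inv r.faithful by blast
qed

end
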